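(* Let $B\in\mathbb R$ and let $(M,g,J)$ be a connected Kähler manifold of real dimension $2m\geq 4$ which is $\mathrm{C}_{\mathbb C}(B)$. Suppose in addition that there exists $A\in\mathrm{Sol}(g,J)$ such that either the number of nonconstant eigenvalues of $A$ is $\geq 2$, or the number of (distinct) constant eigenvalues of $A$ is $\geq 3$. Then $D(g,J)\geq 3$.
   Context: $\nabla$ is the Levi-Civita connection of $g$; $X^\flat=g(X,\cdot)$, $JX^\flat:=(JX)^\flat$, and $(\alpha\otimes V)(Y)=\alpha(Y)V$. An endomorphism of $TM$ is hermitian if it is $g$-symmetric and commutes with $J$. $\mathrm{Sol}(g,J)$ is the real vector space of hermitian endomorphisms $A$ of $TM$ for which there is a vector field $\Lambda$ (necessarily $\Lambda=\frac14\mathrm{grad}_g\mathrm{tr}A$) with $\nabla_X A=X^\flat\otimes\Lambda+\Lambda^\flat\otimes X+JX^\flat\otimes J\Lambda+J\Lambda^\flat\otimes JX$ for all $X$. The mobility is $D(g,J)=\dim\mathrm{Sol}(g,J)$. Eigenvalues of $A\in\mathrm{Sol}(g,J)$ are regarded as functions on $M$; they are continuous, and on a dense open subset they are smooth and the nonconstant ones have complex multiplicity one. $(g,J)$ is called $\mathrm{C}_{\mathbb C}(B)$ if there is a triple $(A,\Lambda,\mu)$ ($A$ a hermitian endomorphism, $\Lambda$ a vector field not identically zero, $\mu$ a function) with $\nabla_X A=X^\flat\otimes\Lambda+\Lambda^\flat\otimes X+JX^\flat\otimes J\Lambda+J\Lambda^\flat\otimes JX$ for all $X$, $\nabla\Lambda=\mu\,\mathrm{Id}+BA$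 and $\nabla\mu=2B\Lambda^\flat$. *)

theory Defs
  imports "HOL-Analysis.Analysis" "HOL-Library.Function_Algebras" "HOL-Library.Extended_Nat"
begin

text \<open>Pointwise scalar multiplication, so that the library's \<^const>\<open>span\<close> and \<^const>\<open>dim\<close>
  apply to spaces of tangent vectors and of tensor fields.\<close>

instantiation "fun" :: (type, real_vector) real_vector
begin

definition scaleR_fun :: "real \<Rightarrow> ('a \<Rightarrow> 'b) \<Rightarrow> 'a \<Rightarrow> 'b"
  where "scaleR_fun r f = (\<lambda>x. r *\<^sub>R f x)"

instance
  by standard (simp_all add: scaleR_fun_def fun_eq_iff scaleR_add_right scaleR_add_left)

end


section \<open>Smooth manifolds\<close>

text \<open>These two notions are meant for open \<open>S\<close>.\<close>

fun times_differentiable_on ::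
    "nat \<Rightarrow> 'a::real_normed_vector set \<Rightarrow> ('a \<Rightarrow> 'b::real_normed_vector) \<Rightarrow> bool"
  where
    "times_differentiable_on 0 S f \<longleftrightarrow> continuous_on S f"
  | "times_differentiable_on (Suc n) S f \<longleftrightarrow>
       (\<forall>x\<in>S. f differentiable (at x)) \<and>
       (\<forall>v. times_differentiable_on n S (\<lambda>x. frechet_derivative f (at x) v))"

definition smooth_on :: "'a::real_normed_vector set \<Rightarrow> ('a \<Rightarrow> 'b::real_normed_vector) \<Rightarrow> bool"
  where "smooth_on S f \<longleftrightarrow> (\<forall>n. times_differentiable_on n S f)"

text \<open>A chart is a pair of an open domain and a coordinate map into the Euclidean space \<open>'e\<close>.
  The manifold is the union of the chart domains, an open subset of the ambient Hausdorff second
  countable space \<open>'a\<close>; its dimension is \<open>DIM('e)\<close>.\<close>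

type_synonym ('a, 'e) atlas = "('a set \<times> ('a \<Rightarrow> 'e)) set"

definition smooth_manifold ::
    "('a::{t2_space,second_countable_topology}, 'e::euclidean_space) atlas \<Rightarrow> bool"
  where "smooth_manifold \<A> \<longleftrightarrow>
    (\<forall>(U, \<phi>)\<in>\<A>. open U \<and> open (\<phi> ` U) \<and> homeomorphism U (\<phi> ` U) \<phi> (inv_into U \<phi>)) \<and>
    (\<forall>(U, \<phi>)\<in>\<A>. \<forall>(V, \<psi>)\<in>\<A>. smooth_on (\<phi> ` (U \<inter> V)) (\<psi> \<circ> inv_into U \<phi>))"

definition manifold_carrier :: "('a, 'e) atlas \<Rightarrow> 'a set"
  where "manifold_carrier \<A> = (\<Union>(U, \<phi>)\<in>\<A>. U)"

text \<open>The values of a smooth function off the manifold are irrelevant.\<close>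

definition smooth_functions :: "('a, 'e::euclidean_space) atlas \<Rightarrow> ('a \<Rightarrow> real) set"
  where "smooth_functions \<A> = {f. \<forall>(U, \<phi>)\<in>\<A>. smooth_on (\<phi> ` U) (f \<circ> inv_into U \<phi>)}"


section \<open>Vector fields and endomorphism fields\<close>

text \<open>Tangent vectors are derivations of the algebra of smooth functions at a point. As
  functionals on all functions they are set to zero on the non-smooth ones, and fields are set to
  zero outside their domain, so that equality in HOL is the intended equality.\<close>

type_synonym 'a tvec = "('a \<Rightarrow> real) \<Rightarrow> real"
type_synonym 'a vfield = "'a \<Rightarrow> 'a tvec"
type_synonym 'a endo = "'a \<Rightarrow> 'a tvec \<Rightarrow> 'a tvec"
type_synonym 'a metric = "'a \<Rightarrow> 'a tvec \<Rightarrow> 'a tvec \<Rightarrow> real"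
type_synonym 'a connection = "'a vfield \<Rightarrow> 'a vfield \<Rightarrow> 'a vfield"

definition tangent_space :: "('a, 'e::euclidean_space) atlas \<Rightarrow> 'a \<Rightarrow> 'a tvec set"
  where "tangent_space \<A> p = {v.
    (\<forall>f. f \<notin> smooth_functions \<A> \<longrightarrow> v f = 0) \<and>
    (\<forall>f\<in>smooth_functions \<A>. \<forall>h\<in>smooth_functions \<A>. v (\<lambda>x. f x + h x) = v f + v h) \<and>
    (\<forall>f\<in>smooth_functions \<A>. \<forall>c. v (\<lambda>x. c * f x) = c * v f) \<and>
    (\<forall>f\<in>smooth_functions \<A>. \<forall>h\<in>smooth_functions \<A>.
       v (\<lambda>x. f x * h x) = f p * v h + h p * v f)}"

definition vector_fields :: "('a, 'e::euclidean_space) atlas \<Rightarrow> 'a vfield set"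
  where "vector_fields \<A> = {X.
    (\<forall>p\<in>manifold_carrier \<A>. X p \<in> tangent_space \<A> p) \<and>
    (\<forall>p. p \<notin> manifold_carrier \<A> \<longrightarrow> X p = 0) \<and>
    (\<forall>f\<in>smooth_functions \<A>. (\<lambda>p. X p f) \<in> smooth_functions \<A>)}"

definition lie_bracket :: "'a vfield \<Rightarrow> 'a vfield \<Rightarrow> 'a vfield"
  where "lie_bracket X Y = (\<lambda>p f. X p (\<lambda>q. Y q f) - Y p (\<lambda>q. X q f))"

definition fscale :: "('a \<Rightarrow> real) \<Rightarrow> 'a vfield \<Rightarrow> 'a vfield"
  where "fscale f X = (\<lambda>p. f p *\<^sub>R X p)"

definition app :: "'a endo \<Rightarrow> 'a vfield \<Rightarrow> 'a vfield"
  where "app A X = (\<lambda>p. A p (X p))"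

definition endo_fields :: "('a, 'e::euclidean_space) atlas \<Rightarrow> 'a endo set"
  where "endo_fields \<A> = {A.
    (\<forall>p v. p \<notin> manifold_carrier \<A> \<or> v \<notin> tangent_space \<A> p \<longrightarrow> A p v = 0) \<and>
    (\<forall>p\<in>manifold_carrier \<A>. \<forall>v\<in>tangent_space \<A> p. A p v \<in> tangent_space \<A> p \<and>
       (\<forall>w\<in>tangent_space \<A> p. A p (v + w) = A p v + A p w) \<and>
       (\<forall>c. A p (c *\<^sub>R v) = c *\<^sub>R A p v)) \<and>
    (\<forall>X\<in>vector_fields \<A>. app A X \<in> vector_fields \<A>)}"


section \<open>Kaehler manifolds\<close>

definition riemannian_metric :: "('a, 'e::euclidean_space) atlas \<Rightarrow> 'a metric \<Rightarrow> bool"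
  where "riemannian_metric \<A> g \<longleftrightarrow>
    (\<forall>p\<in>manifold_carrier \<A>. \<forall>u\<in>tangent_space \<A> p.
       (\<forall>v\<in>tangent_space \<A> p. g p u v = g p v u \<and>
          (\<forall>w\<in>tangent_space \<A> p. g p (u + v) w = g p u w + g p v w) \<and>
          (\<forall>c. g p (c *\<^sub>R u) v = c * g p u v)) \<and>
       (u \<noteq> 0 \<longrightarrow> g p u u > 0)) \<and>
    (\<forall>X\<in>vector_fields \<A>. \<forall>Y\<in>vector_fields \<A>.
       (\<lambda>p. g p (X p) (Y p)) \<in> smooth_functions \<A>)"

definition affine_connection :: "('a, 'e::euclidean_space) atlas \<Rightarrow> 'a connection \<Rightarrow> bool"
  where "affine_connection \<A> nabla \<longleftrightarrow>
    (\<forall>X\<in>vector_fields \<A>. \<forall>Y\<in>vector_fields \<A>. nabla X Y \<in> vector_fields \<A> \<and>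
       (\<forall>Z\<in>vector_fields \<A>.
          nabla (X + Y) Z = nabla X Z + nabla Y Z \<and> nabla X (Y + Z) = nabla X Y + nabla X Z) \<and>
       (\<forall>f\<in>smooth_functions \<A>.
          nabla (fscale f X) Y = fscale f (nabla X Y) \<and>
          nabla X (fscale f Y) = fscale f (nabla X Y) + fscale (\<lambda>p. X p f) Y))"

definition levi_civita ::
    "('a, 'e::euclidean_space) atlas \<Rightarrow> 'a metric \<Rightarrow> 'a connection \<Rightarrow> bool"
  where "levi_civita \<A> g nabla \<longleftrightarrow> affine_connection \<A> nabla \<and>
    (\<forall>X\<in>vector_fields \<A>. \<forall>Y\<in>vector_fields \<A>. nabla X Y - nabla Y X = lie_bracket X Y) \<and>
    (\<forall>X\<in>vector_fields \<A>. \<forall>Y\<in>vector_fields \<A>. \<forall>Z\<in>vector_fields \<A>. \<forall>p\<in>manifold_carrier \<A>.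
       X p (\<lambda>q. g q (Y q) (Z q)) = g p (nabla X Y p) (Z p) + g p (Y p) (nabla X Z p))"

definition cov_deriv_endo :: "'a connection \<Rightarrow> 'a vfield \<Rightarrow> 'a endo \<Rightarrow> 'a vfield \<Rightarrow> 'a vfield"
  where "cov_deriv_endo nabla X A Y = nabla X (app A Y) - app A (nabla X Y)"

text \<open>Integrability of \<open>J\<close> and closedness of the Kaehler form both follow from \<open>nabla J = 0\<close>.
  The Levi-Civita connection is carried along as an argument; its values on vector fields are
  determined by \<open>g\<close>.\<close>

definition kaehler_manifold ::
    "('a::{t2_space,second_countable_topology}, 'e::euclidean_space) atlas \<Rightarrow>
     'a metric \<Rightarrow> 'a endo \<Rightarrow> 'a connection \<Rightarrow> bool"
  where "kaehler_manifold \<A> g J nabla \<longleftrightarrow>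
    smooth_manifold \<A> \<and> riemannian_metric \<A> g \<and> levi_civita \<A> g nabla \<and>
    J \<in> endo_fields \<A> \<and>
    (\<forall>p\<in>manifold_carrier \<A>. \<forall>u\<in>tangent_space \<A> p.
       J p (J p u) = - u \<and> (\<forall>v\<in>tangent_space \<A> p. g p (J p u) (J p v) = g p u v)) \<and>
    (\<forall>X\<in>vector_fields \<A>. \<forall>Y\<in>vector_fields \<A>. cov_deriv_endo nabla X J Y = 0)"


section \<open>C-projective mobility\<close>

definition hermitian ::
    "('a, 'e::euclidean_space) atlas \<Rightarrow> 'a metric \<Rightarrow> 'a endo \<Rightarrow> 'a endo \<Rightarrow> bool"
  where "hermitian \<A> g J A \<longleftrightarrow> A \<in> endo_fields \<A> \<and>
    (\<forall>p\<in>manifold_carrier \<A>. \<forall>u\<in>tangent_space \<A> p.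
       A p (J p u) = J p (A p u) \<and> (\<forall>v\<in>tangent_space \<A> p. g p (A p u) v = g p u (A p v)))"

definition flat :: "'a metric \<Rightarrow> 'a vfield \<Rightarrow> 'a \<Rightarrow> 'a tvec \<Rightarrow> real"
  where "flat g X = (\<lambda>p v. g p (X p) v)"

definition tensor :: "('a \<Rightarrow> 'a tvec \<Rightarrow> real) \<Rightarrow> 'a vfield \<Rightarrow> 'a endo"
  where "tensor \<alpha> V = (\<lambda>p v. \<alpha> p v *\<^sub>R V p)"

definition mobility_equation ::
    "('a, 'e::euclidean_space) atlas \<Rightarrow> 'a metric \<Rightarrow> 'a endo \<Rightarrow> 'a connection \<Rightarrow>
     'a endo \<Rightarrow> 'a vfield \<Rightarrow> bool"
  where "mobility_equation \<A> g J nabla A \<Lambda> \<longleftrightarrow>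
    (\<forall>X\<in>vector_fields \<A>. \<forall>Y\<in>vector_fields \<A>.
       cov_deriv_endo nabla X A Y =
       app (tensor (flat g X) \<Lambda> + tensor (flat g \<Lambda>) X
          + tensor (flat g (app J X)) (app J \<Lambda>) + tensor (flat g (app J \<Lambda>)) (app J X)) Y)"

definition Sol ::
    "('a, 'e::euclidean_space) atlas \<Rightarrow> 'a metric \<Rightarrow> 'a endo \<Rightarrow> 'a connection \<Rightarrow> 'a endo set"
  where "Sol \<A> g J nabla =
    {A. hermitian \<A> g J A \<and> (\<exists>\<Lambda>\<in>vector_fields \<A>. mobility_equation \<A> g J nabla A \<Lambda>)}"

text \<open>The library's \<^const>\<open>dim\<close> is 0 on infinite-dimensional spaces, hence the case distinction.\<close>

definition mobility ::
    "('a, 'e::euclidean_space) atlas \<Rightarrow> 'a metric \<Rightarrow> 'a endo \<Rightarrow> 'a connection \<Rightarrow> enat"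
  where "mobility \<A> g J nabla =
    (if \<exists>S. finite S \<and> Sol \<A> g J nabla \<subseteq> span S then enat (dim (Sol \<A> g J nabla)) else \<infinity>)"

definition C_C ::
    "('a, 'e::euclidean_space) atlas \<Rightarrow> 'a metric \<Rightarrow> 'a endo \<Rightarrow> 'a connection \<Rightarrow> real \<Rightarrow> bool"
  where "C_C \<A> g J nabla B \<longleftrightarrow>
    (\<exists>A \<Lambda> \<mu>. hermitian \<A> g J A \<and>
       \<Lambda> \<in> vector_fields \<A> \<and> (\<exists>p\<in>manifold_carrier \<A>. \<Lambda> p \<noteq> 0) \<and>
       \<mu> \<in> smooth_functions \<A> \<and>
       mobility_equation \<A> g J nabla A \<Lambda> \<and>
       (\<forall>X\<in>vector_fields \<A>. nabla X \<Lambda> = fscale \<mu> X + B *\<^sub>R app A X) \<and>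
       (\<forall>X\<in>vector_fields \<A>. \<forall>p\<in>manifold_carrier \<A>. X p \<mu> = 2 * B * flat g \<Lambda> p (X p)))"

text \<open>Eigenvalues as continuous functions on the manifold (set to zero outside it).\<close>

definition eigenvalue_functions ::
    "('a::topological_space, 'e::euclidean_space) atlas \<Rightarrow> 'a endo \<Rightarrow> ('a \<Rightarrow> real) set"
  where "eigenvalue_functions \<A> A = {ev.
    continuous_on (manifold_carrier \<A>) ev \<and>
    (\<forall>p. p \<notin> manifold_carrier \<A> \<longrightarrow> ev p = 0) \<and>
    (\<forall>p\<in>manifold_carrier \<A>. \<exists>v\<in>tangent_space \<A> p. v \<noteq> 0 \<and> A p v = ev p *\<^sub>R v)}"

definition constant_eigenvalues ::
    "('a::topological_space, 'e::euclidean_space) atlas \<Rightarrow> 'a endo \<Rightarrow> ('a \<Rightarrow> real) set"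
  where "constant_eigenvalues \<A> A =
    {ev \<in> eigenvalue_functions \<A> A. ev constant_on manifold_carrier \<A>}"

definition nonconstant_eigenvalues ::
    "('a::topological_space, 'e::euclidean_space) atlas \<Rightarrow> 'a endo \<Rightarrow> ('a \<Rightarrow> real) set"
  where "nonconstant_eigenvalues \<A> A =
    {ev \<in> eigenvalue_functions \<A> A. \<not> ev constant_on manifold_carrier \<A>}"

end

theory Submission
  imports Defs
begin

text \<open>Suppose the mobility is at most 2, so that \<open>Sol\<close> is spanned by \<open>Id\<close> and any nontrivial solution \<open>A\<close>
  of the extended system \<open>(A, \<Lambda>, \<mu>)\<close>. The endomorphism \<open>B A\<^sup>2 - (\<Lambda>\<^sup>\<flat> \<otimes> \<Lambda> + J\<Lambda>\<^sup>\<flat> \<otimes> J\<Lambda>)\<close> is again a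
  solution, hence equals \<open>a Id + b A\<close>. With \<open>q(t) = B t\<^sup>2 - b t - a\<close> this says that \<open>q(A)\<close> is the rank two
  endomorphism built from \<open>\<Lambda>\<close>, so every eigenvalue is a root of \<open>q\<close> or the eigenvalue \<open>ev0\<close> of \<open>\<Lambda>\<close>,
  which is a smooth function with \<open>grad ev0 = 2\<Lambda>\<close> and \<open>q(ev0) = |\<Lambda>|\<^sup>2\<close>. Constant eigenvalues are therefore
  roots of \<open>q\<close>. A continuous eigenvalue function could only switch between a root \<open>r\<close> and \<open>ev0\<close> at
  zeros of \<open>\<Lambda>\<close>. There \<open>ev0\<close> is a simple root of \<open>q\<close>: at a double root \<open>|grad ev0|\<close> is bounded by a
  multiple of \<open>|ev0 - r|\<close>, so \<open>ev0\<close> would be constant by Gronwall. Hence the Hessian of \<open>ev0\<close> is definite there on the \<open>J\<close>-invariant \<open>r\<close>-eigenspace, of real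
  dimension at least 2, so the zero set of \<open>\<Lambda>\<close> does not separate locally and no switch occurs: \<open>ev0\<close>
  is the only nonconstant eigenvalue function.\<close>

section \<open>Calculus of smooth maps between Euclidean spaces\<close>

text \<open>The solution with many eigenvalues need not be the endomorphism of the given triple. It
  is \<open>s Id + t A0\<close>; for \<open>t = 0\<close> it has one eigenvalue, and for
  \<open>t \<noteq> 0\<close> it belongs to a triple with the same \<open>B\<close>, so it may
  itself be taken as \<open>A\<close>.

  The main obstacle is that eigenvalue functions are arbitrary continuous selections: one that
  follows a root and then leaves along \<open>ev0\<close> has to be excluded at every zero of
  \<Lambda>. At such a zero \<open>q(A) = 0\<close>, and the Hessian of \<open>ev0\<close> is
  \<open>2 q'(r) g\<close> on the \<open>r\<close>-eigenspace but 0 on the eigenspace of the other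
  root \<open>r'\<close>, since \<open>B (r + r') = b\<close>. So the zeros of \<Lambda> need not be
  isolated. The neighbourhood is therefore cut into slices parallel to the plane of an eigenvector
  \<open>v\<close> and \<open>J v\<close>, each of which contains at most one zero. A slice by lines
  would not do, because removing a point disconnects a line; the second direction is what
  \<open>J\<close> provides.

  Tangent vectors are derivations of globally defined functions. Bump functions and Hadamard's lemma
  are what connects them with derivatives in charts.\<close>

lemma times_differentiable_on_subset:
  "times_differentiable_on n S f \<Longrightarrow> T \<subseteq> S \<Longrightarrow> times_differentiable_on n T f"
  by (induction n arbitrary: f) (auto intro: continuous_on_subset)

lemma frechet_derivative_eqI: "(f has_derivative f') (at x) \<Longrightarrow> frechet_derivative f (at x) = f'"
  using frechet_derivative_at by metis

lemma differentiable_cong_open: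
  assumes "open S" "x \<in> S" "\<And>y. y \<in> S \<Longrightarrow> f y = h y" "f differentiable (at x)"
  shows "h differentiable (at x)" "frechet_derivative h (at x) = frechet_derivative f (at x)"
proof -
  have "(f has_derivative frechet_derivative f (at x)) (at x)"
    using assms(4) by (simp add: frechet_derivative_works)
  then have *: "(h has_derivative frechet_derivative f (at x)) (at x)"
    by (rule has_derivative_transform_within_open) (use assms in auto)
  then show "h differentiable (at x)" by (auto simp: differentiable_def)
  show "frechet_derivative h (at x) = frechet_derivative f (at x)"
    by (rule frechet_derivative_eqI[OF *])
qed

lemma times_differentiable_on_cong:
  assumes "open S" "\<And>y. y \<in> S \<Longrightarrow> f y = h y" "times_differentiable_on n S f"
  shows "times_differentiable_on n S h"
  using assms(2,3)
proof (induction n arbitrary: f h)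
  case 0
  then show ?case using continuous_on_cong[of S S f h] by simp
next
  case (Suc n)
  have 1: "h differentiable (at x)" "frechet_derivative h (at x) = frechet_derivative f (at x)"
    if "x \<in> S" for x
    using differentiable_cong_open[OF assms(1) that, of f h] Suc.prems that by auto
  have "times_differentiable_on n S (\<lambda>x. frechet_derivative h (at x) v)" for v
    by (rule Suc.IH[of "\<lambda>x. frechet_derivative f (at x) v"]) (use 1 Suc.prems in auto)
  then show ?case using 1 by simp
qed

lemma times_differentiable_on_local:
  assumes "\<And>x. x \<in> S \<Longrightarrow> \<exists>T. open T \<and> x \<in> T \<and> times_differentiable_on n T f"
  shows "times_differentiable_on n S f"
  using assms
proof (induction n arbitrary: f)
  case 0
  have "continuous (at x) f" if "x \<in> S" for x
    using 0[OF that] continuous_on_eq_continuous_at by auto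
  then show ?case by (simp add: continuous_at_imp_continuous_on)
next
  case (Suc n)
  show ?case
  proof (simp, intro conjI ballI allI)
    show "f differentiable (at x)" if "x \<in> S" for x using Suc.prems[OF that] by auto
    show "times_differentiable_on n S (\<lambda>x. frechet_derivative f (at x) v)" for v
      by (rule Suc.IH) (use Suc.prems in fastforce)
  qed
qed

lemma times_differentiable_on_Suc_imp:
  "times_differentiable_on (Suc n) S f \<Longrightarrow> times_differentiable_on n S f"
proof (induction n arbitrary: f)
  case 0
  then show ?case by (auto intro!: continuous_at_imp_continuous_on differentiable_imp_continuous_within)
next
  case (Suc n)
  then show ?case by simp
qed

lemma times_differentiable_on_const: "times_differentiable_on n S (\<lambda>x. c)"
  by (induction n arbitrary: c) auto

lemma times_differentiable_on_compose_linear: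
  assumes "open S" "bounded_linear L" "times_differentiable_on n S f"
  shows "times_differentiable_on n S (\<lambda>x. L (f x))"
  using assms(3)
proof (induction n arbitrary: f)
  case 0
  then show ?case using assms(2) by (auto intro: bounded_linear.continuous_on)
next
  case (Suc n)
  have *: "((\<lambda>x. L (f x)) has_derivative (\<lambda>v. L (frechet_derivative f (at x) v))) (at x)" if "x \<in> S" for x
    by (rule bounded_linear.has_derivative[OF assms(2)])
       (use Suc.prems that in \<open>auto simp: frechet_derivative_works[symmetric]\<close>)
  have "times_differentiable_on n S (\<lambda>x. frechet_derivative (\<lambda>x. L (f x)) (at x) v)" for v
    by (rule times_differentiable_on_cong[OF assms(1), of "\<lambda>x. L (frechet_derivative f (at x) v)"])
       (use Suc in \<open>auto simp: frechet_derivative_eqI[OF *]\<close>)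
  moreover have "(\<lambda>x. L (f x)) differentiable (at x)" if "x \<in> S" for x
    using *[OF that] by (auto simp: differentiable_def)
  ultimately show ?case by simp
qed

lemma times_differentiable_on_linear:
  assumes "open S" "bounded_linear L"
  shows "times_differentiable_on n S L"
proof (cases n)
  case 0
  then show ?thesis using assms bounded_linear.continuous_on continuous_on_id by fastforce
next
  case (Suc k)
  have "(L has_derivative L) (at x)" for x by (rule bounded_linear_imp_has_derivative[OF assms(2)])
  then have "frechet_derivative L (at x) = L" "L differentiable (at x)" for x
    by (auto simp: frechet_derivative_eqI differentiable_def)
  then show ?thesis using Suc by (simp add: times_differentiable_on_const)
qed

lemma times_differentiable_on_add:
  assumes "open S" "times_differentiable_on n S f" "times_differentiable_on n S h"
  shows "times_differentiable_on n S (\<lambda>x. f x + h x)"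
  using assms(2,3)
proof (induction n arbitrary: f h)
  case 0
  then show ?case by (auto intro: continuous_on_add)
next
  case (Suc n)
  have *: "((\<lambda>x. f x + h x) has_derivative
      (\<lambda>v. frechet_derivative f (at x) v + frechet_derivative h (at x) v)) (at x)" if "x \<in> S" for x
    by (rule has_derivative_add)
       (use Suc.prems that in \<open>auto simp: frechet_derivative_works[symmetric]\<close>)
  have "times_differentiable_on n S (\<lambda>x. frechet_derivative (\<lambda>x. f x + h x) (at x) v)" for v
    by (rule times_differentiable_on_cong[OF assms(1),
          of "\<lambda>x. frechet_derivative f (at x) v + frechet_derivative h (at x) v"])
       (use Suc in \<open>auto simp: frechet_derivative_eqI[OF *]\<close>)
  moreover have "(\<lambda>x. f x + h x) differentiable (at x)" if "x \<in> S" for x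
    using *[OF that] by (auto simp: differentiable_def)
  ultimately show ?case by simp
qed

lemma times_differentiable_on_sum:
  assumes "open S" "\<And>i. i \<in> I \<Longrightarrow> times_differentiable_on n S (f i)"
  shows "times_differentiable_on n S (\<lambda>x. \<Sum>i\<in>I. f i x)"
  using assms(2)
  by (induction I rule: infinite_finite_induct)
     (auto intro!: times_differentiable_on_add[OF assms(1)] times_differentiable_on_const)

lemma times_differentiable_on_scaleR:
  fixes f :: "'a::real_normed_vector \<Rightarrow> real" and h :: "'a \<Rightarrow> 'b::real_normed_vector"
  assumes "open S" "times_differentiable_on n S f" "times_differentiable_on n S h"
  shows "times_differentiable_on n S (\<lambda>x. f x *\<^sub>R h x)"
  using assms(2,3)
proof (induction n arbitrary: f h)
  case 0
  then show ?case by (auto intro: continuous_on_scaleR)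
next
  case (Suc n)
  have *: "((\<lambda>x. f x *\<^sub>R h x) has_derivative
      (\<lambda>v. f x *\<^sub>R frechet_derivative h (at x) v + frechet_derivative f (at x) v *\<^sub>R h x)) (at x)"
    if "x \<in> S" for x
    by (rule has_derivative_scaleR)
       (use Suc.prems that in \<open>auto simp: frechet_derivative_works[symmetric]\<close>)
  have "times_differentiable_on n S (\<lambda>x. frechet_derivative (\<lambda>x. f x *\<^sub>R h x) (at x) v)" for v
  proof (rule times_differentiable_on_cong[OF assms(1)])
    show "times_differentiable_on n S
        (\<lambda>x. f x *\<^sub>R frechet_derivative h (at x) v + frechet_derivative f (at x) v *\<^sub>R h x)"
      using Suc.prems times_differentiable_on_Suc_imp[OF Suc.prems(1)]
        times_differentiable_on_Suc_imp[OF Suc.prems(2)]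
      by (intro times_differentiable_on_add[OF assms(1)] Suc.IH) simp_all
  qed (auto simp: frechet_derivative_eqI[OF *])
  moreover have "(\<lambda>x. f x *\<^sub>R h x) differentiable (at x)" if "x \<in> S" for x
    using *[OF that] by (auto simp: differentiable_def)
  ultimately show ?case by simp
qed

text \<open>In the chain rule the direction in which \<open>h\<close> is differentiated varies with
  \<open>x\<close>. Expanding it over \<open>Basis\<close> leaves products of coordinates of
  \<open>Df\<close> with composites of \<open>f\<close> and a partial derivative of
  \<open>h\<close>, to which the induction hypothesis applies; this is why the middle space is
  Euclidean.\<close>

lemma times_differentiable_on_compose:
  fixes f :: "'a::real_normed_vector \<Rightarrow> 'b::euclidean_space" and h :: "'b \<Rightarrow> 'c::real_normed_vector"
  assumes "open S" "open T" "f ` S \<subseteq> T"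
    and "times_differentiable_on n S f" "times_differentiable_on n T h"
  shows "times_differentiable_on n S (\<lambda>x. h (f x))"
  using assms(4,5)
proof (induction n arbitrary: h)
  case 0
  then show ?case using assms(3) by (auto intro: continuous_on_compose2)
next
  case (Suc n)
  have f: "(f has_derivative frechet_derivative f (at x)) (at x)" if "x \<in> S" for x
    using Suc.prems that by (auto simp: frechet_derivative_works[symmetric])
  have h: "(h has_derivative frechet_derivative h (at y)) (at y)" if "y \<in> T" for y
    using Suc.prems that by (auto simp: frechet_derivative_works[symmetric])
  have *: "((\<lambda>x. h (f x)) has_derivative
      (\<lambda>v. frechet_derivative h (at (f x)) (frechet_derivative f (at x) v))) (at x)" if "x \<in> S" for x
    by (rule has_derivative_compose[OF f[OF that]]) (use h that assms(3) in auto)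
  have lin: "frechet_derivative h (at y) w = (\<Sum>i\<in>Basis. (w \<bullet> i) *\<^sub>R frechet_derivative h (at y) i)"
    if "y \<in> T" for y w
  proof -
    interpret bounded_linear "frechet_derivative h (at y)"
      using h[OF that] by (rule has_derivative_bounded_linear)
    show ?thesis by (subst euclidean_representation[of w, symmetric]) (simp add: sum scaleR)
  qed
  have "times_differentiable_on n S (\<lambda>x. frechet_derivative (\<lambda>x. h (f x)) (at x) v)" for v
  proof (rule times_differentiable_on_cong[OF assms(1)])
    show "times_differentiable_on n S (\<lambda>x. \<Sum>i\<in>Basis. (frechet_derivative f (at x) v \<bullet> i) *\<^sub>R
        frechet_derivative h (at (f x)) i)"
    proof (intro times_differentiable_on_sum[OF assms(1)] times_differentiable_on_scaleR[OF assms(1)])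
      show "times_differentiable_on n S (\<lambda>x. frechet_derivative f (at x) v \<bullet> i)" for i
        by (rule times_differentiable_on_compose_linear[OF assms(1) bounded_linear_inner_left])
           (use Suc.prems in auto)
      show "times_differentiable_on n S (\<lambda>x. frechet_derivative h (at (f x)) i)" for i
        by (rule Suc.IH[OF times_differentiable_on_Suc_imp[OF Suc.prems(1)]]) (use Suc.prems in auto)
    qed
    fix y assume "y \<in> S"
    then show "(\<Sum>i\<in>Basis. (frechet_derivative f (at y) v \<bullet> i) *\<^sub>R frechet_derivative h (at (f y)) i)
      = frechet_derivative (\<lambda>x. h (f x)) (at y) v"
      using lin[of "f y" "frechet_derivative f (at y) v"] assms(3)
      unfolding frechet_derivative_eqI[OF *[OF \<open>y \<in> S\<close>]] by (metis image_subset_iff)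
  qed
  moreover have "(\<lambda>x. h (f x)) differentiable (at x)" if "x \<in> S" for x
    using *[OF that] by (auto simp: differentiable_def)
  ultimately show ?case by simp
qed

lemma smooth_on_subset: "smooth_on S f \<Longrightarrow> T \<subseteq> S \<Longrightarrow> smooth_on T f"
  by (auto simp: smooth_on_def intro: times_differentiable_on_subset)

lemma smooth_on_cong: "open S \<Longrightarrow> (\<And>y. y \<in> S \<Longrightarrow> f y = h y) \<Longrightarrow> smooth_on S f \<Longrightarrow> smooth_on S h"
  unfolding smooth_on_def using times_differentiable_on_cong by blast

lemma smooth_on_local:
  assumes "\<And>x. x \<in> S \<Longrightarrow> \<exists>T. open T \<and> x \<in> T \<and> smooth_on T f"
  shows "smooth_on S f"
  unfolding smooth_on_def
  by (intro allI times_differentiable_on_local) (use assms in \<open>auto simp: smooth_on_def\<close>)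

lemma smooth_on_const: "smooth_on S (\<lambda>x. c)"
  by (simp add: smooth_on_def times_differentiable_on_const)

lemma smooth_on_linear: "open S \<Longrightarrow> bounded_linear L \<Longrightarrow> smooth_on S L"
  by (simp add: smooth_on_def times_differentiable_on_linear)

lemma smooth_on_add:
  "open S \<Longrightarrow> smooth_on S f \<Longrightarrow> smooth_on S h \<Longrightarrow> smooth_on S (\<lambda>x. f x + h x)"
  by (simp add: smooth_on_def times_differentiable_on_add)

lemma smooth_on_sum:
  "open S \<Longrightarrow> (\<And>i. i \<in> I \<Longrightarrow> smooth_on S (f i)) \<Longrightarrow> smooth_on S (\<lambda>x. \<Sum>i\<in>I. f i x)"
  by (simp add: smooth_on_def times_differentiable_on_sum)

lemma smooth_on_mult:
  fixes f h :: "'a::real_normed_vector \<Rightarrow> real"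
  shows "open S \<Longrightarrow> smooth_on S f \<Longrightarrow> smooth_on S h \<Longrightarrow> smooth_on S (\<lambda>x. f x * h x)"
  using times_differentiable_on_scaleR[of S _ f h] by (simp add: smooth_on_def)

lemma smooth_on_compose:
  fixes f :: "'a::real_normed_vector \<Rightarrow> 'b::euclidean_space" and h :: "'b \<Rightarrow> 'c::real_normed_vector"
  shows "open S \<Longrightarrow> open T \<Longrightarrow> f ` S \<subseteq> T \<Longrightarrow> smooth_on S f \<Longrightarrow> smooth_on T h \<Longrightarrow>
    smooth_on S (\<lambda>x. h (f x))"
  by (simp add: smooth_on_def times_differentiable_on_compose)

lemma smooth_on_continuous_on: "smooth_on S f \<Longrightarrow> continuous_on S f"
  by (metis smooth_on_def times_differentiable_on.simps(1))

lemma smooth_on_has_derivative: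
  "smooth_on S f \<Longrightarrow> x \<in> S \<Longrightarrow> (f has_derivative frechet_derivative f (at x)) (at x)"
  by (metis smooth_on_def times_differentiable_on.simps(2) frechet_derivative_works)

lemma smooth_on_derivative: "smooth_on S f \<Longrightarrow> smooth_on S (\<lambda>x. frechet_derivative f (at x) v)"
  unfolding smooth_on_def using times_differentiable_on.simps(2) by blast

text \<open>Serves families that reproduce themselves under differentiation, so that higher
  derivatives never have to be computed explicitly.\<close>

lemma smooth_on_coinduct:
  assumes "open S" "P f"
    and "\<And>f v. P f \<Longrightarrow> \<exists>h. P h \<and> (\<forall>x\<in>S. f differentiable (at x) \<and> frechet_derivative f (at x) v = h x)"
  shows "smooth_on S f"
proof -
  have "times_differentiable_on n S f" if "P f" for n f
    using that
  proof (induction n arbitrary: f)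
    case 0
    \<comment> \<open>Any direction serves here, since only the differentiability half is
      extracted.\<close>
    then show ?case using assms(3)[OF 0, of undefined]
      by (auto intro!: continuous_at_imp_continuous_on differentiable_imp_continuous_within)
  next
    case (Suc n)
    have "times_differentiable_on n S (\<lambda>x. frechet_derivative f (at x) v)" for v
    proof -
      obtain h where h: "P h" "\<forall>x\<in>S. frechet_derivative f (at x) v = h x"
        using assms(3)[OF Suc.prems, of v] by blast
      show ?thesis
        by (rule times_differentiable_on_cong[OF assms(1) _ Suc.IH[OF h(1)]]) (simp add: h(2))
    qed
    moreover have "\<forall>x\<in>S. f differentiable (at x)"
      using assms(3)[OF Suc.prems, of undefined] by blast
    ultimately show ?case by simp
  qed
  then show ?thesis using assms(2) by (simp add: smooth_on_def)
qed

section \<open>Bump functions\<close>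

text \<open>For \<open>P = 1\<close> this is the standard function that is flat at 0. A polynomial
  factor in \<open>1 / t\<close> makes the family closed under differentiation.\<close>

definition exp_poly :: "real poly \<Rightarrow> real \<Rightarrow> real"
  where "exp_poly P t = (if t > 0 then poly P (1 / t) * exp (- 1 / t) else 0)"

lemma exp_poly_tendsto_0: "(exp_poly P \<longlongrightarrow> 0) (at 0)"
proof -
  have "((\<lambda>x. poly P x / exp x) \<longlongrightarrow> 0) at_top"
    unfolding poly_altdef sum_divide_distrib
    by (rule tendsto_null_sum) (use tendsto_mult_right_zero[OF tendsto_power_div_exp_0] in \<open>simp flip: times_divide_eq_right\<close>)
  then have "((\<lambda>t. poly P (inverse t) / exp (inverse t)) \<longlongrightarrow> 0) (at_right 0)"
    by (rule filterlim_compose) (rule filterlim_inverse_at_top_right)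
  then have "(exp_poly P \<longlongrightarrow> 0) (at_right 0)"
    by (rule Lim_transform_eventually)
       (auto simp: exp_poly_def eventually_at_filter exp_minus field_simps)
  moreover have "(exp_poly P \<longlongrightarrow> 0) (at_left 0)"
    by (rule Lim_transform_eventually[OF tendsto_const])
       (auto simp: exp_poly_def eventually_at_filter)
  ultimately show ?thesis by (simp add: filterlim_at_split)
qed

text \<open>For positive \<open>t\<close> both factors contribute \<open>1 / t^2\<close> by the
  chain rule, giving \<open>(P - P')\<close> at \<open>1 / t\<close>; the polynomial
  \<open>[:0, 0, 1:]\<close> is this factor \<open>x^2\<close> at \<open>x = 1 / t\<close>.\<close>

lemma exp_poly_has_derivative:
  "(exp_poly P has_real_derivative exp_poly ([:0, 0, 1:] * (P - pderiv P)) t) (at t)"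
proof -
  consider "t > 0" | "t < 0" | "t = 0" by linarith
  then show ?thesis
  proof cases
    case 1
    have "((\<lambda>t. poly P (1 / t) * exp (- 1 / t)) has_real_derivative
        exp_poly ([:0, 0, 1:] * (P - pderiv P)) t) (at t)"
      using 1 by (auto intro!: derivative_eq_intros DERIV_chain'[OF _ poly_DERIV]
          simp: exp_poly_def field_simps power2_eq_square)
    then show ?thesis
      by (rule has_field_derivative_transform_within_open[where S = "{0<..}"])
         (use 1 in \<open>auto simp: exp_poly_def\<close>)
  next
    case 2
    have "((\<lambda>t. 0) has_real_derivative exp_poly ([:0, 0, 1:] * (P - pderiv P)) t) (at t)"
      using 2 by (simp add: exp_poly_def)
    then show ?thesis
      by (rule has_field_derivative_transform_within_open[where S = "{..<0}"])
         (use 2 in \<open>auto simp: exp_poly_def\<close>)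
  next
    case 3
    \<comment> \<open>The difference quotient at 0 is again in the family: dividing by
      \<open>h\<close> multiplies the polynomial by \<open>x = 1 / h\<close>.\<close>
    have "((\<lambda>h. (exp_poly P (0 + h) - exp_poly P 0) / h) \<longlongrightarrow> 0) (at 0)"
      by (rule Lim_transform_eventually[OF exp_poly_tendsto_0[of "[:0, 1:] * P"]])
         (auto simp: exp_poly_def eventually_at_filter)
    then show ?thesis using 3 by (simp add: DERIV_def exp_poly_def)
  qed
qed

lemma smooth_on_exp_poly: "smooth_on UNIV (exp_poly P)"
\<comment> \<open>The scalar \<open>c\<close> absorbs the direction \<open>v\<close>, which enters
  the derivative as a factor.\<close>
proof (rule smooth_on_coinduct[where P = "\<lambda>f. \<exists>c P. f = (\<lambda>t. c * exp_poly P t)"])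
  fix f :: "real \<Rightarrow> real" and v :: real
  assume "\<exists>c P. f = (\<lambda>t. c * exp_poly P t)"
  then obtain c P where f: "f = (\<lambda>t. c * exp_poly P t)" by blast
  have *: "(f has_derivative (\<lambda>v. c * exp_poly ([:0, 0, 1:] * (P - pderiv P)) t * v)) (at t)" for t
    using DERIV_cmult[OF exp_poly_has_derivative, of c P] unfolding f has_field_derivative_def .
  have "f differentiable (at t)"
    "frechet_derivative f (at t) v = (c * v) * exp_poly ([:0, 0, 1:] * (P - pderiv P)) t" for t
    using * by (auto simp: frechet_derivative_eqI[OF *] differentiable_def)
  then show "\<exists>h. (\<exists>c P. h = (\<lambda>t. c * exp_poly P t)) \<and>
      (\<forall>x\<in>UNIV. f differentiable (at x) \<and> frechet_derivative f (at x) v = h x)" by blast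
next
  have "exp_poly P = (\<lambda>t. 1 * exp_poly P t)" by simp
  then show "\<exists>c Q. exp_poly P = (\<lambda>t. c * exp_poly Q t)" by blast
qed simp

lemma smooth_bump:
  fixes c :: "'e::euclidean_space"
  assumes "r > 0"
  obtains b :: "'e \<Rightarrow> real"
  where "smooth_on UNIV b" "\<And>x. x \<in> ball c r \<Longrightarrow> b x > 0" "\<And>x. x \<notin> ball c r \<Longrightarrow> b x = 0" "b c = 1"
proof
  let ?k = "\<lambda>x::'e. r\<^sup>2 + - ((x - c) \<bullet> (x - c))"
  \<comment> \<open>The argument \<open>?k\<close> is positive exactly inside the ball, and
    \<open>exp (1 / r^2)\<close> normalises the value at the centre to 1.\<close>
  let ?b = "\<lambda>x. exp (1 / r\<^sup>2) * exp_poly [:1:] (?k x)"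
  have "(\<Sum>i\<in>Basis. (x \<bullet> i) * (- x \<bullet> i)) = - (x \<bullet> x)" for x :: 'e
    unfolding euclidean_inner[of x x] by (simp add: sum_negf)
  then have eq: "?k = (\<lambda>x. r\<^sup>2 - c \<bullet> c + (\<Sum>i\<in>Basis. (x \<bullet> i) * (- x \<bullet> i)) + x \<bullet> (2 *\<^sub>R c))"
    by (simp add: fun_eq_iff inner_diff_left inner_diff_right inner_commute)
  have "smooth_on UNIV ?k"
    unfolding eq
    by (intro smooth_on_add smooth_on_sum smooth_on_mult smooth_on_const smooth_on_linear
        bounded_linear_inner_left bounded_linear_compose[OF bounded_linear_inner_left bounded_linear_minus]
        bounded_linear_ident) auto
  then show "smooth_on UNIV ?b"
    by (intro smooth_on_mult smooth_on_const smooth_on_compose[OF _ _ _ _ smooth_on_exp_poly]) auto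
  have *: "?k x > 0 \<longleftrightarrow> x \<in> ball c r" for x
    using assms power_mono_iff[of r "norm (x - c)" 2]
    by (auto simp: dist_norm norm_minus_commute[of c x] dot_square_norm not_le[symmetric])
  show "?b x > 0" if "x \<in> ball c r" for x using that * by (simp add: exp_poly_def)
  show "?b x = 0" if "x \<notin> ball c r" for x using that * by (simp add: exp_poly_def)
  show "?b c = 1" using assms by (simp add: exp_poly_def flip: exp_add)
qed

section \<open>Hadamard's lemma\<close>

text \<open>Differentiating under the integral in direction \<open>v\<close> brings out a factor
  \<open>t\<close> and replaces \<open>f\<close> by its derivative along \<open>v\<close>. The
  weights \<open>t ^ k\<close> make the family closed under this, so the coinduction rule
  applies.\<close>

lemma smooth_on_radial_integral:
  fixes f :: "'e::euclidean_space \<Rightarrow> real"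
  assumes "smooth_on (ball 0 r) f"
  shows "smooth_on (ball 0 r) (\<lambda>x. integral {0..1} (\<lambda>t. t ^ k * f (t *\<^sub>R x)))"
proof (rule smooth_on_coinduct[where P = "\<lambda>h. \<exists>k f. smooth_on (ball 0 r) f \<and>
      h = (\<lambda>x. integral {0..1} (\<lambda>t. t ^ k * f (t *\<^sub>R x)))"])
  fix h :: "'e \<Rightarrow> real" and v :: 'e
  assume "\<exists>k f. smooth_on (ball 0 r) f \<and> h = (\<lambda>x. integral {0..1} (\<lambda>t. t ^ k * f (t *\<^sub>R x)))"
  then obtain k f where f: "smooth_on (ball 0 r) f"
    and h: "h = (\<lambda>x. integral {0..1} (\<lambda>t. t ^ k * f (t *\<^sub>R x)))" by blast
  have in_ball: "t *\<^sub>R x \<in> ball 0 r" if "x \<in> ball 0 r" "t \<in> {0..1}" for x :: 'e and t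
    using that mult_left_le_one_le[of "norm x" t] by auto
  have cont: "continuous_on (ball 0 r \<times> {0..1}) (\<lambda>(x, t). u (t *\<^sub>R x))"
    if "smooth_on (ball 0 r) u" for u :: "'e \<Rightarrow> real"
    unfolding case_prod_beta
    by (rule continuous_on_compose2[OF smooth_on_continuous_on[OF that]])
       (use in_ball in \<open>auto intro!: continuous_intros\<close>)
  define f' where "f' x = frechet_derivative f (at x)" for x
  have f': "(f has_derivative f' x) (at x)" if "x \<in> ball 0 r" for x
    unfolding f'_def using smooth_on_has_derivative[OF f that] .
  have f'_smooth: "smooth_on (ball 0 r) (\<lambda>x. f' x i)" for i
    unfolding f'_def using smooth_on_derivative[OF f] .
  have f'_sum: "f' x w = (\<Sum>i\<in>Basis. (w \<bullet> i) * f' x i)" if "x \<in> ball 0 r" for x w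
  proof -
    interpret bounded_linear "f' x" using f'[OF that] by (rule has_derivative_bounded_linear)
    show ?thesis by (subst euclidean_representation[of w, symmetric]) (simp add: sum scaleR)
  qed
  \<comment> \<open>The Leibniz rule wants a derivative valued in bounded linear maps. Assembling it
    from coordinate functionals reduces its continuity to that of the partial derivatives.\<close>
  define D where "D x t = (\<Sum>i\<in>Basis. (t ^ Suc k * f' (t *\<^sub>R x) i) *\<^sub>R blinfun_inner_right i)"
    for x :: 'e and t :: real
  have D_apply: "blinfun_apply (D x t) w = t ^ Suc k * f' (t *\<^sub>R x) w"
    if "x \<in> ball 0 r" "t \<in> {0..1}" for x t w
    unfolding f'_sum[OF in_ball[OF that], of w]
    by (simp add: D_def blinfun.sum_left blinfun.scaleR_left sum_distrib_left inner_commute[of _ w] mult_ac)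
  have D_cont: "continuous_on (ball 0 r \<times> cbox 0 1) (\<lambda>(x, t). D x t)"
    using cont[OF f'_smooth] unfolding D_def case_prod_beta cbox_interval
    by (intro continuous_intros) (simp add: case_prod_beta)
  have deriv: "(h has_derivative blinfun_apply (integral (cbox 0 1) (D x))) (at x)" if x: "x \<in> ball 0 r" for x
  proof -
    have "(h has_derivative blinfun_apply (integral (cbox 0 1) (D x))) (at x within ball 0 r)"
      unfolding h cbox_interval[symmetric]
    proof (rule leibniz_rule[OF _ _ D_cont x])
      fix x :: 'e and t :: real assume xt: "x \<in> ball 0 r" "t \<in> cbox 0 1"
      then have xt': "t \<in> {0..1}" by simp
      have "((\<lambda>x. t *\<^sub>R x) has_derivative (\<lambda>v. t *\<^sub>R v)) (at x within ball 0 r)"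
        by (intro has_derivative_scaleR_right has_derivative_ident)
      from has_derivative_compose[OF this f'[OF in_ball[OF xt(1) xt']]]
      have "((\<lambda>x. t ^ k * f (t *\<^sub>R x)) has_derivative (\<lambda>v. t ^ k * f' (t *\<^sub>R x) (t *\<^sub>R v)))
          (at x within ball 0 r)"
        by (rule has_derivative_mult_right)
      moreover have "t ^ k * f' (t *\<^sub>R x) (t *\<^sub>R v) = blinfun_apply (D x t) v" for v
        using linear_scale[OF has_derivative_linear[OF f'[OF in_ball[OF xt(1) xt']]]]
        by (simp add: D_apply[OF xt(1) xt'])
      ultimately show "((\<lambda>x. t ^ k * f (t *\<^sub>R x)) has_derivative blinfun_apply (D x t)) (at x within ball 0 r)"
        by simp
    next
      fix x :: 'e assume "x \<in> ball 0 r"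
      then have "continuous_on {0..1} (\<lambda>t. f (t *\<^sub>R x))"
        using in_ball
        by (intro continuous_on_compose2[OF smooth_on_continuous_on[OF f]] continuous_intros) auto
      then show "(\<lambda>t. t ^ k * f (t *\<^sub>R x)) integrable_on cbox 0 1"
        unfolding cbox_interval
        by (intro integrable_continuous_real continuous_on_mult continuous_on_power continuous_on_id)
    qed simp
    then show ?thesis by (simp only: at_within_open[OF x open_ball])
  qed
  have D_int: "blinfun_apply (integral (cbox 0 1) (D x)) v = integral {0..1} (\<lambda>t. t ^ Suc k * f' (t *\<^sub>R x) v)"
    if x: "x \<in> ball 0 r" for x
  proof -
    have "continuous_on (cbox 0 1) (D x)"
    proof -
      have "continuous_on (cbox 0 1) (\<lambda>t. (\<lambda>(x, t). D x t) (x, t))"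
        by (rule continuous_on_compose2[OF D_cont continuous_on_Pair[OF continuous_on_const continuous_on_id]])
           (use x in auto)
      then show ?thesis by simp
    qed
    then have "blinfun_apply (integral (cbox 0 1) (D x)) v = integral (cbox 0 1) (\<lambda>t. blinfun_apply (D x t) v)"
      using integral_linear[OF integrable_continuous blinfun.bounded_linear_left, of 0 1 "D x" v]
      by (simp add: o_def)
    also have "\<dots> = integral {0..1} (\<lambda>t. t ^ Suc k * f' (t *\<^sub>R x) v)"
      unfolding cbox_interval by (rule integral_cong) (simp only: D_apply[OF x])
    finally show ?thesis .
  qed
  have "h differentiable (at x) \<and>
      frechet_derivative h (at x) v = integral {0..1} (\<lambda>t. t ^ Suc k * f' (t *\<^sub>R x) v)"
    if x: "x \<in> ball 0 r" for x
    unfolding frechet_derivative_eqI[OF deriv[OF x]] D_int[OF x, symmetric]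
    using deriv[OF x] by (auto simp: differentiable_def)
  then show "\<exists>h'. (\<exists>k f. smooth_on (ball 0 r) f \<and> h' = (\<lambda>x. integral {0..1} (\<lambda>t. t ^ k * f (t *\<^sub>R x)))) \<and>
      (\<forall>x\<in>ball 0 r. h differentiable (at x) \<and> frechet_derivative h (at x) v = h' x)"
    by (intro exI[of _ "\<lambda>x. integral {0..1} (\<lambda>t. t ^ Suc k * f' (t *\<^sub>R x) v)"] conjI
        exI[of _ "Suc k"] exI[of _ "\<lambda>x. f' x v"] ballI f'_smooth refl) auto
qed (use assms in auto)

text \<open>The fundamental theorem along the segment from \<open>c\<close> to \<open>x\<close>
  gives \<open>h i x\<close> as the integral of the partial derivative over that segment. At
  \<open>x = c\<close> the integrand is constant, which yields the last clause.\<close>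

lemma hadamard:
  fixes f :: "'e::euclidean_space \<Rightarrow> real"
  assumes f: "smooth_on (ball c r) f"
  obtains h where "\<And>i. i \<in> Basis \<Longrightarrow> smooth_on (ball c r) (h i)"
    "\<And>x. x \<in> ball c r \<Longrightarrow> f x = f c + (\<Sum>i\<in>Basis. ((x - c) \<bullet> i) * h i x)"
    "\<And>i. i \<in> Basis \<Longrightarrow> h i c = frechet_derivative f (at c) i"
proof
  define f' where "f' x = frechet_derivative f (at x)" for x
  define H where "H i y = integral {0..1} (\<lambda>t. t ^ 0 * f' (c + t *\<^sub>R y) i)" for i y
  have translate: "smooth_on (ball a r) (\<lambda>x. u (d + x))" if "smooth_on (ball (d + a) r) u"
    for a d :: 'e and u :: "'e \<Rightarrow> real"
  proof (rule smooth_on_compose[OF _ _ _ _ that])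
    show "smooth_on (ball a r) ((+) d)"
      by (intro smooth_on_add smooth_on_const smooth_on_linear bounded_linear_ident) auto
  qed (auto simp: dist_norm algebra_simps)
  have f': "(f has_derivative f' x) (at x)" if "x \<in> ball c r" for x
    unfolding f'_def using smooth_on_has_derivative[OF f that] .
  have f'_smooth: "smooth_on (ball c r) (\<lambda>x. f' x i)" for i
    unfolding f'_def using smooth_on_derivative[OF f] .
  have "smooth_on (ball 0 r) (H i)" for i
    unfolding H_def by (intro smooth_on_radial_integral translate) (simp add: f'_smooth)
  then show "smooth_on (ball c r) (\<lambda>x. H i (- c + x))" for i
    by (intro translate) simp
  show "H i (- c + c) = frechet_derivative f (at c) i" for i by (simp add: H_def f'_def)
  fix x assume x: "x \<in> ball c r"
  have in_ball: "c + t *\<^sub>R (x - c) \<in> ball c r" if "t \<in> {0..1}" for t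
    using x that mult_left_le_one_le[of "norm (x - c)" t] by (auto simp: dist_norm norm_minus_commute)
  have "((\<lambda>t. f' (c + t *\<^sub>R (x - c)) (x - c)) has_integral
      f (c + 1 *\<^sub>R (x - c)) - f (c + 0 *\<^sub>R (x - c))) {0..1}"
  proof (rule fundamental_theorem_of_calculus)
    fix t :: real assume t: "t \<in> {0..1}"
    have "((\<lambda>t. c + t *\<^sub>R (x - c)) has_derivative (\<lambda>s. s *\<^sub>R (x - c))) (at t within {0..1})"
      by (auto intro!: derivative_eq_intros)
    from has_derivative_compose[OF this f'[OF in_ball[OF t]]]
    show "((\<lambda>t. f (c + t *\<^sub>R (x - c))) has_vector_derivative f' (c + t *\<^sub>R (x - c)) (x - c)) (at t within {0..1})"
      using linear_scale[OF has_derivative_linear[OF f'[OF in_ball[OF t]]]]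
      by (simp add: has_vector_derivative_def)
  qed simp
  then have "f x - f c = integral {0..1} (\<lambda>t. f' (c + t *\<^sub>R (x - c)) (x - c))"
    by (simp add: integral_unique)
  also have "\<dots> = integral {0..1} (\<lambda>t. \<Sum>i\<in>Basis. ((x - c) \<bullet> i) * f' (c + t *\<^sub>R (x - c)) i)"
  proof (rule integral_cong)
    fix t :: real assume "t \<in> {0..1}"
    then interpret bounded_linear "f' (c + t *\<^sub>R (x - c))"
      using f'[OF in_ball] by (intro has_derivative_bounded_linear)
    show "f' (c + t *\<^sub>R (x - c)) (x - c) = (\<Sum>i\<in>Basis. ((x - c) \<bullet> i) * f' (c + t *\<^sub>R (x - c)) i)"
      by (subst euclidean_representation[of "x - c", symmetric]) (simp add: sum scaleR)
  qed
  also have "\<dots> = (\<Sum>i\<in>Basis. integral {0..1} (\<lambda>t. ((x - c) \<bullet> i) * f' (c + t *\<^sub>R (x - c)) i))"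
  proof (rule integral_sum)
    show "(\<lambda>t. ((x - c) \<bullet> i) * f' (c + t *\<^sub>R (x - c)) i) integrable_on {0..1}" for i
      by (intro integrable_continuous_real continuous_on_mult continuous_on_const
          continuous_on_compose2[OF smooth_on_continuous_on[OF f'_smooth]] continuous_intros)
         (use in_ball in auto)
  qed simp
  finally show "f x = f c + (\<Sum>i\<in>Basis. ((x - c) \<bullet> i) * H i (- c + x))"
    by (simp add: H_def)
qed

section \<open>Smooth manifolds\<close>

locale manifold =
  fixes \<A> :: "('a::{t2_space,second_countable_topology}, 'e::euclidean_space) atlas"
  assumes smooth_manifold: "smooth_manifold \<A>"
begin

abbreviation M where "M \<equiv> manifold_carrier \<A>"

abbreviation T where "T \<equiv> tangent_space \<A>"

lemma chart_facts:
  assumes "(U, \<phi>) \<in> \<A>"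
  shows chart_open: "open U" and chart_image_open: "open (\<phi> ` U)"
    and chart_homeomorphism: "homeomorphism U (\<phi> ` U) \<phi> (inv_into U \<phi>)"
    and chart_subset: "U \<subseteq> M"
  using smooth_manifold assms by (auto simp: smooth_manifold_def manifold_carrier_def)

lemma chart_inv: "(U, \<phi>) \<in> \<A> \<Longrightarrow> p \<in> U \<Longrightarrow> inv_into U \<phi> (\<phi> p) = p"
  using chart_homeomorphism by (meson homeomorphism_apply1)

lemma inv_chart: "x \<in> \<phi> ` U \<Longrightarrow> \<phi> (inv_into U \<phi> x) = x" "x \<in> \<phi> ` U \<Longrightarrow> inv_into U \<phi> x \<in> U"
  by (auto simp: f_inv_into_f inv_into_into)

lemma transition_smooth:
  "(U, \<phi>) \<in> \<A> \<Longrightarrow> (V, \<psi>) \<in> \<A> \<Longrightarrow> smooth_on (\<phi> ` (U \<inter> V)) (\<psi> \<circ> inv_into U \<phi>)"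
  using smooth_manifold by (auto simp: smooth_manifold_def)

lemma carrier_open: "open M"
  unfolding manifold_carrier_def using chart_open by auto

lemma chart_image_open_subset:
  assumes "(U, \<phi>) \<in> \<A>" "open W" "W \<subseteq> U"
  shows "open (\<phi> ` W)"
proof -
  have "\<phi> ` W = \<phi> ` U \<inter> inv_into U \<phi> -` W"
    using assms inv_chart chart_inv by (auto simp: image_iff)
  moreover have "open (\<phi> ` U \<inter> inv_into U \<phi> -` W)"
    using chart_homeomorphism[OF assms(1)] chart_image_open[OF assms(1)] assms(2)
    by (intro continuous_open_preimage) (auto simp: homeomorphism_def)
  ultimately show ?thesis by simp
qed

lemma chart_preimage_open:
  assumes "(U, \<phi>) \<in> \<A>" "open S"
  shows "open (U \<inter> \<phi> -` S)"
  using chart_homeomorphism[OF assms(1)] chart_open[OF assms(1)] assms(2)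
  by (intro continuous_open_preimage) (auto simp: homeomorphism_def)

lemma smooth_functions_chart:
  "f \<in> smooth_functions \<A> \<Longrightarrow> (U, \<phi>) \<in> \<A> \<Longrightarrow> smooth_on (\<phi> ` U) (f \<circ> inv_into U \<phi>)"
  by (auto simp: smooth_functions_def)

text \<open>Transition maps carry smoothness from one chart near a point to every other chart there,
  so a single chart per point suffices.\<close>

lemma smooth_functions_local:
  assumes "\<And>p. p \<in> M \<Longrightarrow> \<exists>U \<phi> W. (U, \<phi>) \<in> \<A> \<and> open W \<and> p \<in> W \<and> W \<subseteq> U \<and>
    smooth_on (\<phi> ` W) (f \<circ> inv_into U \<phi>)"
  shows "f \<in> smooth_functions \<A>"
proof -
  have "smooth_on (\<psi> ` V) (f \<circ> inv_into V \<psi>)" if V: "(V, \<psi>) \<in> \<A>" for V \<psi>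
  proof (rule smooth_on_local)
    fix x assume x: "x \<in> \<psi> ` V"
    define p where "p = inv_into V \<psi> x"
    have p: "p \<in> V" "\<psi> p = x" using inv_chart[OF x] by (auto simp: p_def)
    obtain U \<phi> W where U: "(U, \<phi>) \<in> \<A>" and W: "open W" "p \<in> W" "W \<subseteq> U"
      and f: "smooth_on (\<phi> ` W) (f \<circ> inv_into U \<phi>)"
      using assms[OF subsetD[OF chart_subset[OF V] p(1)]] by (elim exE conjE)
    have inv: "inv_into V \<psi> (\<psi> q) = q" "inv_into U \<phi> (\<phi> q) = q" if "q \<in> V \<inter> W" for q
      using that W chart_inv[OF V] chart_inv[OF U] by auto
    have o: "open (\<psi> ` (V \<inter> W))"
      using chart_open[OF V] W by (intro chart_image_open_subset[OF V]) auto
    have "smooth_on (\<psi> ` (V \<inter> W)) (\<lambda>x. (f \<circ> inv_into U \<phi>) ((\<phi> \<circ> inv_into V \<psi>) x))"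
    proof (rule smooth_on_compose[OF o chart_image_open_subset[OF U W(1,3)] _ _ f])
      show "(\<phi> \<circ> inv_into V \<psi>) ` \<psi> ` (V \<inter> W) \<subseteq> \<phi> ` W" using inv by auto
      show "smooth_on (\<psi> ` (V \<inter> W)) (\<phi> \<circ> inv_into V \<psi>)"
        by (rule smooth_on_subset[OF transition_smooth[OF V U]]) (use W in auto)
    qed
    then have "smooth_on (\<psi> ` (V \<inter> W)) (f \<circ> inv_into V \<psi>)"
      by (rule smooth_on_cong[OF o, rotated]) (use inv in auto)
    then show "\<exists>T. open T \<and> x \<in> T \<and> smooth_on T (f \<circ> inv_into V \<psi>)"
      using o p W by blast
  qed
  then show ?thesis by (auto simp: smooth_functions_def)
qed

lemma smooth_functions_const: "(\<lambda>x. c) \<in> smooth_functions \<A>"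
  by (auto simp: smooth_functions_def comp_def smooth_on_const)

lemma smooth_functions_add:
  "f \<in> smooth_functions \<A> \<Longrightarrow> h \<in> smooth_functions \<A> \<Longrightarrow> (\<lambda>x. f x + h x) \<in> smooth_functions \<A>"
  unfolding smooth_functions_def comp_def by (auto intro!: smooth_on_add chart_image_open)

lemma smooth_functions_mult:
  "f \<in> smooth_functions \<A> \<Longrightarrow> h \<in> smooth_functions \<A> \<Longrightarrow> (\<lambda>x. f x * h x) \<in> smooth_functions \<A>"
  unfolding smooth_functions_def comp_def by (auto intro!: smooth_on_mult chart_image_open)

lemma smooth_functions_sum:
  "(\<And>i. i \<in> I \<Longrightarrow> f i \<in> smooth_functions \<A>) \<Longrightarrow> (\<lambda>x. \<Sum>i\<in>I. f i x) \<in> smooth_functions \<A>"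
  by (induction I rule: infinite_finite_induct)
     (auto intro: smooth_functions_add smooth_functions_const)

lemma smooth_functions_continuous:
  assumes "f \<in> smooth_functions \<A>"
  shows "continuous_on M f"
proof -
  have "continuous_on U f" if U: "(U, \<phi>) \<in> \<A>" for U \<phi>
  proof -
    have "continuous_on U (\<lambda>p. (f \<circ> inv_into U \<phi>) (\<phi> p))"
      by (rule continuous_on_compose2[OF smooth_on_continuous_on[OF smooth_functions_chart[OF assms U]]
            homeomorphism_cont1[OF chart_homeomorphism[OF U]]]) simp
    then show ?thesis by (rule continuous_on_eq) (simp add: chart_inv[OF U])
  qed
  then show ?thesis unfolding manifold_carrier_def
    using chart_open by (intro continuous_on_open_Union) auto
qed

text \<open>At points outside \<open>U\<close> a neighbourhood on which the extension vanishes is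
  needed. It is obtained by removing the image \<open>K\<close> of the closed ball, which is compact
  and hence closed because the ambient space is Hausdorff.\<close>

lemma smooth_extension:
  assumes U: "(U, \<phi>) \<in> \<A>" and "cball c r \<subseteq> \<phi> ` U"
    and k: "smooth_on (\<phi> ` U) k" "\<And>x. x \<notin> cball c r \<Longrightarrow> k x = 0"
  shows "(\<lambda>p. if p \<in> U then k (\<phi> p) else 0) \<in> smooth_functions \<A>" (is "?f \<in> _")
proof (rule smooth_functions_local)
  fix p assume "p \<in> M"
  then obtain V \<psi> where V: "(V, \<psi>) \<in> \<A>" "p \<in> V" by (auto simp: manifold_carrier_def)
  show "\<exists>U \<phi> W. (U, \<phi>) \<in> \<A> \<and> open W \<and> p \<in> W \<and> W \<subseteq> U \<and> smooth_on (\<phi> ` W) (?f \<circ> inv_into U \<phi>)"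
  proof (cases "p \<in> U")
    case True
    have "smooth_on (\<phi> ` U) (?f \<circ> inv_into U \<phi>)"
      by (rule smooth_on_cong[OF chart_image_open[OF U] _ k(1)]) (auto simp: inv_chart chart_inv[OF U])
    then show ?thesis using True U chart_open[OF U] by blast
  next
    case False
    define K where "K = inv_into U \<phi> ` cball c r"
    have "compact K" unfolding K_def
      by (intro compact_continuous_image compact_cball
          continuous_on_subset[OF homeomorphism_cont2[OF chart_homeomorphism[OF U]] assms(2)])
    then have o: "open (V - K)" using chart_open[OF V(1)] by (simp add: compact_imp_closed open_Diff)
    have "K \<subseteq> U" unfolding K_def by (intro image_subsetI inv_chart(2) subsetD[OF assms(2)])
    then have p: "p \<in> V - K" using V False by auto
    have zero: "?f q = 0" if "q \<in> V - K" for q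
    proof -
      have "\<phi> q \<notin> cball c r" if "q \<in> U"
        using \<open>q \<in> V - K\<close> chart_inv[OF U that] unfolding K_def by (metis DiffE image_eqI)
      then show ?thesis using k(2) by simp
    qed
    have "smooth_on (\<psi> ` (V - K)) (?f \<circ> inv_into V \<psi>)"
    proof (rule smooth_on_cong[OF chart_image_open_subset[OF V(1) o] _ smooth_on_const[of _ 0]])
      show "0 = (?f \<circ> inv_into V \<psi>) y" if "y \<in> \<psi> ` (V - K)" for y
        using that zero chart_inv[OF V(1)] by (elim imageE) (simp only: o_apply DiffD1)
    qed auto
    then show ?thesis using V(1) o p by blast
  qed
qed

section \<open>Tangent vectors as directional derivatives in a chart\<close>

definition chart_vec :: "'a set \<Rightarrow> ('a \<Rightarrow> 'e) \<Rightarrow> 'a \<Rightarrow> 'e \<Rightarrow> 'a tvec"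
  where "chart_vec U \<phi> p u = (\<lambda>f. if f \<in> smooth_functions \<A>
    then frechet_derivative (f \<circ> inv_into U \<phi>) (at (\<phi> p)) u else 0)"

lemma chart_has_derivative:
  assumes "(U, \<phi>) \<in> \<A>" "p \<in> U" "f \<in> smooth_functions \<A>"
  shows "((f \<circ> inv_into U \<phi>) has_derivative (\<lambda>u. chart_vec U \<phi> p u f)) (at (\<phi> p))"
  using smooth_on_has_derivative[OF smooth_functions_chart[OF assms(3,1)], of "\<phi> p"] assms
  by (simp add: chart_vec_def)

lemma chart_vec_tangent:
  assumes U: "(U, \<phi>) \<in> \<A>" "p \<in> U"
  shows "chart_vec U \<phi> p u \<in> T p"
proof -
  note d = chart_has_derivative[OF U]
  have "frechet_derivative ((\<lambda>x. f x + h x) \<circ> inv_into U \<phi>) (at (\<phi> p)) u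
      = chart_vec U \<phi> p u f + chart_vec U \<phi> p u h"
    if "f \<in> smooth_functions \<A>" "h \<in> smooth_functions \<A>" for f h
    using fun_cong[OF frechet_derivative_eqI[OF has_derivative_add[OF d[OF that(1)] d[OF that(2)]]], of u]
    by (simp add: comp_def)
  moreover have "frechet_derivative ((\<lambda>x. f x * h x) \<circ> inv_into U \<phi>) (at (\<phi> p)) u
      = f p * chart_vec U \<phi> p u h + h p * chart_vec U \<phi> p u f"
    if "f \<in> smooth_functions \<A>" "h \<in> smooth_functions \<A>" for f h
    using fun_cong[OF frechet_derivative_eqI[OF has_derivative_mult[OF d[OF that(1)] d[OF that(2)]]], of u]
    by (simp add: comp_def chart_inv[OF U])
  moreover have "frechet_derivative ((\<lambda>x. c * f x) \<circ> inv_into U \<phi>) (at (\<phi> p)) u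
      = c * chart_vec U \<phi> p u f" if "f \<in> smooth_functions \<A>" for f c
    using fun_cong[OF frechet_derivative_eqI[OF has_derivative_mult_right[OF d[OF that]]], of c u]
    by (simp add: comp_def)
  ultimately show ?thesis
    unfolding tangent_space_def
    by (auto simp: smooth_functions_add smooth_functions_mult smooth_functions_const)
       (auto simp: chart_vec_def smooth_functions_add smooth_functions_mult smooth_functions_const)
qed

lemma chart_vec_linear:
  assumes U: "(U, \<phi>) \<in> \<A>" "p \<in> U"
  shows "chart_vec U \<phi> p (u + w) = chart_vec U \<phi> p u + chart_vec U \<phi> p w"
    and "chart_vec U \<phi> p (c *\<^sub>R u) = c *\<^sub>R chart_vec U \<phi> p u"
proof -
  have lin: "linear (\<lambda>u. chart_vec U \<phi> p u f)" if "f \<in> smooth_functions \<A>" for f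
    using has_derivative_linear[OF chart_has_derivative[OF U that]] .
  show "chart_vec U \<phi> p (u + w) = chart_vec U \<phi> p u + chart_vec U \<phi> p w"
    using linear_add[OF lin] by (auto simp: fun_eq_iff chart_vec_def)
  show "chart_vec U \<phi> p (c *\<^sub>R u) = c *\<^sub>R chart_vec U \<phi> p u"
    using linear_scale[OF lin] by (auto simp: fun_eq_iff chart_vec_def scaleR_fun_def)
qed

lemma chart_ball:
  assumes "(U, \<phi>) \<in> \<A>" "p \<in> U"
  obtains R where "R > 0" "cball (\<phi> p) R \<subseteq> \<phi> ` U"
  using chart_image_open[OF assms(1)] assms(2) open_contains_cball by blast

text \<open>Vector fields live on the whole manifold, so coordinate fields are cut off by a bump.
  The value 1 at the centre recovers the coordinate vector at \<open>p\<close>, and positivity on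
  the ball allows division by the bump elsewhere.\<close>

lemma chart_fields:
  assumes U: "(U, \<phi>) \<in> \<A>" "p \<in> U"
  obtains b R where "R > 0" "ball (\<phi> p) R \<subseteq> \<phi> ` U" "smooth_on UNIV b"
    "\<And>x. x \<in> ball (\<phi> p) R \<Longrightarrow> b x > 0" "b (\<phi> p) = 1"
    "\<And>u. (\<lambda>q. if q \<in> U then b (\<phi> q) *\<^sub>R chart_vec U \<phi> q u else 0) \<in> vector_fields \<A>"
proof -
  obtain R where R: "R > 0" "cball (\<phi> p) R \<subseteq> \<phi> ` U" using chart_ball[OF U] .
  obtain b :: "'e \<Rightarrow> real" where b: "smooth_on UNIV b" "\<And>x. x \<in> ball (\<phi> p) R \<Longrightarrow> b x > 0"
    "\<And>x. x \<notin> ball (\<phi> p) R \<Longrightarrow> b x = 0" "b (\<phi> p) = 1"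
    using smooth_bump[OF R(1)] by metis
  have "(\<lambda>q. if q \<in> U then b (\<phi> q) *\<^sub>R chart_vec U \<phi> q u else 0) \<in> vector_fields \<A>" (is "?X \<in> _") for u
    unfolding vector_fields_def
  proof (intro CollectI conjI ballI allI impI)
    have zero: "0 \<in> T q" for q by (simp add: tangent_space_def)
    have scale: "c *\<^sub>R v \<in> T q" if "v \<in> T q" for c v q
      using that by (auto simp: tangent_space_def scaleR_fun_def algebra_simps)
    show "?X q \<in> T q" for q using chart_vec_tangent[OF U(1)] scale zero by simp
    show "?X q = 0" if "q \<notin> M" for q using that chart_subset[OF U(1)] by auto
    fix f assume f: "f \<in> smooth_functions \<A>"
    define k where "k x = b x * frechet_derivative (f \<circ> inv_into U \<phi>) (at x) u" for x
    have "(\<lambda>q. if q \<in> U then k (\<phi> q) else 0) \<in> smooth_functions \<A>"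
    proof (rule smooth_extension[OF U(1) R(2)])
      show "smooth_on (\<phi> ` U) k" unfolding k_def
        by (intro smooth_on_mult chart_image_open[OF U(1)] smooth_on_derivative
            smooth_functions_chart[OF f U(1)] smooth_on_subset[OF b(1)]) simp
    qed (auto simp: k_def b(3))
    moreover have "(\<lambda>q. ?X q f) = (\<lambda>q. if q \<in> U then k (\<phi> q) else 0)"
      by (auto simp: k_def chart_vec_def f scaleR_fun_def)
    ultimately show "(\<lambda>q. ?X q f) \<in> smooth_functions \<A>" by simp
  qed
  moreover have "ball (\<phi> p) R \<subseteq> \<phi> ` U" using R(2) by auto
  ultimately show thesis using that R(1) b by blast
qed

lemma tangent_smul: "v \<in> T p \<Longrightarrow> c *\<^sub>R v \<in> T p"
  and tangent_add: "v \<in> T p \<Longrightarrow> w \<in> T p \<Longrightarrow> v + w \<in> T p"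
  and tangent_zero: "0 \<in> T p"
  by (auto simp: tangent_space_def scaleR_fun_def algebra_simps)

lemma tangent_fadd:
  "v \<in> T p \<Longrightarrow> f \<in> smooth_functions \<A> \<Longrightarrow> h \<in> smooth_functions \<A> \<Longrightarrow> v (\<lambda>x. f x + h x) = v f + v h"
  and tangent_fscale: "v \<in> T p \<Longrightarrow> f \<in> smooth_functions \<A> \<Longrightarrow> v (\<lambda>x. c * f x) = c * v f"
  and tangent_fmult: "v \<in> T p \<Longrightarrow> f \<in> smooth_functions \<A> \<Longrightarrow> h \<in> smooth_functions \<A> \<Longrightarrow>
    v (\<lambda>x. f x * h x) = f p * v h + h p * v f"
  by (auto simp: tangent_space_def)

lemma tangent_const:
  assumes v: "v \<in> T p"
  shows "v (\<lambda>x. c) = 0"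
proof -
  note one = smooth_functions_const[of 1]
  have "v (\<lambda>x. 1) = 0" using tangent_fmult[OF v one one] by simp
  then show ?thesis using tangent_fscale[OF v one, of c] by simp
qed

lemma tangent_fsum:
  assumes "v \<in> T p" "\<And>i. i \<in> I \<Longrightarrow> f i \<in> smooth_functions \<A>"
  shows "v (\<lambda>x. \<Sum>i\<in>I. f i x) = (\<Sum>i\<in>I. v (f i))"
  using assms(2)
proof (induction I rule: infinite_finite_induct)
  case (insert i I)
  then show ?case
    using tangent_fadd[OF assms(1), of "f i" "\<lambda>x. \<Sum>i\<in>I. f i x"] smooth_functions_sum[of I f] by simp
qed (simp_all add: tangent_const[OF assms(1)])

text \<open>\<open>E k\<close> is \<open>k\<close> in coordinates times a bump. It is linear in
  \<open>k\<close>, but multiplicative only up to the factor \<open>E 1\<close>, which is the bump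
  itself. In the derivative clause \<open>k (\<phi> p) = 0\<close> removes the term with the
  derivative of the bump.\<close>

lemma cutoff_extension:
  assumes U: "(U, \<phi>) \<in> \<A>" "p \<in> U"
  obtains E R where "R > 0" "ball (\<phi> p) R \<subseteq> \<phi> ` U"
    "\<And>k. smooth_on (ball (\<phi> p) R) k \<Longrightarrow> E k \<in> smooth_functions \<A>"
    "\<And>k. E k p = k (\<phi> p)"
    "\<And>k l q. E k q * E l q = E (\<lambda>x. 1) q * E (\<lambda>x. k x * l x) q"
    "\<And>k q. E (\<lambda>x. 1) q * k q = E (k \<circ> inv_into U \<phi>) q"
    "\<And>k l q. (\<And>x. x \<in> ball (\<phi> p) R \<Longrightarrow> k x = l x) \<Longrightarrow> E k q = E l q"
    "\<And>(I :: 'e set) k q. E (\<lambda>x. \<Sum>i\<in>I. k i x) q = (\<Sum>i\<in>I. E (k i) q)"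
    "\<And>k l q. E (\<lambda>x. k x + l x) q = E k q + E l q"
    "\<And>c k q. E (\<lambda>x. c * k x) q = c * E k q"
    "\<And>k u. smooth_on (ball (\<phi> p) R) k \<Longrightarrow> k (\<phi> p) = 0 \<Longrightarrow>
      chart_vec U \<phi> p u (E k) = frechet_derivative k (at (\<phi> p)) u"
proof -
  let ?c = "\<phi> p"
  obtain R where R: "R > 0" "cball ?c R \<subseteq> \<phi> ` U" using chart_ball[OF U] .
  then have sub: "ball ?c R \<subseteq> \<phi> ` U" by auto
  \<comment> \<open>Radius \<open>R/2\<close> keeps the support in a closed ball inside
    \<open>ball ?c R\<close>, so smoothness of \<open>k\<close> is required only on the larger open
    ball.\<close>
  obtain b :: "'e \<Rightarrow> real" where b: "smooth_on UNIV b"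
    "\<And>x. x \<notin> ball ?c (R/2) \<Longrightarrow> b x = 0" "b ?c = 1"
    using smooth_bump[of "R/2" ?c] R(1) by (metis half_gt_zero)
  define E where "E k q = (if q \<in> U then if \<phi> q \<in> ball ?c R then b (\<phi> q) * k (\<phi> q) else 0 else 0)"
    for k q
  have E_smooth: "E k \<in> smooth_functions \<A>" if k: "smooth_on (ball ?c R) k" for k
    unfolding E_def
  proof (rule smooth_extension[OF U(1), of ?c "R/2"])
    let ?k = "\<lambda>x. if x \<in> ball ?c R then b x * k x else 0"
    show "cball ?c (R/2) \<subseteq> \<phi> ` U" using R by (intro order_trans[OF _ R(2)]) auto
    show "?k x = 0" if "x \<notin> cball ?c (R/2)" for x using b(2)[of x] that by auto
    show "smooth_on (\<phi> ` U) ?k"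
    proof (rule smooth_on_local)
      fix x assume "x \<in> \<phi> ` U"
      show "\<exists>S. open S \<and> x \<in> S \<and> smooth_on S ?k"
      proof (cases "x \<in> ball ?c R")
        case True
        have "smooth_on (ball ?c R) ?k"
          by (rule smooth_on_cong[of _ "\<lambda>x. b x * k x"])
             (auto intro!: smooth_on_mult k smooth_on_subset[OF b(1)])
        then show ?thesis using True by blast
      next
        case False
        have "smooth_on (- cball ?c (R/2)) ?k"
          by (rule smooth_on_cong[OF _ _ smooth_on_const[of _ 0]]) (use b(2) in auto)
        moreover have "x \<in> - cball ?c (R/2)" using False R(1) by auto
        ultimately show ?thesis by blast
      qed
    qed
  qed
  have deriv: "chart_vec U \<phi> p u (E k) = frechet_derivative k (at ?c) u"
    if k: "smooth_on (ball ?c R) k" "k ?c = 0" for k u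
  proof -
    have "((\<lambda>x. b x * k x) has_derivative
        (\<lambda>v. b ?c * frechet_derivative k (at ?c) v + frechet_derivative b (at ?c) v * k ?c)) (at ?c)"
      by (intro has_derivative_mult smooth_on_has_derivative[OF k(1)] smooth_on_has_derivative[OF b(1)])
         (use R in auto)
    then have "((\<lambda>x. b x * k x) has_derivative frechet_derivative k (at ?c)) (at ?c)"
      by (simp add: k(2) b(3))
    then have "((E k \<circ> inv_into U \<phi>) has_derivative frechet_derivative k (at ?c)) (at ?c)"
    proof (rule has_derivative_transform_within_open[OF _ open_ball])
      show "?c \<in> ball ?c R" using R(1) by simp
      show "b x * k x = (E k \<circ> inv_into U \<phi>) x" if "x \<in> ball ?c R" for x
        using that subsetD[OF sub that] by (simp add: E_def inv_chart)
    qed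
    then show ?thesis
      by (simp add: chart_vec_def E_smooth[OF k(1)] frechet_derivative_eqI)
  qed
  show thesis
  proof (rule that[of R E])
    show "E k p = k ?c" for k using U R(1) b(3) by (simp add: E_def)
    show "E k q * E l q = E (\<lambda>x. 1) q * E (\<lambda>x. k x * l x) q" for k l q by (simp add: E_def)
    show "E (\<lambda>x. 1) q * k q = E (k \<circ> inv_into U \<phi>) q" for k q
      by (simp add: E_def chart_inv[OF U(1)])
    show "E k q = E l q" if "\<And>x. x \<in> ball ?c R \<Longrightarrow> k x = l x" for k l q
      using that by (simp add: E_def)
    show "E (\<lambda>x. \<Sum>i\<in>I. k i x) q = (\<Sum>i\<in>I. E (k i) q)" for I :: "'e set" and k q
      by (simp add: E_def sum_distrib_left)
    show "E (\<lambda>x. k x + l x) q = E k q + E l q" for k l q by (simp add: E_def algebra_simps)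
    show "E (\<lambda>x. c * k x) q = c * E k q" for c k q by (simp add: E_def)
  qed (use R(1) sub E_smooth deriv in auto)
qed

lemma smooth_on_coordinate: "open S \<Longrightarrow> smooth_on S (\<lambda>x::'e. (x - c) \<bullet> i)"
  using smooth_on_add[OF _ smooth_on_linear[OF _ bounded_linear_inner_left] smooth_on_const, of S i "- (c \<bullet> i)"]
  by (simp add: inner_diff_left)

text \<open>The classical identification of derivations with directional derivatives. Hadamard's
  lemma writes \<open>f\<close> near \<open>p\<close> as \<open>f p\<close> plus products of
  coordinates with smooth functions; by the Leibniz rule \<open>v\<close> sees only its values on
  the coordinates and the first derivatives of \<open>f\<close>.\<close>

lemma tangent_eq_chart_vec:
  assumes U: "(U, \<phi>) \<in> \<A>" "p \<in> U" and v: "v \<in> T p"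
  obtains u where "v = chart_vec U \<phi> p u"
proof -
  obtain E R where R: "R > 0" "ball (\<phi> p) R \<subseteq> \<phi> ` U"
    and E: "\<And>k. smooth_on (ball (\<phi> p) R) k \<Longrightarrow> E k \<in> smooth_functions \<A>"
    "\<And>k. E k p = k (\<phi> p)"
    "\<And>k l q. E k q * E l q = E (\<lambda>x. 1) q * E (\<lambda>x. k x * l x) q"
    "\<And>k q. E (\<lambda>x. 1) q * k q = E (k \<circ> inv_into U \<phi>) q"
    "\<And>k l q. (\<And>x. x \<in> ball (\<phi> p) R \<Longrightarrow> k x = l x) \<Longrightarrow> E k q = E l q"
    "\<And>(I :: 'e set) k q. E (\<lambda>x. \<Sum>i\<in>I. k i x) q = (\<Sum>i\<in>I. E (k i) q)"
    "\<And>k l q. E (\<lambda>x. k x + l x) q = E k q + E l q"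
    "\<And>c k q. E (\<lambda>x. c * k x) q = c * E k q"
    by (rule cutoff_extension[OF U]) blast
  define c where "c = \<phi> p"
  define X where "X i = E (\<lambda>x. (x - c) \<bullet> i)" for i
  define \<beta> where "\<beta> = E (\<lambda>x. 1)"
  define u where "u = (\<Sum>i\<in>Basis. v (X i) *\<^sub>R i)"
  have X: "X i \<in> smooth_functions \<A>" for i unfolding X_def by (intro E smooth_on_coordinate) simp
  have \<beta>: "\<beta> \<in> smooth_functions \<A>" "\<beta> p = 1" unfolding \<beta>_def by (auto intro: E smooth_on_const simp: E(2))
  have "v f = chart_vec U \<phi> p u f" if f: "f \<in> smooth_functions \<A>" for f
  proof -
    let ?F = "f \<circ> inv_into U \<phi>"
    have F: "smooth_on (ball c R) ?F"
      using smooth_on_subset[OF smooth_functions_chart[OF f U(1)]] R(2) by (simp add: c_def)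
    obtain h where h: "\<And>i. i \<in> Basis \<Longrightarrow> smooth_on (ball c R) (h i)"
      "\<And>x. x \<in> ball c R \<Longrightarrow> ?F x = ?F c + (\<Sum>i\<in>Basis. ((x - c) \<bullet> i) * h i x)"
      "\<And>i. i \<in> Basis \<Longrightarrow> h i c = frechet_derivative ?F (at c) i"
      by (rule hadamard[OF F]) blast
    have Eh: "E (h i) \<in> smooth_functions \<A>" if "i \<in> Basis" for i
      using E(1) h(1)[OF that] by (simp add: c_def)
    have Fc: "?F c = f p" by (simp add: c_def chart_inv[OF U])
    \<comment> \<open>One factor \<beta> makes the Hadamard expansion global; the second turns each
      summand into a product of the two global functions \<open>X i\<close> and
      \<open>E (h i)\<close>.\<close>
    have "\<beta> q * (\<beta> q * f q) = f p * (\<beta> q * \<beta> q) + (\<Sum>i\<in>Basis. X i q * E (h i) q)" for q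
    proof -
      have "\<beta> q * f q = E (\<lambda>x. ?F c * 1 + (\<Sum>i\<in>Basis. ((x - c) \<bullet> i) * h i x)) q"
        unfolding \<beta>_def E(4) by (rule E(5)) (use h(2) in \<open>simp add: c_def\<close>)
      also have "\<dots> = f p * \<beta> q + (\<Sum>i\<in>Basis. E (\<lambda>x. ((x - c) \<bullet> i) * h i x) q)"
        unfolding E(6,7,8) Fc \<beta>_def ..
      finally have eq: "\<beta> q * f q = f p * \<beta> q + (\<Sum>i\<in>Basis. E (\<lambda>x. ((x - c) \<bullet> i) * h i x) q)" .
      have "X i q * E (h i) q = \<beta> q * E (\<lambda>x. ((x - c) \<bullet> i) * h i x) q" for i
        unfolding X_def \<beta>_def by (rule E(3))
      then show ?thesis unfolding eq by (simp only: distrib_left sum_distrib_left mult.left_commute)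
    qed
    then have "v (\<lambda>q. \<beta> q * (\<beta> q * f q)) = v (\<lambda>q. f p * (\<beta> q * \<beta> q) + (\<Sum>i\<in>Basis. X i q * E (h i) q))"
      by simp
    also have "\<dots> = f p * v (\<lambda>q. \<beta> q * \<beta> q) + (\<Sum>i\<in>Basis. v (\<lambda>q. X i q * E (h i) q))"
      by (subst tangent_fadd[OF v] tangent_fsum[OF v] tangent_fscale[OF v];
          (intro smooth_functions_sum smooth_functions_mult smooth_functions_const \<beta> X Eh)?; assumption?)+ simp
    also have "(\<Sum>i\<in>Basis. v (\<lambda>q. X i q * E (h i) q)) = (\<Sum>i\<in>Basis. h i c * v (X i))"
    proof (rule sum.cong[OF refl])
      fix i :: 'e assume "i \<in> Basis"
      then show "v (\<lambda>q. X i q * E (h i) q) = h i c * v (X i)"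
        using tangent_fmult[OF v X Eh, of i i] by (simp add: X_def E(2) c_def)
    qed
    also have "\<dots> = frechet_derivative ?F (at c) u"
    proof -
      interpret bounded_linear "frechet_derivative ?F (at c)"
        using smooth_on_has_derivative[OF F, of c] R(1) by (intro has_derivative_bounded_linear) simp
      show ?thesis unfolding u_def by (simp add: sum scaleR h(3) mult.commute)
    qed
    finally have "v (\<lambda>q. \<beta> q * (\<beta> q * f q)) = f p * v (\<lambda>q. \<beta> q * \<beta> q) + frechet_derivative ?F (at c) u" .
    \<comment> \<open>The same left-hand side by the Leibniz rule. The term
      \<open>f p * v (\<beta>^2)\<close> occurs in both evaluations and cancels, so it need not be
      known.\<close>
    moreover have "v (\<lambda>q. \<beta> q * (\<beta> q * f q)) = f p * v (\<lambda>q. \<beta> q * \<beta> q) + v f"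
      using \<beta> f by (simp add: tangent_fmult[OF v] smooth_functions_mult)
    ultimately show ?thesis by (simp add: chart_vec_def f c_def)
  qed
  moreover have "v f = chart_vec U \<phi> p u f" if "f \<notin> smooth_functions \<A>" for f
    using v that by (auto simp: tangent_space_def chart_vec_def)
  ultimately show thesis using that[of u] by blast
qed

text \<open>Tested on the cut-off coordinate functions, which vanish at \<open>p\<close> and recover
  the components of \<open>u\<close>.\<close>

lemma chart_vec_eq_0_iff:
  assumes U: "(U, \<phi>) \<in> \<A>" "p \<in> U"
  shows "chart_vec U \<phi> p u = 0 \<longleftrightarrow> u = 0"
proof
  assume 0: "chart_vec U \<phi> p u = 0"
  obtain E R where E: "\<And>k w. smooth_on (ball (\<phi> p) R) k \<Longrightarrow> k (\<phi> p) = (0::real) \<Longrightarrow>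
      chart_vec U \<phi> p w (E k) = frechet_derivative k (at (\<phi> p)) w"
    by (rule cutoff_extension[OF U]) (rule that, assumption)
  have "u \<bullet> i = 0" for i
  proof -
    have "((\<lambda>x. (x - \<phi> p) \<bullet> i) has_derivative (\<lambda>v. v \<bullet> i)) (at (\<phi> p))"
      by (auto intro!: derivative_eq_intros)
    then show ?thesis
      using E[OF smooth_on_coordinate, of "\<phi> p" i u] 0 by (simp add: frechet_derivative_eqI)
  qed
  then show "u = 0" using inner_eq_zero_iff by blast
next
  assume "u = 0"
  then show "chart_vec U \<phi> p u = 0" using chart_vec_linear(2)[OF U, of 0 u] by simp
qed

text \<open>Derivations are local, because in a chart each of them is a derivative at a
  point.\<close>

lemma tangent_const_near:
  assumes v: "v \<in> T p" and f: "f \<in> smooth_functions \<A>"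
    and W: "open W" "p \<in> W" "W \<subseteq> M" "\<And>q. q \<in> W \<Longrightarrow> f q = c"
  shows "v f = 0"
proof -
  obtain U \<phi> where U: "(U, \<phi>) \<in> \<A>" "p \<in> U" using W by (auto simp: manifold_carrier_def)
  obtain u where u: "v = chart_vec U \<phi> p u" using tangent_eq_chart_vec[OF U v] .
  have o: "open (\<phi> ` (U \<inter> W))"
    using chart_open[OF U(1)] W by (intro chart_image_open_subset[OF U(1)]) auto
  have "((f \<circ> inv_into U \<phi>) has_derivative (\<lambda>u. 0)) (at (\<phi> p))"
    by (rule has_derivative_transform_within_open[OF has_derivative_const[of c] o])
       (use U W chart_inv[OF U(1)] in auto)
  then show ?thesis unfolding u by (simp add: chart_vec_def f frechet_derivative_eqI)
qed

lemma vector_field_extension: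
  assumes "p \<in> M" "v \<in> T p"
  obtains X where "X \<in> vector_fields \<A>" "X p = v"
proof -
  obtain U \<phi> where U: "(U, \<phi>) \<in> \<A>" "p \<in> U" using assms by (auto simp: manifold_carrier_def)
  obtain u where u: "v = chart_vec U \<phi> p u" using tangent_eq_chart_vec[OF U assms(2)] .
  show thesis
    by (rule chart_fields[OF U]) (rule that, assumption, simp add: U u)
qed

end

section \<open>Tensor calculus on Kaehler manifolds\<close>

lemma scaleR_fun_apply: "(c *\<^sub>R f) x = c *\<^sub>R f x"
  by (simp add: scaleR_fun_def)

context manifold
begin

lemma tangent_diff: "v \<in> T p \<Longrightarrow> w \<in> T p \<Longrightarrow> v - w \<in> T p"
  using tangent_add[of v p "(-1) *\<^sub>R w"] tangent_smul[of w p "-1"] by simp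

lemma tangent_uminus: "v \<in> T p \<Longrightarrow> - v \<in> T p"
  using tangent_smul[of v p "-1"] by simp

lemma vector_field_tangent: "X \<in> vector_fields \<A> \<Longrightarrow> X p \<in> T p"
  by (cases "p \<in> M") (auto simp: vector_fields_def tangent_zero)

lemma vector_field_off: "X \<in> vector_fields \<A> \<Longrightarrow> p \<notin> M \<Longrightarrow> X p = 0"
  by (simp add: vector_fields_def)

lemma vector_field_smooth:
  "X \<in> vector_fields \<A> \<Longrightarrow> f \<in> smooth_functions \<A> \<Longrightarrow> (\<lambda>p. X p f) \<in> smooth_functions \<A>"
  by (simp add: vector_fields_def)

lemma vector_field_eqI:
  "X \<in> vector_fields \<A> \<Longrightarrow> Y \<in> vector_fields \<A> \<Longrightarrow> (\<And>p. p \<in> M \<Longrightarrow> X p = Y p) \<Longrightarrow> X = Y"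
  by (rule ext) (metis vector_field_off)

lemma vector_fields_add:
  "X \<in> vector_fields \<A> \<Longrightarrow> Y \<in> vector_fields \<A> \<Longrightarrow> X + Y \<in> vector_fields \<A>"
  by (auto simp: vector_fields_def tangent_add intro: smooth_functions_add)

lemma vector_fields_zero: "0 \<in> vector_fields \<A>"
  by (auto simp: vector_fields_def tangent_zero smooth_functions_const)

lemma vector_fields_fscale:
  "f \<in> smooth_functions \<A> \<Longrightarrow> X \<in> vector_fields \<A> \<Longrightarrow> fscale f X \<in> vector_fields \<A>"
  by (auto simp: vector_fields_def fscale_def tangent_smul scaleR_fun_apply intro: smooth_functions_mult)

lemma fscale_const: "fscale (\<lambda>x. c) X = c *\<^sub>R X"
  by (simp add: fscale_def scaleR_fun_apply fun_eq_iff)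

lemma vector_fields_scaleR: "X \<in> vector_fields \<A> \<Longrightarrow> c *\<^sub>R X \<in> vector_fields \<A>"
  using vector_fields_fscale[OF smooth_functions_const[of c]] by (simp add: fscale_const)

lemma vector_fields_app:
  "A \<in> endo_fields \<A> \<Longrightarrow> X \<in> vector_fields \<A> \<Longrightarrow> app A X \<in> vector_fields \<A>"
  by (simp add: endo_fields_def)

lemma endo_tangent: "A \<in> endo_fields \<A> \<Longrightarrow> p \<in> M \<Longrightarrow> v \<in> T p \<Longrightarrow> A p v \<in> T p"
  and endo_add: "A \<in> endo_fields \<A> \<Longrightarrow> p \<in> M \<Longrightarrow> v \<in> T p \<Longrightarrow> w \<in> T p \<Longrightarrow> A p (v + w) = A p v + A p w"
  and endo_scale: "A \<in> endo_fields \<A> \<Longrightarrow> p \<in> M \<Longrightarrow> v \<in> T p \<Longrightarrow> A p (c *\<^sub>R v) = c *\<^sub>R A p v"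
  and endo_off: "A \<in> endo_fields \<A> \<Longrightarrow> p \<notin> M \<or> v \<notin> T p \<Longrightarrow> A p v = 0"
  by (simp_all add: endo_fields_def)

lemma endo_diff:
  assumes "A \<in> endo_fields \<A>" "p \<in> M" "v \<in> T p" "w \<in> T p"
  shows "A p (v - w) = A p v - A p w"
  using endo_add[OF assms(1-3), of "(-1) *\<^sub>R w"] endo_scale[OF assms(1,2,4), of "-1"] tangent_smul[OF assms(4), of "-1"]
  by simp

lemma endo_uminus:
  assumes "A \<in> endo_fields \<A>" "p \<in> M" "v \<in> T p"
  shows "A p (- v) = - A p v"
  using endo_scale[OF assms, of "-1"] by simp

lemma endo_zero: "A \<in> endo_fields \<A> \<Longrightarrow> A p 0 = 0"
  using endo_scale[of A p 0 0] tangent_zero[of p] endo_off[of A p 0] by (cases "p \<in> M") auto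

text \<open>Endomorphism fields are normalised to vanish on everything that is not a tangent vector
  of the manifold, hence the case distinction.\<close>

definition id_endo :: "'a endo"
  where "id_endo p v = (if p \<in> M \<and> v \<in> T p then v else 0)"

lemma id_endo_fields: "id_endo \<in> endo_fields \<A>"
proof -
  have "app id_endo X = X" if "X \<in> vector_fields \<A>" for X
    using vector_field_off[OF that] vector_field_tangent[OF that] by (auto simp: app_def id_endo_def fun_eq_iff)
  then show ?thesis by (simp add: endo_fields_def id_endo_def tangent_add tangent_smul)
qed

end

locale kaehler = manifold \<A>
  for \<A> :: "('a::{t2_space,second_countable_topology}, 'e::euclidean_space) atlas" +
  fixes g :: "'a metric" and J :: "'a endo" and nabla :: "'a connection"
  assumes kaehler_manifold: "kaehler_manifold \<A> g J nabla"
begin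

lemma
  assumes p: "p \<in> M"
  shows metric_sym: "\<And>u v. u \<in> T p \<Longrightarrow> v \<in> T p \<Longrightarrow> g p u v = g p v u"
    and metric_add_left: "\<And>u v w. u \<in> T p \<Longrightarrow> v \<in> T p \<Longrightarrow> w \<in> T p \<Longrightarrow> g p (u + v) w = g p u w + g p v w"
    and metric_scale_left: "\<And>u v c. u \<in> T p \<Longrightarrow> v \<in> T p \<Longrightarrow> g p (c *\<^sub>R u) v = c * g p u v"
    and metric_pos: "\<And>u. u \<in> T p \<Longrightarrow> u \<noteq> 0 \<Longrightarrow> g p u u > 0"
  using kaehler_manifold p by (auto simp: kaehler_manifold_def riemannian_metric_def)

lemma metric_add_right:
  "p \<in> M \<Longrightarrow> u \<in> T p \<Longrightarrow> v \<in> T p \<Longrightarrow> w \<in> T p \<Longrightarrow> g p w (u + v) = g p w u + g p w v"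
  using metric_add_left[of p u v w] metric_sym[of p w] by (simp add: tangent_add)

lemma metric_scale_right:
  "p \<in> M \<Longrightarrow> u \<in> T p \<Longrightarrow> v \<in> T p \<Longrightarrow> g p v (c *\<^sub>R u) = c * g p v u"
  using metric_scale_left[of p u v c] metric_sym[of p v] by (simp add: tangent_smul)

lemma metric_uminus:
  assumes "p \<in> M" "u \<in> T p" "v \<in> T p"
  shows "g p (- u) v = - g p u v" "g p v (- u) = - g p v u"
  using metric_scale_left[OF assms, of "-1"] metric_scale_right[OF assms, of "-1"] by simp_all

lemma metric_diff:
  assumes "p \<in> M" "u \<in> T p" "v \<in> T p" "w \<in> T p"
  shows "g p (u - v) w = g p u w - g p v w" "g p w (u - v) = g p w u - g p w v"
  using metric_add_left[OF assms(1,2) tangent_uminus[OF assms(3)] assms(4)]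
    metric_add_right[OF assms(1,2) tangent_uminus[OF assms(3)] assms(4)] metric_uminus[OF assms(1,3,4)]
  by simp_all

lemma metric_zero:
  assumes "p \<in> M" "v \<in> T p"
  shows "g p 0 v = 0" "g p v 0 = 0"
  using metric_scale_left[OF assms(1) tangent_zero assms(2), of 0]
    metric_scale_right[OF assms(1) tangent_zero assms(2), of 0] by simp_all

lemma metric_eq_0: "p \<in> M \<Longrightarrow> u \<in> T p \<Longrightarrow> g p u u = 0 \<Longrightarrow> u = 0"
  using metric_pos[of p u] by force

lemma metric_nonneg: "p \<in> M \<Longrightarrow> u \<in> T p \<Longrightarrow> g p u u \<ge> 0"
  using metric_pos[of p u] metric_zero[of p 0] by (cases "u = 0") (auto simp: tangent_zero)

lemma metric_smooth:
  "X \<in> vector_fields \<A> \<Longrightarrow> Y \<in> vector_fields \<A> \<Longrightarrow> (\<lambda>p. g p (X p) (Y p)) \<in> smooth_functions \<A>"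
  using kaehler_manifold by (auto simp: kaehler_manifold_def riemannian_metric_def)

lemma J_endo: "J \<in> endo_fields \<A>"
  using kaehler_manifold by (simp add: kaehler_manifold_def)

lemma J_J: "p \<in> M \<Longrightarrow> u \<in> T p \<Longrightarrow> J p (J p u) = - u"
  and metric_J_J: "p \<in> M \<Longrightarrow> u \<in> T p \<Longrightarrow> v \<in> T p \<Longrightarrow> g p (J p u) (J p v) = g p u v"
  using kaehler_manifold by (auto simp: kaehler_manifold_def)

lemma metric_J_right:
  assumes "p \<in> M" "u \<in> T p" "v \<in> T p"
  shows "g p u (J p v) = - g p (J p u) v"
  using metric_J_J[OF assms(1,2) endo_tangent[OF J_endo assms(1,3)]] J_J[OF assms(1,3)]
    metric_uminus(2)[OF assms(1,3) endo_tangent[OF J_endo assms(1,2)]] by simp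

lemma metric_J_self:
  assumes "p \<in> M" "u \<in> T p"
  shows "g p (J p u) u = 0" "g p u (J p u) = 0"
  using metric_J_right[OF assms assms(2)] metric_sym[OF assms endo_tangent[OF J_endo assms]] by simp_all

lemma connection: "affine_connection \<A> nabla"
  using kaehler_manifold by (simp add: kaehler_manifold_def levi_civita_def)

lemma nabla_field:
  "X \<in> vector_fields \<A> \<Longrightarrow> Y \<in> vector_fields \<A> \<Longrightarrow> nabla X Y \<in> vector_fields \<A>"
  using connection by (simp add: affine_connection_def)

lemma nabla_add:
  "X \<in> vector_fields \<A> \<Longrightarrow> Y \<in> vector_fields \<A> \<Longrightarrow> Z \<in> vector_fields \<A> \<Longrightarrow>
    nabla X (Y + Z) = nabla X Y + nabla X Z"
  using connection by (simp add: affine_connection_def)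

lemma nabla_fscale:
  "X \<in> vector_fields \<A> \<Longrightarrow> Y \<in> vector_fields \<A> \<Longrightarrow> f \<in> smooth_functions \<A> \<Longrightarrow>
    nabla X (fscale f Y) = fscale f (nabla X Y) + fscale (\<lambda>p. X p f) Y"
  using connection by (simp add: affine_connection_def)

lemma nabla_scaleR:
  assumes "X \<in> vector_fields \<A>" "Y \<in> vector_fields \<A>"
  shows "nabla X (c *\<^sub>R Y) = c *\<^sub>R nabla X Y"
  using nabla_fscale[OF assms smooth_functions_const[of c]] tangent_const[OF vector_field_tangent[OF assms(1)]]
  by (simp add: fscale_const fun_eq_iff fscale_def)

lemma nabla_metric:
  "X \<in> vector_fields \<A> \<Longrightarrow> Y \<in> vector_fields \<A> \<Longrightarrow> Z \<in> vector_fields \<A> \<Longrightarrow> p \<in> M \<Longrightarrow>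
    X p (\<lambda>q. g q (Y q) (Z q)) = g p (nabla X Y p) (Z p) + g p (Y p) (nabla X Z p)"
  using kaehler_manifold by (simp add: kaehler_manifold_def levi_civita_def)

lemma nabla_J:
  "X \<in> vector_fields \<A> \<Longrightarrow> Y \<in> vector_fields \<A> \<Longrightarrow> nabla X (app J Y) = app J (nabla X Y)"
  using kaehler_manifold by (simp add: kaehler_manifold_def cov_deriv_endo_def)

definition mobility_term :: "'a \<Rightarrow> 'a tvec \<Rightarrow> 'a tvec \<Rightarrow> 'a tvec \<Rightarrow> 'a tvec"
  where "mobility_term p x l y =
    g p x y *\<^sub>R l + g p l y *\<^sub>R x + g p (J p x) y *\<^sub>R J p l + g p (J p l) y *\<^sub>R J p x"

text \<open>Off the manifold all terms are 0 by the normalisation of fields, so the equation between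
  fields is a pointwise one, accessible to linear algebra in each tangent space.\<close>

lemma mobility_equation_iff:
  assumes A: "A \<in> endo_fields \<A>" and L: "\<Lambda> \<in> vector_fields \<A>"
  shows "mobility_equation \<A> g J nabla A \<Lambda> \<longleftrightarrow>
    (\<forall>X\<in>vector_fields \<A>. \<forall>Y\<in>vector_fields \<A>. \<forall>p\<in>M.
      nabla X (app A Y) p = A p (nabla X Y p) + mobility_term p (X p) (\<Lambda> p) (Y p))"
proof -
  have "cov_deriv_endo nabla X A Y = app (tensor (flat g X) \<Lambda> + tensor (flat g \<Lambda>) X
          + tensor (flat g (app J X)) (app J \<Lambda>) + tensor (flat g (app J \<Lambda>)) (app J X)) Y
    \<longleftrightarrow> (\<forall>p\<in>M. nabla X (app A Y) p = A p (nabla X Y p) + mobility_term p (X p) (\<Lambda> p) (Y p))"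
    (is "?l = ?r \<longleftrightarrow> _")
    if X: "X \<in> vector_fields \<A>" and Y: "Y \<in> vector_fields \<A>" for X Y
  proof -
    have r: "?r p = mobility_term p (X p) (\<Lambda> p) (Y p)" for p
      by (simp add: fun_eq_iff app_def tensor_def flat_def mobility_term_def)
    have l: "?l p = nabla X (app A Y) p - A p (nabla X Y p)" for p
      by (simp add: cov_deriv_endo_def app_def)
    have "?l p = ?r p" if "p \<notin> M" for p
      unfolding l r
      using that
      by (simp only: vector_field_off[OF X] vector_field_off[OF L] mobility_term_def endo_off[OF A]
          endo_zero[OF J_endo] vector_field_off[OF nabla_field[OF X vector_fields_app[OF A Y]]]
          scaleR_zero_right diff_zero add_0_left not_False_eq_True simp_thms)
    moreover have "?l = ?r \<longleftrightarrow> (\<forall>p. ?l p = ?r p)" by (rule fun_eq_iff)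
    moreover have "?l p = ?r p \<longleftrightarrow> nabla X (app A Y) p = A p (nabla X Y p) + mobility_term p (X p) (\<Lambda> p) (Y p)"
      for p unfolding l r by (simp add: algebra_simps)
    ultimately show ?thesis by blast
  qed
  then show ?thesis unfolding mobility_equation_def by simp
qed

lemma hermitian_endo: "hermitian \<A> g J A \<Longrightarrow> A \<in> endo_fields \<A>"
  by (simp add: hermitian_def)

lemma hermitian_J: "hermitian \<A> g J A \<Longrightarrow> p \<in> M \<Longrightarrow> u \<in> T p \<Longrightarrow> A p (J p u) = J p (A p u)"
  and hermitian_sym:
    "hermitian \<A> g J A \<Longrightarrow> p \<in> M \<Longrightarrow> u \<in> T p \<Longrightarrow> v \<in> T p \<Longrightarrow> g p (A p u) v = g p u (A p v)"
  by (simp_all add: hermitian_def)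

lemma id_endo_mobility_equation: "mobility_equation \<A> g J nabla id_endo 0"
proof -
  have "app id_endo X = X" if "X \<in> vector_fields \<A>" for X
    using vector_field_off[OF that] vector_field_tangent[OF that] by (auto simp: app_def id_endo_def fun_eq_iff)
  moreover have "mobility_term p x 0 y = 0" if "p \<in> M" "y \<in> T p" for p x y
    using that by (simp add: mobility_term_def metric_zero endo_zero[OF J_endo])
  ultimately show ?thesis
    unfolding mobility_equation_iff[OF id_endo_fields vector_fields_zero]
    using vector_field_tangent nabla_field by (simp add: id_endo_def)
qed

lemma id_endo_Sol: "id_endo \<in> Sol \<A> g J nabla"
proof -
  have "hermitian \<A> g J id_endo"
    by (simp add: hermitian_def id_endo_fields) (simp add: id_endo_def endo_tangent[OF J_endo])
  then show ?thesis using vector_fields_zero id_endo_mobility_equation by (auto simp: Sol_def)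
qed

lemma mobility_term_self:
  assumes p: "p \<in> M" and l: "l \<in> T p"
  shows "mobility_term p l l l = (2 * g p l l) *\<^sub>R l"
  using metric_J_self[OF p l] by (simp only: mobility_term_def scaleR_zero_left add_0_right mult_2 scaleR_add_left)

lemma mobility_term_diff:
  assumes "p \<in> M" "x \<in> T p" "l \<in> T p" "l' \<in> T p" "y \<in> T p"
  shows "mobility_term p x (l - l') y = mobility_term p x l y - mobility_term p x l' y"
  using assms endo_tangent[OF J_endo]
  by (simp add: mobility_term_def metric_diff endo_diff[OF J_endo] algebra_simps)

text \<open>Evaluating the difference of the two equations at \<open>X = Y = V\<close>, where \<open>V\<close> is the difference of the
  two fields, gives \<open>2|V|\<^sup>2 V = 0\<close>.\<close>

lemma mobility_equation_unique:
  assumes A: "A \<in> endo_fields \<A>" and L: "\<Lambda> \<in> vector_fields \<A>" "\<Lambda>' \<in> vector_fields \<A>"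
    and "mobility_equation \<A> g J nabla A \<Lambda>" "mobility_equation \<A> g J nabla A \<Lambda>'"
  shows "\<Lambda> = \<Lambda>'"
proof (rule vector_field_eqI[OF L])
  fix p assume p: "p \<in> M"
  note t = vector_field_tangent[OF L(1), of p] vector_field_tangent[OF L(2), of p]
  define l where "l = \<Lambda> p - \<Lambda>' p"
  have l: "l \<in> T p" unfolding l_def using t by (rule tangent_diff)
  obtain X where X: "X \<in> vector_fields \<A>" "X p = l" using vector_field_extension[OF p l] .
  have "mobility_term p l (\<Lambda> p) l = mobility_term p l (\<Lambda>' p) l"
    using assms(4,5) X p unfolding mobility_equation_iff[OF A L(1)] mobility_equation_iff[OF A L(2)]
    by (metis add_left_imp_eq)
  then have "mobility_term p l l l = 0"
    using mobility_term_diff[OF p l t l] by (simp add: l_def[symmetric])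
  then have "g p l l = 0 \<or> l = 0" using mobility_term_self[OF p l] by simp
  then have "l = 0" using metric_eq_0[OF p l] by blast
  then show "\<Lambda> p = \<Lambda>' p" by (simp add: l_def)
qed

subsection \<open>The square of a solution\<close>

text \<open>This is |\<Lambda>|^2 times the orthogonal projection onto the complex line spanned by
  \<Lambda>.\<close>

definition rank_endo :: "'a vfield \<Rightarrow> 'a \<Rightarrow> 'a tvec \<Rightarrow> 'a tvec"
  where "rank_endo \<Lambda> p v = g p (\<Lambda> p) v *\<^sub>R \<Lambda> p + g p (J p (\<Lambda> p)) v *\<^sub>R J p (\<Lambda> p)"

text \<open>When \<open>B \<noteq> 0\<close>, a triple \<open>(A, \<Lambda>, \<mu>)\<close> is a parallel endomorphism of the tractor bundle
  \<open>TM \<oplus> \<complex>\<close>, and this is \<open>B\<close> times the \<open>TM\<close>-block of its square.\<close>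

definition square_endo :: "real \<Rightarrow> 'a endo \<Rightarrow> 'a vfield \<Rightarrow> 'a endo"
  where "square_endo B A \<Lambda> p v =
    (if p \<in> M \<and> v \<in> T p then B *\<^sub>R A p (A p v) - rank_endo \<Lambda> p v else 0)"

text \<open>Rewrites the pointwise definition by smooth multiples of global fields, the form to
  which the rules for \<open>nabla\<close> apply.\<close>

lemma app_square_endo:
  assumes A: "A \<in> endo_fields \<A>" and L: "\<Lambda> \<in> vector_fields \<A>" and Y: "Y \<in> vector_fields \<A>"
  shows "app (square_endo B A \<Lambda>) Y = B *\<^sub>R app A (app A Y)
    + (fscale (\<lambda>p. - 1 * g p (\<Lambda> p) (Y p)) \<Lambda> + fscale (\<lambda>p. - 1 * g p (app J \<Lambda> p) (Y p)) (app J \<Lambda>))"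
proof (rule ext)
  show "app (square_endo B A \<Lambda>) Y p = (B *\<^sub>R app A (app A Y) + (fscale (\<lambda>p. - 1 * g p (\<Lambda> p) (Y p)) \<Lambda>
    + fscale (\<lambda>p. - 1 * g p (app J \<Lambda> p) (Y p)) (app J \<Lambda>))) p" for p
    using vector_field_tangent[OF Y, of p] vector_field_off[OF L, of p] endo_off[OF A] endo_off[OF J_endo]
    by (cases "p \<in> M") (simp_all add: app_def square_endo_def fscale_def rank_endo_def scaleR_fun_apply)
qed

lemma square_endo_hermitian:
  assumes A: "hermitian \<A> g J A" and L: "\<Lambda> \<in> vector_fields \<A>"
  shows "hermitian \<A> g J (square_endo B A \<Lambda>)"
proof -
  note E = hermitian_endo[OF A]
  note tan = tangent_add tangent_smul tangent_diff endo_tangent[OF E] endo_tangent[OF J_endo] vector_field_tangent[OF L]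
  note bil = metric_add_left metric_add_right metric_scale_left metric_scale_right metric_diff
  note lin = endo_add[OF E] endo_scale[OF E] endo_add[OF J_endo] endo_scale[OF J_endo] endo_diff[OF J_endo]
  have field: "app (square_endo B A \<Lambda>) Y \<in> vector_fields \<A>" if Y: "Y \<in> vector_fields \<A>" for Y
    unfolding app_square_endo[OF E L Y]
    by (intro vector_fields_add vector_fields_scaleR vector_fields_fscale smooth_functions_mult
        smooth_functions_const metric_smooth vector_fields_app[OF E] vector_fields_app[OF J_endo] Y L)
  have "square_endo B A \<Lambda> \<in> endo_fields \<A>"
    unfolding endo_fields_def
    using field by (auto simp: square_endo_def rank_endo_def tan bil lin algebra_simps)
  moreover have "square_endo B A \<Lambda> p (J p u) = J p (square_endo B A \<Lambda> p u)" if p: "p \<in> M" and u: "u \<in> T p" for p u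
    using p u by (simp add: square_endo_def rank_endo_def tan bil lin hermitian_J[OF A] metric_J_right metric_J_J
        J_J endo_uminus[OF J_endo] metric_uminus algebra_simps)
  moreover have "g p (square_endo B A \<Lambda> p u) v = g p u (square_endo B A \<Lambda> p v)"
    if p: "p \<in> M" and u: "u \<in> T p" and v: "v \<in> T p" for p u v
    using p u v metric_sym[OF p u, of "\<Lambda> p"] metric_sym[OF p u, of "J p (\<Lambda> p)"]
    by (simp add: square_endo_def rank_endo_def tan bil lin hermitian_sym[OF A] algebra_simps)
  ultimately show ?thesis by (simp add: hermitian_def)
qed

end

text \<open>The data of \<open>C_C\<close> in pointwise form. The triple is a parameter because the
  locale is interpreted for two triples: the given one and the one of the solution whose eigenvalues
  are counted.\<close>

locale extended_system = kaehler \<A> g J nabla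
  for \<A> :: "('a::{t2_space,second_countable_topology}, 'e::euclidean_space) atlas"
    and g :: "'a metric" and J :: "'a endo" and nabla :: "'a connection" +
  fixes B :: real and A :: "'a endo" and \<Lambda> :: "'a vfield" and \<mu> :: "'a \<Rightarrow> real"
  assumes A: "hermitian \<A> g J A" and L: "\<Lambda> \<in> vector_fields \<A>"
    and mu: "\<mu> \<in> smooth_functions \<A>"
    and mobility_eq: "mobility_equation \<A> g J nabla A \<Lambda>"
    and nabla_L: "\<And>X p. X \<in> vector_fields \<A> \<Longrightarrow> nabla X \<Lambda> p = \<mu> p *\<^sub>R X p + B *\<^sub>R A p (X p)"
    and grad_mu: "\<And>X p. X \<in> vector_fields \<A> \<Longrightarrow> p \<in> M \<Longrightarrow> X p \<mu> = 2 * B * g p (\<Lambda> p) (X p)"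
    and L_nonzero: "\<exists>p\<in>M. \<Lambda> p \<noteq> 0"
begin

lemmas A_endo = hermitian_endo[OF A]

lemmas tan = tangent_add tangent_smul tangent_diff endo_tangent[OF A_endo] endo_tangent[OF J_endo]
  vector_field_tangent[OF L] vector_field_tangent[OF nabla_field] vector_field_tangent
  tangent_uminus

lemmas bil = metric_add_left metric_add_right metric_scale_left metric_scale_right metric_diff metric_uminus

lemmas lin = endo_add[OF A_endo] endo_scale[OF A_endo] endo_diff[OF A_endo]
  endo_add[OF J_endo] endo_scale[OF J_endo] endo_diff[OF J_endo] endo_uminus[OF J_endo]

lemma nabla_A:
  "X \<in> vector_fields \<A> \<Longrightarrow> Y \<in> vector_fields \<A> \<Longrightarrow> p \<in> M \<Longrightarrow>
    nabla X (app A Y) p = A p (nabla X Y p) + mobility_term p (X p) (\<Lambda> p) (Y p)"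
  using mobility_eq unfolding mobility_equation_iff[OF A_endo L] by blast

lemma metric_JA: "p \<in> M \<Longrightarrow> u \<in> T p \<Longrightarrow> v \<in> T p \<Longrightarrow> g p (J p (A p u)) v = g p (J p u) (A p v)"
  using hermitian_sym[OF A, of p "J p u" v] hermitian_J[OF A, of p u] by (simp add: tan)

text \<open>The vector field that accompanies \<open>square_endo\<close> in the mobility equation;
  for \<open>B \<noteq> 0\<close> it is \<open>B\<close> times the off-diagonal block of the tractor
  square.\<close>

definition square_field :: "'a vfield"
  where "square_field p = B *\<^sub>R A p (\<Lambda> p) + ((- 1 * \<mu> p) *\<^sub>R \<Lambda> p)"

lemma square_field_eq: "square_field = B *\<^sub>R app A \<Lambda> + fscale (\<lambda>p. - 1 * \<mu> p) \<Lambda>"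
  by (rule ext) (simp add: square_field_def app_def fscale_def scaleR_fun_apply)

lemma square_field: "square_field \<in> vector_fields \<A>"
  unfolding square_field_eq
  by (intro vector_fields_add vector_fields_scaleR vector_fields_fscale smooth_functions_mult
      smooth_functions_const vector_fields_app[OF A_endo] L mu)

text \<open>Differentiating \<open>B A^2\<close> produces wanted terms with
  \<open>A \<Lambda>\<close> and unwanted ones pairing \<open>A X\<close> with \<Lambda>. The part
  \<open>B A X\<close> of \<open>nabla X \<Lambda>\<close> in the derivative of the rank two term
  cancels the latter, and its part \<mu> \<open>X\<close> contributes the summand - \<mu> \<Lambda>
  of \<open>square_field\<close>.\<close>

lemma square_mobility_equation: "mobility_equation \<A> g J nabla (square_endo B A \<Lambda>) square_field"
  unfolding mobility_equation_iff[OF hermitian_endo[OF square_endo_hermitian[OF A L]] square_field]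
proof (intro ballI)
  fix X Y p assume X: "X \<in> vector_fields \<A>" and Y: "Y \<in> vector_fields \<A>" and p: "p \<in> M"
  note AY = vector_fields_app[OF A_endo Y] and AAY = vector_fields_app[OF A_endo vector_fields_app[OF A_endo Y]]
    and JL = vector_fields_app[OF J_endo L]
  let ?f = "\<lambda>Z p. - 1 * g p (Z p) (Y p)"
  have f: "?f Z \<in> smooth_functions \<A>" if "Z \<in> vector_fields \<A>" for Z
    by (intro smooth_functions_mult smooth_functions_const metric_smooth that Y)
  have df: "X p (?f Z) = - (g p (nabla X Z p) (Y p) + g p (Z p) (nabla X Y p))" if Z: "Z \<in> vector_fields \<A>" for Z
    using tangent_fscale[OF vector_field_tangent[OF X] metric_smooth[OF Z Y], of p "-1"] nabla_metric[OF X Z Y p]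
    by simp
  have "nabla X (app (square_endo B A \<Lambda>) Y) = B *\<^sub>R nabla X (app A (app A Y))
      + ((fscale (?f \<Lambda>) (nabla X \<Lambda>) + fscale (\<lambda>p. X p (?f \<Lambda>)) \<Lambda>)
      + (fscale (?f (app J \<Lambda>)) (nabla X (app J \<Lambda>)) + fscale (\<lambda>p. X p (?f (app J \<Lambda>))) (app J \<Lambda>)))"
    unfolding app_square_endo[OF A_endo L Y]
    using nabla_add[OF X vector_fields_scaleR[OF AAY, of B] vector_fields_add[OF vector_fields_fscale[OF f[OF L] L]
          vector_fields_fscale[OF f[OF JL] JL]]]
      nabla_add[OF X vector_fields_fscale[OF f[OF L] L] vector_fields_fscale[OF f[OF JL] JL]]
      nabla_scaleR[OF X AAY, of B] nabla_fscale[OF X L f[OF L]] nabla_fscale[OF X JL f[OF JL]]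
    by simp
  then have "nabla X (app (square_endo B A \<Lambda>) Y) p = B *\<^sub>R nabla X (app A (app A Y)) p
      + ((?f \<Lambda> p *\<^sub>R nabla X \<Lambda> p + X p (?f \<Lambda>) *\<^sub>R \<Lambda> p)
      + (?f (app J \<Lambda>) p *\<^sub>R nabla X (app J \<Lambda>) p + X p (?f (app J \<Lambda>)) *\<^sub>R app J \<Lambda> p))"
    by (simp add: fscale_def scaleR_fun_apply)
  also have "\<dots> = square_endo B A \<Lambda> p (nabla X Y p) + mobility_term p (X p) (square_field p) (Y p)"
    unfolding df[OF L] df[OF JL] nabla_J[OF X L] nabla_A[OF X AY p]
    using p X Y
    by (simp add: app_def nabla_A[unfolded app_def] nabla_A nabla_L mobility_term_def square_endo_def rank_endo_def
        square_field_def tan bil lin hermitian_sym[OF A] hermitian_J[OF A] metric_JA algebra_simps)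
  finally show "nabla X (app (square_endo B A \<Lambda>) Y) p =
      square_endo B A \<Lambda> p (nabla X Y p) + mobility_term p (X p) (square_field p) (Y p)" .
qed

lemma square_Sol: "square_endo B A \<Lambda> \<in> Sol \<A> g J nabla"
  using square_endo_hermitian[OF A L] square_field square_mobility_equation by (auto simp: Sol_def)

lemma A_Sol: "A \<in> Sol \<A> g J nabla"
  using A L mobility_eq by (auto simp: Sol_def)

text \<open>The square thus satisfies the second equation of the extended system as well, with B
  |\<Lambda>|^2 - \<mu>^2 in place of \<mu>. Comparing this function with that of a combination of
  \<open>Id\<close> and \<open>A\<close> will give a formula for |\<Lambda>|^2.\<close>

lemma nabla_square_field:
  assumes X: "X \<in> vector_fields \<A>" and p: "p \<in> M"
  shows "nabla X square_field p =
    (B * g p (\<Lambda> p) (\<Lambda> p) - (\<mu> p)\<^sup>2) *\<^sub>R X p + B *\<^sub>R square_endo B A \<Lambda> p (X p)"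
proof -
  have m: "(\<lambda>p. - 1 * \<mu> p) \<in> smooth_functions \<A>"
    by (intro smooth_functions_mult smooth_functions_const mu)
  have dm: "X p (\<lambda>p. - 1 * \<mu> p) = - (B * g p (\<Lambda> p) (X p) + B * g p (\<Lambda> p) (X p))"
    using tangent_fscale[OF vector_field_tangent[OF X] mu, of p "-1"] grad_mu[OF X p] by simp
  note AL = vector_fields_app[OF A_endo L]
  have "nabla X square_field = B *\<^sub>R nabla X (app A \<Lambda>) + (fscale (\<lambda>p. - 1 * \<mu> p) (nabla X \<Lambda>)
      + fscale (\<lambda>p. X p (\<lambda>p. - 1 * \<mu> p)) \<Lambda>)"
    unfolding square_field_eq
    using nabla_add[OF X vector_fields_scaleR[OF AL, of B] vector_fields_fscale[OF m L]]
      nabla_scaleR[OF X AL, of B] nabla_fscale[OF X L m] by simp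
  then have "nabla X square_field p = B *\<^sub>R nabla X (app A \<Lambda>) p + ((- 1 * \<mu> p) *\<^sub>R nabla X \<Lambda> p
      + X p (\<lambda>p. - 1 * \<mu> p) *\<^sub>R \<Lambda> p)"
    by (simp add: fscale_def scaleR_fun_apply)
  also have "\<dots> = (B * g p (\<Lambda> p) (\<Lambda> p) - (\<mu> p)\<^sup>2) *\<^sub>R X p + B *\<^sub>R square_endo B A \<Lambda> p (X p)"
    unfolding dm nabla_A[OF X L p]
    using p X metric_sym[OF p, of "X p" "\<Lambda> p"] metric_sym[OF p, of "J p (X p)" "\<Lambda> p"]
      metric_J_self[OF p, of "\<Lambda> p"]
    by (simp add: nabla_L mobility_term_def square_endo_def rank_endo_def tan bil lin metric_J_right
        hermitian_J[OF A] power2_eq_square algebra_simps)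
       (simp add: fun_eq_iff scaleR_fun_apply)
  finally show ?thesis .
qed

end

section \<open>Local analysis in Euclidean space\<close>

text \<open>On a small closed ball let \<open>m\<close> be the maximum of |F - r|. The mean value
  inequality from the centre bounds \<open>m\<close> by \<open>K'\<close> times the radius times
  \<open>m\<close>, hence by \<open>m / 2\<close>, so \<open>m = 0\<close>.\<close>

lemma gronwall_ball:
  fixes F :: "'e::euclidean_space \<Rightarrow> real"
  assumes R: "R > 0" and F0: "F x0 = r"
    and F: "\<And>x. x \<in> cball x0 R \<Longrightarrow> (F has_derivative F' x) (at x)"
    and bound: "\<And>x u. x \<in> cball x0 R \<Longrightarrow> \<bar>F' x u\<bar> \<le> K * \<bar>F x - r\<bar> * norm u"
  obtains \<rho> where "\<rho> > 0" "\<And>x. x \<in> ball x0 \<rho> \<Longrightarrow> F x = r"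
proof
  \<comment> \<open>A positive majorant of \<open>K\<close>, so that the radius
    \<open>1 / (2 * K')\<close> makes sense and halves the bound.\<close>
  define K' where "K' = \<bar>K\<bar> + 1"
  define \<rho> where "\<rho> = min R (1 / (2 * K'))"
  have K': "K' > 0" "K \<le> K'" by (auto simp: K'_def)
  show \<rho>: "\<rho> > 0" using R K' by (simp add: \<rho>_def)
  have sub: "cball x0 \<rho> \<subseteq> cball x0 R" by (simp add: \<rho>_def subset_cball)
  have cont: "continuous_on (cball x0 \<rho>) (\<lambda>x. \<bar>F x - r\<bar>)"
    using F sub by (intro continuous_intros continuous_at_imp_continuous_on ballI has_derivative_continuous) blast
  obtain x1 where x1: "x1 \<in> cball x0 \<rho>" "\<And>x. x \<in> cball x0 \<rho> \<Longrightarrow> \<bar>F x - r\<bar> \<le> \<bar>F x1 - r\<bar>"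
    using continuous_attains_sup[OF compact_cball _ cont] \<rho> by auto
  define m where "m = \<bar>F x1 - r\<bar>"
  have "norm (F x1 - F x0) \<le> (K' * m) * norm (x1 - x0)"
  proof (rule differentiable_bound[OF convex_cball _ _ x1(1)])
    fix x assume x: "x \<in> cball x0 \<rho>"
    show "(F has_derivative F' x) (at x within cball x0 \<rho>)"
      using F[OF subsetD[OF sub x]] by (rule has_derivative_at_withinI)
    have "\<bar>F' x u\<bar> \<le> (K' * m) * norm u" for u
    proof -
      have "K * \<bar>F x - r\<bar> \<le> K' * m"
        using K' x1(2)[OF x] unfolding m_def by (intro mult_mono) auto
      then show ?thesis using bound[OF subsetD[OF sub x], of u] mult_right_mono[of _ _ "norm u"] by fastforce
    qed
    then show "onorm (F' x) \<le> K' * m"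
      using K' by (intro onorm_bound) (auto simp: m_def)
  qed (use \<rho> in simp)
  also have "\<dots> \<le> (K' * m) * (1 / (2 * K'))"
    using x1(1) K' by (intro mult_left_mono) (auto simp: \<rho>_def dist_norm norm_minus_commute m_def)
  also have "\<dots> = m / 2" using K' by simp
  finally have "m = 0" by (simp add: F0 m_def)
  then show "F x = r" if "x \<in> ball x0 \<rho>" for x
    using x1(2)[of x] that by (simp add: m_def)
qed

text \<open>Points of the level \<open>r\<close> are critical. Between two of them on a line in
  direction \<open>v\<close> of the plane, the derivative along \<open>v\<close> vanishes at both
  ends, so the second derivative vanishes somewhere in between. Near \<open>x0\<close> this is
  impossible, since the Hessian stays definite on the plane by continuity.\<close>

lemma slice_unique_zero:
  fixes F :: "'e::euclidean_space \<Rightarrow> real"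
  assumes S: "open S" "x0 \<in> S" and F: "smooth_on S F"
    and crit: "\<And>x u. x \<in> S \<Longrightarrow> F x = r \<Longrightarrow> frechet_derivative F (at x) u = 0"
    and c: "c \<noteq> 0"
    and hess: "\<And>s t. frechet_derivative (\<lambda>x. frechet_derivative F (at x) (s *\<^sub>R u + t *\<^sub>R w)) (at x0)
      (s *\<^sub>R u + t *\<^sub>R w) = c * (s\<^sup>2 + t\<^sup>2)"
  obtains \<rho> where "\<rho> > 0" "ball x0 \<rho> \<subseteq> S"
    "\<And>x s t. x \<in> ball x0 \<rho> \<Longrightarrow> x + (s *\<^sub>R u + t *\<^sub>R w) \<in> ball x0 \<rho> \<Longrightarrow> F x = r \<Longrightarrow>
      F (x + (s *\<^sub>R u + t *\<^sub>R w)) = r \<Longrightarrow> s = 0 \<and> t = 0"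
proof -
  define D where "D v x = frechet_derivative F (at x) v" for v x
  define H where "H v y x = frechet_derivative (D v) (at x) y" for v y x
  have D_smooth: "smooth_on S (D v)" for v unfolding D_def by (rule smooth_on_derivative[OF F])
  have D_deriv: "(D v has_derivative (\<lambda>y. H v y x)) (at x)" if "x \<in> S" for v x
    using smooth_on_has_derivative[OF D_smooth that] by (simp add: H_def)
  have H_cont: "continuous_on S (H v y)" for v y
    unfolding H_def by (intro smooth_on_continuous_on smooth_on_derivative D_smooth)
  have D_lin: "D (s *\<^sub>R u + t *\<^sub>R w) x = s * D u x + t * D w x" if "x \<in> S" for s t x
    using has_derivative_linear[OF smooth_on_has_derivative[OF F that]]
    by (simp add: D_def linear_add linear_scale)
  have H_lin: "H v (s *\<^sub>R u + t *\<^sub>R w) x = s * H v u x + t * H v w x" if "x \<in> S" for s t x v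
    using linear_add[OF has_derivative_linear[OF D_deriv[OF that, of v]]]
      linear_scale[OF has_derivative_linear[OF D_deriv[OF that, of v]]] by simp
  define h where "h s t x = s * (s * H u u x + t * H u w x) + t * (s * H w u x + t * H w w x)" for s t x
  have D_deriv2: "(D (s *\<^sub>R u + t *\<^sub>R w) has_derivative (\<lambda>y. s * H u y x + t * H w y x)) (at x)"
    if "x \<in> S" for s t x
    by (rule has_derivative_transform_within_open[OF _ S(1) that D_lin[symmetric]])
       (intro has_derivative_add has_derivative_mult_right D_deriv that)
  have H_eq: "H (s *\<^sub>R u + t *\<^sub>R w) (s *\<^sub>R u + t *\<^sub>R w) x = h s t x" if "x \<in> S" for s t x
    unfolding H_def[of "s *\<^sub>R u + t *\<^sub>R w"] frechet_derivative_eqI[OF D_deriv2[OF that]]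
    by (simp add: h_def H_lin[OF that])
  have hess': "h s t x0 = c * (s\<^sup>2 + t\<^sup>2)" for s t
    using hess[of s t, folded D_def] H_eq[OF S(2), of s t] by (simp add: H_def D_def[abs_def])
  \<comment> \<open>Only the sum of the two mixed derivatives is determined by the quadratic form,
    and only that sum enters \<open>h\<close>.\<close>
  have H0: "H u u x0 = c" "H w w x0 = c" "H u w x0 + H w u x0 = 0"
    using hess'[of 1 0] hess'[of 0 1] hess'[of 1 1] by (simp_all add: h_def)
  have lim: "(k \<longlongrightarrow> k x0) (nhds x0)" if "continuous_on S k" for k :: "'e \<Rightarrow> real"
    using that S(2) continuous_on_eq_continuous_at[OF S(1), of k]
    by (simp add: isCont_def tendsto_at_iff_tendsto_nhds)
  have "continuous_on S (\<lambda>x. H u u x / c)" "continuous_on S (\<lambda>x. H w w x / c)"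
    "continuous_on S (\<lambda>x. (H u w x + H w u x) / c)"
    using c by (intro continuous_on_divide continuous_on_add H_cont continuous_on_const; simp)+
  note lims = this[THEN lim]
  have "\<forall>\<^sub>F x in nhds x0. 1/2 < H u u x / c" "\<forall>\<^sub>F x in nhds x0. 1/2 < H w w x / c"
    by (rule order_tendstoD(1)[OF lims(1)] order_tendstoD(1)[OF lims(2)]; use H0 c in simp)+
  moreover have "\<forall>\<^sub>F x in nhds x0. (H u w x + H w u x) / c < 1/2"
    "\<forall>\<^sub>F x in nhds x0. -1/2 < (H u w x + H w u x) / c"
    by (rule order_tendstoD(2)[OF lims(3)] order_tendstoD(1)[OF lims(3)]; use H0 c in simp)+
  moreover have "\<forall>\<^sub>F x in nhds x0. x \<in> S" using S by (rule eventually_nhds_in_open)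
  \<comment> \<open>With these thresholds \<open>h s t x / c\<close> is at least half of
    \<open>s^2 - |s t| + t^2\<close>, which is positive unless \<open>s = t = 0\<close>.\<close>
  ultimately have "\<forall>\<^sub>F x in nhds x0. x \<in> S \<and> H u u x / c > 1/2 \<and> H w w x / c > 1/2 \<and>
    \<bar>(H u w x + H w u x) / c\<bar> < 1/2"
    by eventually_elim (intro conjI; (assumption | linarith))
  then obtain \<rho> where \<rho>: "\<rho> > 0" and near: "\<And>x. x \<in> ball x0 \<rho> \<Longrightarrow> x \<in> S \<and> H u u x / c > 1/2 \<and>
      H w w x / c > 1/2 \<and> \<bar>(H u w x + H w u x) / c\<bar> < 1/2"
    unfolding eventually_nhds_metric by (auto simp: dist_commute)
  have h_nz: "h s t x \<noteq> 0" if x: "x \<in> ball x0 \<rho>" and st: "s \<noteq> 0 \<or> t \<noteq> 0" for s t x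
  proof -
    define \<alpha> \<beta> \<gamma> where "\<alpha> = H u u x / c" and "\<beta> = (H u w x + H w u x) / c" and "\<gamma> = H w w x / c"
    have ab: "\<alpha> > 1/2" "\<gamma> > 1/2" "\<bar>\<beta>\<bar> < 1/2" using near[OF x] by (auto simp: \<alpha>_def \<beta>_def \<gamma>_def)
    have "h s t x / c = \<alpha> * s\<^sup>2 + \<beta> * (s * t) + \<gamma> * t\<^sup>2"
      by (simp add: h_def \<alpha>_def \<beta>_def \<gamma>_def power2_eq_square field_simps c)
    moreover have "\<beta> * (s * t) \<ge> - (1/2) * \<bar>s * t\<bar>"
    proof -
      have "\<bar>\<beta> * (s * t)\<bar> \<le> (1/2) * \<bar>s * t\<bar>" unfolding abs_mult[of \<beta>] using ab by (intro mult_right_mono) auto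
      then show ?thesis by linarith
    qed
    moreover have "\<alpha> * s\<^sup>2 \<ge> (1/2) * s\<^sup>2" "\<gamma> * t\<^sup>2 \<ge> (1/2) * t\<^sup>2" 
      using ab mult_right_mono[of "1/2" \<alpha> "s\<^sup>2"] mult_right_mono[of "1/2" \<gamma> "t\<^sup>2"] by simp_all
    moreover have "s\<^sup>2 + t\<^sup>2 - \<bar>s * t\<bar> > 0"
    proof -
      have "2 * \<bar>s * t\<bar> \<le> s\<^sup>2 + t\<^sup>2"
        using sum_squares_bound[of "\<bar>s\<bar>" "\<bar>t\<bar>"] by (simp add: abs_mult)
      moreover have "s\<^sup>2 + t\<^sup>2 > 0" using st by (simp add: sum_power2_gt_zero_iff)
      ultimately show ?thesis by linarith
    qed
    ultimately have "h s t x / c > 0" by linarith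
    then show ?thesis by auto
  qed
  have "s = 0 \<and> t = 0"
    if x: "x \<in> ball x0 \<rho>" and y: "x + (s *\<^sub>R u + t *\<^sub>R w) \<in> ball x0 \<rho>" and Fx: "F x = r"
      and Fy: "F (x + (s *\<^sub>R u + t *\<^sub>R w)) = r" for x s t
  proof (rule ccontr)
    assume st: "\<not> (s = 0 \<and> t = 0)"
    define v where "v = s *\<^sub>R u + t *\<^sub>R w"
    have seg: "x + \<tau> *\<^sub>R v \<in> ball x0 \<rho>" if "0 \<le> \<tau>" "\<tau> \<le> 1" for \<tau>
    proof -
      have "(1 - \<tau>) *\<^sub>R x + \<tau> *\<^sub>R (x + v) \<in> ball x0 \<rho>"
        using convexD_alt[OF convex_ball x y[folded v_def]] that by simp
      then show ?thesis by (simp add: algebra_simps)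
    qed
    have d: "((\<lambda>\<tau>. D v (x + \<tau> *\<^sub>R v)) has_real_derivative h s t (x + \<tau> *\<^sub>R v)) (at \<tau>)"
      if "0 \<le> \<tau>" "\<tau> \<le> 1" for \<tau>
    proof -
      have "((\<lambda>\<tau>. x + \<tau> *\<^sub>R v) has_derivative (\<lambda>\<sigma>. \<sigma> *\<^sub>R v)) (at \<tau>)"
        by (auto intro!: derivative_eq_intros)
      moreover have xS: "x + \<tau> *\<^sub>R v \<in> S" using near[OF seg[OF that]] by blast
      ultimately have "((\<lambda>\<tau>. D v (x + \<tau> *\<^sub>R v)) has_derivative (\<lambda>\<sigma>. H v (\<sigma> *\<^sub>R v) (x + \<tau> *\<^sub>R v))) (at \<tau>)"
        by (rule has_derivative_compose[OF _ D_deriv])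
      moreover have "H v (\<sigma> *\<^sub>R v) (x + \<tau> *\<^sub>R v) = h s t (x + \<tau> *\<^sub>R v) * \<sigma>" for \<sigma>
        using linear_scale[OF has_derivative_linear[OF D_deriv[OF xS, of v]], of \<sigma> v]
          H_eq[OF xS, of s t, folded v_def] by simp
      ultimately show ?thesis by (simp add: has_field_derivative_def)
    qed
    \<comment> \<open>Both end points lie on the level \<open>r\<close>, hence are critical; Rolle's
      argument for the derivative along \<open>v\<close> follows.\<close>
    have "D v (x + 0 *\<^sub>R v) = 0" "D v (x + 1 *\<^sub>R v) = 0"
      using crit near[OF x] near[OF y] Fx Fy by (auto simp: D_def v_def)
    then obtain \<tau> where "0 < \<tau>" "\<tau> < 1" "0 = (1 - 0) * h s t (x + \<tau> *\<^sub>R v)"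
      using MVT2[OF zero_less_one d] by auto
    then show False using h_nz[OF seg[of \<tau>], of s t] st by auto
  qed
  moreover have "ball x0 \<rho> \<subseteq> S" using near by auto
  ultimately show thesis using that \<rho> by blast
qed

text \<open>Two-dimensional slices stay connected when a point is removed, so \<open>e\<close> cannot switch between
  \<open>r\<close> and \<open>F\<close> inside one slice.\<close>

lemma slice_dichotomy:
  fixes F e :: "'e::euclidean_space \<Rightarrow> real"
  assumes \<rho>: "\<rho> > 0" and indep: "\<And>s t. s *\<^sub>R u + t *\<^sub>R w = 0 \<Longrightarrow> s = 0 \<and> t = 0"
    and cont: "continuous_on (ball x0 \<rho>) F" "continuous_on (ball x0 \<rho>) e"
    and e: "\<And>x. x \<in> ball x0 \<rho> \<Longrightarrow> e x = r \<or> e x = F x"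
    and uniq: "\<And>x s t. x \<in> ball x0 \<rho> \<Longrightarrow> x + (s *\<^sub>R u + t *\<^sub>R w) \<in> ball x0 \<rho> \<Longrightarrow> F x = r \<Longrightarrow>
      F (x + (s *\<^sub>R u + t *\<^sub>R w)) = r \<Longrightarrow> s = 0 \<and> t = 0"
  shows "(\<forall>x\<in>ball x0 \<rho>. e x = r) \<or> (\<forall>x\<in>ball x0 \<rho>. e x = F x)"
proof -
  define W where "W = ball x0 \<rho>"
  define P where "P = span {u, w}"
  have P_eq: "d \<in> P \<longleftrightarrow> (\<exists>s t. d = s *\<^sub>R u + t *\<^sub>R w)" for d
    unfolding P_def span_insert span_singleton by (auto simp: algebra_simps)
  define Sl where "Sl y = {x \<in> W. x - y \<in> P}" for y
  define Z where "Z = {x. F x = r}"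
  have uniq': "x = y" if "x \<in> Sl a" "y \<in> Sl a" "x \<in> Z" "y \<in> Z" for x y a
  proof -
    have "(y - a) - (x - a) \<in> P"
      using that span_diff[of "y - a" "{u, w}" "x - a"] by (simp add: Sl_def P_def)
    then obtain s t where "y - x = s *\<^sub>R u + t *\<^sub>R w" using P_eq by auto
    then have y: "y = x + (s *\<^sub>R u + t *\<^sub>R w)" by (simp add: algebra_simps)
    then show ?thesis using uniq[of x s t] that by (simp add: Sl_def W_def Z_def)
  qed
  have Sl_dicho: "(\<forall>x\<in>Sl y. e x = r) \<or> (\<forall>x\<in>Sl y. e x = F x)" and Sl_nontriv: "\<exists>x\<in>Sl y. F x \<noteq> r"
    if y: "y \<in> W" for y
  proof -
    obtain \<delta> where \<delta>: "\<delta> > 0" "ball y \<delta> \<subseteq> W" using y unfolding W_def by (meson open_ball open_contains_ball)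
    define N where "N = norm u + norm w + 1"
    define \<epsilon> where "\<epsilon> = \<delta> / (2 * N)"
    have n: "N > 0" unfolding N_def by (intro add_nonneg_pos) auto
    then have \<epsilon>: "\<epsilon> > 0" using \<delta> by (simp add: \<epsilon>_def)
    have small: "\<epsilon> * norm v < \<delta>" if "norm v \<le> norm u + norm w" for v :: 'e
    proof -
      have "\<epsilon> * norm v \<le> \<epsilon> * N" using \<epsilon> that unfolding N_def by (intro mult_left_mono) auto
      also have "\<dots> = \<delta> / 2" using n by (simp add: \<epsilon>_def)
      finally show ?thesis using \<delta> by simp
    qed
    have mem: "y + \<epsilon> *\<^sub>R u \<in> Sl y" "y + \<epsilon> *\<^sub>R w \<in> Sl y" "y \<in> Sl y"
      using \<delta>(2) small[of u] small[of w] \<epsilon> y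
      by (auto simp: Sl_def P_def dist_norm span_scale span_base span_zero)
    have "u \<noteq> 0" using indep[of 1 0] by auto
    then have ne: "y + \<epsilon> *\<^sub>R u \<noteq> y" using \<epsilon> by simp
    show "\<exists>x\<in>Sl y. F x \<noteq> r" using uniq'[OF mem(1,3)] ne mem unfolding Z_def by auto
    have convex: "convex (Sl y)"
    proof -
      have "Sl y = W \<inter> (\<lambda>x. x - y) -` P" by (auto simp: Sl_def)
      moreover have "(\<lambda>x. x - y) -` P = (+) y ` P" by (auto simp: image_iff) (metis add.commute diff_add_cancel)
      ultimately show ?thesis unfolding W_def P_def
        by (simp add: convex_Int subspace_imp_convex convex_translation)
    qed
    have noncoll: "\<not> collinear (Sl y)"
    proof
      assume "collinear (Sl y)"
      then obtain d where "\<And>a b. a \<in> Sl y \<Longrightarrow> b \<in> Sl y \<Longrightarrow> \<exists>c. a - b = c *\<^sub>R d"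
        unfolding collinear_def by blast
      then obtain c1 c2 where c: "\<epsilon> *\<^sub>R u = c1 *\<^sub>R d" "\<epsilon> *\<^sub>R w = c2 *\<^sub>R d"
        using mem by (metis add_diff_cancel_left')
      have "(c2 * \<epsilon>) *\<^sub>R u + (- c1 * \<epsilon>) *\<^sub>R w = c2 *\<^sub>R (\<epsilon> *\<^sub>R u) - c1 *\<^sub>R (\<epsilon> *\<^sub>R w)" by simp
      also have "\<dots> = 0" unfolding c by (simp add: mult.commute)
      finally have "c1 = 0" using indep \<epsilon> by fastforce
      then show False using c(1) \<epsilon> \<open>u \<noteq> 0\<close> by simp
    qed
    have "countable (Sl y \<inter> Z)"
    proof (cases "Sl y \<inter> Z = {}")
      case False
      then obtain x where "x \<in> Sl y \<inter> Z" by auto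
      then have "Sl y \<inter> Z \<subseteq> {x}" using uniq' by auto
      then show ?thesis by (rule countable_subset) simp
    qed simp
    \<comment> \<open>A convex set that is not contained in a line stays connected when countably
      many points are removed; here at most one is.\<close>
    then have conn: "connected (Sl y - (Sl y \<inter> Z))"
      by (rule connected_convex_diff_countable[OF convex noncoll])
    \<comment> \<open>A switch indicator: away from \<open>Z\<close> it is 0 where
      \<open>e = r\<close> and 1 where \<open>e = F\<close>, so continuity on a connected set fixes
      it.\<close>
    let ?k = "\<lambda>x. (e x - r) / (F x - r)"
    have k_cont: "continuous_on (Sl y - (Sl y \<inter> Z)) ?k"
      using cont by (intro continuous_intros) (auto simp: Sl_def W_def Z_def intro: continuous_on_subset)
    have k: "?k x = 0 \<and> e x = r \<or> ?k x = 1 \<and> e x = F x" if "x \<in> Sl y - (Sl y \<inter> Z)" for x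
      using e[of x] that by (auto simp: Sl_def W_def Z_def)
    have "?k ` (Sl y - (Sl y \<inter> Z)) \<subseteq> {0, 1}"
    proof (rule image_subsetI)
      show "?k x \<in> {0, 1}" if "x \<in> Sl y - (Sl y \<inter> Z)" for x using k[OF that] by blast
    qed
    then have "finite (?k ` (Sl y - (Sl y \<inter> Z)))" by (rule finite_subset) simp
    then have "?k constant_on (Sl y - (Sl y \<inter> Z))"
      by (rule continuous_finite_range_constant[OF conn k_cont])
    then obtain c where c: "\<And>x. x \<in> Sl y - (Sl y \<inter> Z) \<Longrightarrow> ?k x = c" by (auto simp: constant_on_def)
    have onZ: "e x = r \<and> e x = F x" if "x \<in> Sl y \<inter> Z" for x
      using e[of x] that by (auto simp: Sl_def W_def Z_def)
    show "(\<forall>x\<in>Sl y. e x = r) \<or> (\<forall>x\<in>Sl y. e x = F x)"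
    proof (cases "c = 0")
      case True
      then have "e x = r" if "x \<in> Sl y" for x using k[of x] c[of x] onZ[of x] that by force
      then show ?thesis by blast
    next
      case False
      then have "e x = F x" if "x \<in> Sl y" for x using k[of x] c[of x] onZ[of x] that by force
      then show ?thesis by blast
    qed
  qed
  have Sl_iff: "(\<exists>d\<in>P. y + d \<in> W \<and> Q (y + d)) \<longleftrightarrow> (\<exists>x\<in>Sl y. Q x)" for y Q
    unfolding Sl_def by (auto simp: bex_simps) (metis add.commute diff_add_cancel)
  have open_part: "open {y \<in> W. \<exists>x\<in>Sl y. f x \<noteq> h x}"
    if fh: "continuous_on W f" "continuous_on W h" for f h :: "'e \<Rightarrow> real"
  proof -
    have oW: "open W" by (simp add: W_def)
    have o: "open (W \<inter> (\<lambda>x. f x - h x) -` (- {0}))"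
      using fh by (intro continuous_open_preimage continuous_intros oW) auto
    have "{y \<in> W. \<exists>x\<in>Sl y. f x \<noteq> h x} =
        W \<inter> (\<Union>d\<in>P. (\<lambda>y. d + y) -` (W \<inter> (\<lambda>x. f x - h x) -` (- {0})))"
      unfolding Sl_iff[of _ "\<lambda>x. f x \<noteq> h x", symmetric] by (auto simp: add.commute)
    moreover have "open ((\<lambda>y. d + y) -` (W \<inter> (\<lambda>x. f x - h x) -` (- {0})))" for d
      by (rule open_vimage[OF o]) (intro continuous_intros)
    ultimately show ?thesis using oW by (simp only:) (intro open_Int open_UN ballI)
  qed
  \<comment> \<open>To pass between slices: both sets are open, they are disjoint because each slice
    makes one choice, and they cover \<open>W\<close> because no slice has \<open>e = F = r\<close>
    throughout. Connectedness of the ball makes the choice uniform.\<close>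
  define T1 where "T1 = {y \<in> W. \<exists>x\<in>Sl y. e x \<noteq> F x}"
  define T2 where "T2 = {y \<in> W. \<exists>x\<in>Sl y. e x \<noteq> r}"
  have o1: "open T1" using open_part[OF cont(2,1)[folded W_def]] unfolding T1_def .
  have o2: "open T2" 
    using open_part[OF cont(2)[folded W_def] continuous_on_const[of _ r]] unfolding T2_def .
  have "connected W" by (simp add: W_def)
  moreover have "T1 \<inter> T2 \<inter> W = {}" using Sl_dicho unfolding T1_def T2_def by blast
  moreover have "W \<subseteq> T1 \<union> T2" using Sl_nontriv unfolding T1_def T2_def by fastforce
  ultimately have "T1 \<inter> W = {} \<or> T2 \<inter> W = {}" using o1 o2 by (meson connectedD)
  moreover have "x \<in> Sl x" if "x \<in> W" for x using that by (simp add: Sl_def P_def span_zero)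
  ultimately show ?thesis unfolding T1_def T2_def W_def[symmetric] by blast
qed

section \<open>Solutions annihilated by a quadratic polynomial\<close>

context manifold
begin

text \<open>Needed because smooth functions have arbitrary values off the manifold, so identities
  between them hold on \<open>M\<close> only.\<close>

lemma tangent_cong:
  assumes v: "v \<in> T p" and p: "p \<in> M" and f: "f \<in> smooth_functions \<A>" "h \<in> smooth_functions \<A>"
    and eq: "\<And>q. q \<in> M \<Longrightarrow> f q = h q"
  shows "v f = v h"
proof -
  have h: "(\<lambda>x. - 1 * h x) \<in> smooth_functions \<A>"
    by (intro smooth_functions_mult smooth_functions_const f)
  have "v (\<lambda>x. f x + - 1 * h x) = 0"
    by (rule tangent_const_near[OF v smooth_functions_add[OF f(1) h] carrier_open p order_refl, of 0])
       (simp add: eq)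
  then show ?thesis
    using tangent_fadd[OF v f(1) h] tangent_fscale[OF v f(2), of "- 1"] by simp
qed

lemma open_avoid:
  fixes f :: "'a \<Rightarrow> real"
  assumes "continuous_on M f" "closed C"
  shows "open {x \<in> M. f x \<notin> C}"
proof -
  have "{x \<in> M. f x \<notin> C} = M \<inter> f -` (- C)" by auto
  then show ?thesis using assms carrier_open by (simp add: continuous_open_preimage open_Compl)
qed

end

text \<open>Treats \<open>B = 0\<close> and \<open>B \<noteq> 0\<close> uniformly: \<mu> is replaced
  by \<open>B * ev0 - b\<close>, with \<open>ev0\<close> an abstract parameter whose construction
  differs in the two cases. The assumption \<open>nontrivial\<close> makes \<open>q\<close> a
  nonconstant polynomial.\<close>

locale quadratic_system = kaehler \<A> g J nabla
  for \<A> :: "('a::{t2_space,second_countable_topology}, 'e::euclidean_space) atlas"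
    and g :: "'a metric" and J :: "'a endo" and nabla :: "'a connection" +
  fixes B b a :: real and A :: "'a endo" and \<Lambda> :: "'a vfield" and ev0 :: "'a \<Rightarrow> real"
  assumes conn: "connected M"
    and A: "hermitian \<A> g J A" and L: "\<Lambda> \<in> vector_fields \<A>" and ev0: "ev0 \<in> smooth_functions \<A>"
    and quadratic: "\<And>p v. p \<in> M \<Longrightarrow> v \<in> T p \<Longrightarrow>
      B *\<^sub>R A p (A p v) - b *\<^sub>R A p v - a *\<^sub>R v = rank_endo \<Lambda> p v"
    and grad_ev0: "\<And>X p. X \<in> vector_fields \<A> \<Longrightarrow> p \<in> M \<Longrightarrow> X p ev0 = 2 * g p (\<Lambda> p) (X p)"
    and norm_L: "\<And>p. p \<in> M \<Longrightarrow> B * (ev0 p)\<^sup>2 - b * ev0 p - a = g p (\<Lambda> p) (\<Lambda> p)"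
    and A_L: "\<And>p. p \<in> M \<Longrightarrow> A p (\<Lambda> p) = ev0 p *\<^sub>R \<Lambda> p"
    and nabla_L: "\<And>X p. X \<in> vector_fields \<A> \<Longrightarrow> p \<in> M \<Longrightarrow>
      nabla X \<Lambda> p = (B * ev0 p - b) *\<^sub>R X p + B *\<^sub>R A p (X p)"
    and nontrivial: "B \<noteq> 0 \<or> b \<noteq> 0"
    and L_nonzero: "\<exists>p\<in>M. \<Lambda> p \<noteq> 0"
begin

section \<open>Eigenvalues are roots of \<open>q\<close> or equal to \<open>ev0\<close>\<close>

definition q :: "real \<Rightarrow> real"
  where "q t = B * t\<^sup>2 - b * t - a"

lemmas A_endo = hermitian_endo[OF A]

lemma L_tan: "\<Lambda> p \<in> T p" using vector_field_tangent[OF L] .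

lemma finite_roots: "finite {t. q t = 0}"
proof -
  have "[:- a, - b, B:] \<noteq> 0" using nontrivial by auto
  moreover have "{t. q t = 0} = {t. poly [:- a, - b, B:] t = 0}"
    by (auto simp: q_def power2_eq_square algebra_simps)
  ultimately show ?thesis using poly_roots_finite by metis
qed

lemma L_zero_iff: "p \<in> M \<Longrightarrow> \<Lambda> p = 0 \<longleftrightarrow> q (ev0 p) = 0"
  using norm_L[of p] metric_eq_0[OF _ L_tan] metric_zero(1)[OF _ tangent_zero] by (auto simp: q_def)

lemma tangent_ev0:
  assumes "p \<in> M" "v \<in> T p"
  shows "v ev0 = 2 * g p (\<Lambda> p) v"
  using vector_field_extension[OF assms] grad_ev0[OF _ assms(1)] by metis

text \<open>The vector \<open>q c\<close> times \<open>v\<close> equals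
  \<open>rank_endo \<Lambda> p v\<close>, which lies in the complex line of \<Lambda>, where
  \<open>A\<close> acts as \<open>ev0 p\<close>; but \<open>A\<close> also acts on it as
  \<open>c\<close>. If the two numbers differ, the vector is 0.\<close>

lemma eigenvalue_cases:
  assumes p: "p \<in> M" and v: "v \<in> T p" "v \<noteq> 0" and Av: "A p v = c *\<^sub>R v"
  shows "q c = 0 \<or> c = ev0 p"
proof (rule disjCI)
  assume "c \<noteq> ev0 p"
  have JL: "J p (\<Lambda> p) \<in> T p" by (rule endo_tangent[OF J_endo p L_tan])
  define \<alpha> \<beta> where "\<alpha> = g p (\<Lambda> p) v" and "\<beta> = g p (J p (\<Lambda> p)) v"
  have "A p (A p v) = (c * c) *\<^sub>R v" using endo_scale[OF A_endo p v(1), of c] by (simp add: Av)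
  then have "q c *\<^sub>R v = rank_endo \<Lambda> p v"
    unfolding quadratic[OF p v(1), symmetric] by (simp add: Av q_def power2_eq_square scaleR_diff_left)
  then have qv: "q c *\<^sub>R v = \<alpha> *\<^sub>R \<Lambda> p + \<beta> *\<^sub>R J p (\<Lambda> p)" by (simp add: rank_endo_def \<alpha>_def \<beta>_def)
  have "A p (J p (\<Lambda> p)) = ev0 p *\<^sub>R J p (\<Lambda> p)"
    using hermitian_J[OF A p L_tan] A_L[OF p] endo_scale[OF J_endo p L_tan] by simp
  then have "A p (\<alpha> *\<^sub>R \<Lambda> p + \<beta> *\<^sub>R J p (\<Lambda> p)) = ev0 p *\<^sub>R (\<alpha> *\<^sub>R \<Lambda> p + \<beta> *\<^sub>R J p (\<Lambda> p))"
    using p L_tan[of p] JL A_L[OF p]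
    by (simp add: endo_add[OF A_endo] endo_scale[OF A_endo] tangent_smul scaleR_add_right mult.commute)
  then have "(c * q c) *\<^sub>R v = (ev0 p * q c) *\<^sub>R v"
    using endo_scale[OF A_endo p v(1), of "q c"] Av by (simp add: qv[symmetric] mult.commute)
  then have "c * q c = ev0 p * q c" using v(2) scaleR_right_imp_eq by blast
  then show "q c = 0" using \<open>c \<noteq> ev0 p\<close> by simp
qed

lemma eigenvalue_function_cases:
  assumes "ev \<in> eigenvalue_functions \<A> A" "p \<in> M"
  shows "q (ev p) = 0 \<or> ev p = ev0 p"
  using assms eigenvalue_cases unfolding eigenvalue_functions_def by blast

lemma ev0_not_constant: "\<not> (\<forall>p\<in>M. ev0 p = c)"
proof
  assume c: "\<forall>p\<in>M. ev0 p = c"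
  obtain p where p: "p \<in> M" "\<Lambda> p \<noteq> 0" using L_nonzero by blast
  have "\<Lambda> p ev0 = 0" by (rule tangent_const_near[OF L_tan ev0 carrier_open p(1)]) (use c in auto)
  then show False using tangent_ev0[OF p(1) L_tan] metric_pos[OF p(1) L_tan p(2)] by simp
qed

text \<open>Otherwise the constant value would coincide with \<open>ev0\<close> at every point,
  although \<open>ev0\<close> is not constant.\<close>

lemma constant_eigenvalue_root:
  assumes "ev \<in> eigenvalue_functions \<A> A" "\<And>p. p \<in> M \<Longrightarrow> ev p = c"
  shows "q c = 0"
  using eigenvalue_function_cases[OF assms(1)] assms(2) ev0_not_constant[of c] by metis

lemma three_roots:
  assumes "q c1 = 0" "q c2 = 0" "q c3 = 0" "c1 \<noteq> c2" "c1 \<noteq> c3" "c2 \<noteq> c3"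
  shows False
proof -
  have "(c1 - c2) * (B * (c1 + c2) - b) = 0" "(c1 - c3) * (B * (c1 + c3) - b) = 0"
    using assms(1-3) by (auto simp: q_def power2_eq_square algebra_simps)
  then have *: "B * (c1 + c2) = b" "B * (c1 + c3) = b" using assms by auto
  have "B * (c2 - c3) = B * (c1 + c2) - B * (c1 + c3)" by (simp add: algebra_simps)
  then have "B * (c2 - c3) = 0" using * by simp
  then show False using * assms nontrivial by auto
qed

lemma few_constant_eigenvalues:
  assumes S: "S \<subseteq> constant_eigenvalues \<A> A" "card S = 3"
  shows False
proof -
  obtain f1 f2 f3 where f: "S = {f1, f2, f3}" "f1 \<noteq> f2" "f1 \<noteq> f3" "f2 \<noteq> f3"
    using S(2) unfolding card_3_iff by blast
  have ex: "\<exists>c. q c = 0 \<and> f = (\<lambda>p. if p \<in> M then c else 0)" if "f \<in> S" for f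
  proof -
    have f: "f \<in> eigenvalue_functions \<A> A" "f constant_on M"
      using that S(1) by (auto simp: constant_eigenvalues_def)
    then obtain c where c: "\<And>p. p \<in> M \<Longrightarrow> f p = c" by (auto simp: constant_on_def)
    moreover have "f p = 0" if "p \<notin> M" for p using f(1) that by (simp add: eigenvalue_functions_def)
    ultimately show ?thesis using constant_eigenvalue_root[OF f(1) c] by (intro exI[of _ c]) auto
  qed
  obtain c1 c2 c3 where c: "q c1 = 0" "f1 = (\<lambda>p. if p \<in> M then c1 else 0)"
    "q c2 = 0" "f2 = (\<lambda>p. if p \<in> M then c2 else 0)" "q c3 = 0" "f3 = (\<lambda>p. if p \<in> M then c3 else 0)"
    using ex[of f1] ex[of f2] ex[of f3] f(1) by auto
  show False by (rule three_roots[OF c(1,3,5)]) (use f c in auto)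
qed

subsection \<open>Chart expressions\<close>

abbreviation ev0_chart where "ev0_chart U \<phi> \<equiv> ev0 \<circ> inv_into U \<phi>"

lemma ev0_chart_derivative:
  assumes "(U, \<phi>) \<in> \<A>" "p \<in> U"
  shows "frechet_derivative (ev0_chart U \<phi>) (at (\<phi> p)) u = 2 * g p (\<Lambda> p) (chart_vec U \<phi> p u)"
  using tangent_ev0[OF _ chart_vec_tangent[OF assms, of u]] chart_subset[OF assms(1)] assms(2)
  by (auto simp: chart_vec_def ev0)

text \<open>Where \<Lambda> vanishes, the second derivative in a chart is the covariant Hessian
  \<open>2 g (nabla X \<Lambda>) X\<close>, because the remaining term
  \<open>g \<Lambda> (nabla X X)\<close> is 0.\<close>

lemma ev0_chart_hessian:
  fixes w :: 'e
  assumes U: "(U, \<phi>) \<in> \<A>" "p \<in> U" and zero: "\<Lambda> p = 0"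
  defines "W \<equiv> chart_vec U \<phi> p w"
  shows "frechet_derivative (\<lambda>x. frechet_derivative (ev0_chart U \<phi>) (at x) w) (at (\<phi> p)) w =
    2 * g p ((B * ev0 p - b) *\<^sub>R W + B *\<^sub>R A p W) W"
proof -
  have p: "p \<in> M" using chart_subset[OF U(1)] U(2) by auto
  obtain \<beta> R where \<beta>: "R > 0" "ball (\<phi> p) R \<subseteq> \<phi> ` U" "smooth_on UNIV \<beta>" "\<beta> (\<phi> p) = 1"
    and fields: "\<And>u. (\<lambda>q. if q \<in> U then \<beta> (\<phi> q) *\<^sub>R chart_vec U \<phi> q u else 0) \<in> vector_fields \<A>"
    by (rule chart_fields[OF U]) blast
  define X where "X y = (if y \<in> U then \<beta> (\<phi> y) *\<^sub>R chart_vec U \<phi> y w else 0)" for y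
  have X: "X \<in> vector_fields \<A>" unfolding X_def by (rule fields)
  have Xp: "X p = W" using U \<beta>(4) by (simp add: X_def W_def)
  define D where "D x = frechet_derivative (ev0_chart U \<phi>) (at x) w" for x
  define D' where "D' = frechet_derivative D (at (\<phi> p))"
  have D_smooth: "smooth_on (\<phi> ` U) D"
    unfolding D_def by (rule smooth_on_derivative[OF smooth_functions_chart[OF ev0 U(1)]])
  have D0: "D (\<phi> p) = 0"
    using ev0_chart_derivative[OF U, of w] metric_zero(1)[OF p chart_vec_tangent[OF U]] by (simp add: D_def zero)
  \<comment> \<open>The cutoff does not disturb the derivative at the centre: \<beta> is 1 there,
    and its own derivative is multiplied by \<open>D (\<phi> p) = 0\<close>.\<close>
  have "((\<lambda>x. \<beta> x * D x) has_derivative (\<lambda>v. \<beta> (\<phi> p) * D' v + frechet_derivative \<beta> (at (\<phi> p)) v * D (\<phi> p))) (at (\<phi> p))"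
    unfolding D'_def
    by (intro has_derivative_mult smooth_on_has_derivative[OF \<beta>(3)] smooth_on_has_derivative[OF D_smooth])
       (use U in auto)
  then have \<beta>D: "((\<lambda>x. \<beta> x * D x) has_derivative D') (at (\<phi> p))" by (simp add: \<beta>(4) D0)
  have h_chart: "\<beta> x * D x = ((\<lambda>q. X q ev0) \<circ> inv_into U \<phi>) x" if "x \<in> \<phi> ` U" for x
    using inv_chart[OF that] by (simp add: X_def D_def scaleR_fun_apply chart_vec_def ev0)
  have "(((\<lambda>q. X q ev0) \<circ> inv_into U \<phi>) has_derivative D') (at (\<phi> p))"
    by (rule has_derivative_transform_within_open[OF \<beta>D chart_image_open[OF U(1)] imageI[OF U(2)] h_chart])
  then have "W (\<lambda>q. X q ev0) = D' w"
    by (simp add: W_def chart_vec_def vector_field_smooth[OF X ev0] frechet_derivative_eqI)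
  moreover have "W (\<lambda>q. X q ev0) = X p (\<lambda>q. 2 * g q (\<Lambda> q) (X q))"
    unfolding Xp[symmetric]
    by (rule tangent_cong[OF vector_field_tangent[OF X] p vector_field_smooth[OF X ev0]])
       (use grad_ev0[OF X] in \<open>auto intro!: smooth_functions_mult smooth_functions_const metric_smooth L X\<close>)
  moreover have "X p (\<lambda>q. 2 * g q (\<Lambda> q) (X q)) = 2 * (g p (nabla X \<Lambda> p) (X p) + g p (\<Lambda> p) (nabla X X p))"
    using tangent_fscale[OF vector_field_tangent[OF X] metric_smooth[OF L X], of p 2] nabla_metric[OF X L X p] by simp
  ultimately show ?thesis
    using metric_zero(1)[OF p vector_field_tangent[OF nabla_field[OF X X]]]
    by (simp add: D'_def D_def[abs_def] zero nabla_L[OF X p] Xp)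
qed

subsection \<open>The roots are simple\<close>

lemma cauchy_schwarz:
  assumes p: "p \<in> M" and u: "u \<in> T p" "v \<in> T p"
  shows "(g p u v)\<^sup>2 \<le> g p u u * g p v v"
proof (cases "v = 0")
  case True
  then show ?thesis using metric_zero[OF p] u tangent_zero by simp
next
  case False
  define d where "d = g p v v"
  have d: "d > 0" unfolding d_def by (rule metric_pos[OF p u(2) False])
  define x where "x = d *\<^sub>R u - g p u v *\<^sub>R v"
  have "0 \<le> g p x x" by (rule metric_nonneg[OF p]) (simp add: x_def tangent_diff tangent_smul u)
  also have "g p x x = d * (d * g p u u - (g p u v)\<^sup>2)"
    using p u metric_sym[OF p u(2,1)]
    by (simp add: x_def metric_diff metric_scale_left metric_scale_right tangent_diff tangent_smul
        d_def[symmetric] power2_eq_square algebra_simps)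
  finally show ?thesis using d by (simp add: d_def zero_le_mult_iff mult.commute)
qed

text \<open>By Cauchy-Schwarz the derivative of \<open>ev0\<close> along \<open>v\<close> is at most
  2 |\<Lambda>| |v|, and at a double root |\<Lambda>|^2 is \<open>B\<close> times the square of
  \<open>ev0 - r\<close>. This is the linear bound required by \<open>gronwall_ball\<close>.\<close>

lemma double_root_locally_constant:
  assumes q: "\<And>t. q t = B * (t - r)\<^sup>2" and p: "p \<in> M" "ev0 p = r"
  obtains V where "open V" "p \<in> V" "V \<subseteq> M" "\<And>x. x \<in> V \<Longrightarrow> ev0 x = r"
proof -
  obtain U \<phi> where U: "(U, \<phi>) \<in> \<A>" "p \<in> U" using p by (auto simp: manifold_carrier_def)
  obtain \<beta> R where \<beta>: "R > 0" "ball (\<phi> p) R \<subseteq> \<phi> ` U" "smooth_on UNIV \<beta>"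
    "\<And>x. x \<in> ball (\<phi> p) R \<Longrightarrow> \<beta> x > 0"
    and fields: "\<And>u. (\<lambda>q. if q \<in> U then \<beta> (\<phi> q) *\<^sub>R chart_vec U \<phi> q u else 0) \<in> vector_fields \<A>"
    by (rule chart_fields[OF U]) blast
  define X where "X u y = (if y \<in> U then \<beta> (\<phi> y) *\<^sub>R chart_vec U \<phi> y u else 0)" for u y
  have X: "X u \<in> vector_fields \<A>" for u unfolding X_def by (rule fields)
  define F where "F = ev0_chart U \<phi>"
  \<comment> \<open>The metric is known to be smooth on global fields only, so the length of a
    coordinate vector is read off from the cut-off field and divided by \<beta>. Continuity of
    \<open>k u\<close> bounds it on the smaller closed ball.\<close>
  define k where "k u x = 2 * sqrt (\<bar>B\<bar> * ((\<lambda>q. g q (X u q) (X u q)) \<circ> inv_into U \<phi>) x) / \<beta> x" for u x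
  have F_bound: "\<bar>frechet_derivative F (at x) u\<bar> \<le> k u x * \<bar>F x - r\<bar>" if x: "x \<in> ball (\<phi> p) R" for x u
  proof -
    define y where "y = inv_into U \<phi> x"
    have y: "y \<in> U" "\<phi> y = x" "y \<in> M"
      using inv_chart[OF subsetD[OF \<beta>(2) x]] chart_subset[OF U(1)] by (auto simp: y_def)
    define v where "v = chart_vec U \<phi> y u"
    have v: "v \<in> T y" unfolding v_def by (rule chart_vec_tangent[OF U(1) y(1)])
    have D: "frechet_derivative F (at x) u = 2 * g y (\<Lambda> y) v"
      using ev0_chart_derivative[OF U(1) y(1), of u] by (simp add: F_def v_def y(2))
    have gX: "g y (X u y) (X u y) = (\<beta> x)\<^sup>2 * g y v v"
      using y v by (simp add: X_def v_def[symmetric] metric_scale_left metric_scale_right tangent_smul power2_eq_square)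
    have "(g y (\<Lambda> y) v)\<^sup>2 \<le> q (ev0 y) * g y v v"
      using cauchy_schwarz[OF y(3) L_tan v] norm_L[OF y(3)] by (simp add: q_def)
    also have "\<dots> \<le> (\<bar>B\<bar> * (ev0 y - r)\<^sup>2) * g y v v"
      unfolding q by (intro mult_right_mono metric_nonneg y v) auto
    finally have "\<bar>g y (\<Lambda> y) v\<bar> \<le> sqrt (\<bar>B\<bar> * g y v v) * \<bar>ev0 y - r\<bar>"
      using real_sqrt_le_mono by (fastforce simp: real_sqrt_mult mult_ac)
    moreover have "k u x = 2 * sqrt (\<bar>B\<bar> * g y v v)"
      using \<beta>(4)[OF x] by (simp add: k_def y_def[symmetric] gX real_sqrt_mult)
    ultimately show ?thesis unfolding D by (simp add: F_def y_def[symmetric] abs_mult)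
  qed
  have k_cont: "continuous_on (ball (\<phi> p) R) (k u)" for u
  proof -
    have c1: "continuous_on (ball (\<phi> p) R) ((\<lambda>q. g q (X u q) (X u q)) \<circ> inv_into U \<phi>)"
      by (rule continuous_on_subset[OF smooth_on_continuous_on[OF smooth_functions_chart[OF metric_smooth[OF X X] U(1)]] \<beta>(2)])
    have c2: "continuous_on (ball (\<phi> p) R) \<beta>"
      by (rule continuous_on_subset[OF smooth_on_continuous_on[OF \<beta>(3)]]) simp
    have c3: "\<forall>x\<in>ball (\<phi> p) R. \<beta> x \<noteq> 0" using \<beta>(4) by force
    show ?thesis
      unfolding k_def
      by (intro continuous_on_divide continuous_on_mult continuous_on_real_sqrt continuous_on_const c1 c2 c3)
  qed
  have sub: "cball (\<phi> p) (R/2) \<subseteq> ball (\<phi> p) R" using \<beta>(1) by auto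
  have "\<exists>K. \<forall>x\<in>cball (\<phi> p) (R/2). \<bar>k u x\<bar> \<le> K" for u
  proof -
    have "compact (k u ` cball (\<phi> p) (R/2))"
      by (rule compact_continuous_image[OF continuous_on_subset[OF k_cont sub] compact_cball])
    then show ?thesis using compact_imp_bounded bounded_real by (metis imageI)
  qed
  then obtain K where K: "\<And>u x. x \<in> cball (\<phi> p) (R/2) \<Longrightarrow> \<bar>k u x\<bar> \<le> K u" by metis
  define C where "C = (\<Sum>i\<in>Basis. K i)"
  have F_deriv: "(F has_derivative frechet_derivative F (at x)) (at x)" if "x \<in> cball (\<phi> p) (R/2)" for x
    unfolding F_def
    by (rule smooth_on_has_derivative[OF smooth_functions_chart[OF ev0 U(1)] subsetD[OF \<beta>(2) subsetD[OF sub that]]])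
  have bound: "\<bar>frechet_derivative F (at x) u\<bar> \<le> C * \<bar>F x - r\<bar> * norm u" if x: "x \<in> cball (\<phi> p) (R/2)" for x u
  proof -
    interpret bounded_linear "frechet_derivative F (at x)"
      using F_deriv[OF x] by (rule has_derivative_bounded_linear)
    have "frechet_derivative F (at x) u = (\<Sum>i\<in>Basis. (u \<bullet> i) * frechet_derivative F (at x) i)"
      by (subst euclidean_representation[of u, symmetric]) (simp add: sum scaleR)
    also have "\<bar>\<dots>\<bar> \<le> (\<Sum>i\<in>Basis. norm u * (K i * \<bar>F x - r\<bar>))"
    proof (rule order_trans[OF sum_abs sum_mono])
      fix i :: 'e assume i: "i \<in> Basis"
      have "\<bar>frechet_derivative F (at x) i\<bar> \<le> k i x * \<bar>F x - r\<bar>" using F_bound x sub by blast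
      also have "\<dots> \<le> K i * \<bar>F x - r\<bar>" using K[OF x, of i] by (intro mult_right_mono) auto
      finally show "\<bar>(u \<bullet> i) * frechet_derivative F (at x) i\<bar> \<le> norm u * (K i * \<bar>F x - r\<bar>)"
        unfolding abs_mult using Basis_le_norm[OF i, of u] by (intro mult_mono) auto
    qed
    also have "\<dots> = C * \<bar>F x - r\<bar> * norm u"
      by (simp add: C_def sum_distrib_left sum_distrib_right mult_ac)
    finally show ?thesis .
  qed
  have Fp: "F (\<phi> p) = r" using p by (simp add: F_def chart_inv[OF U])
  have "R / 2 > 0" using \<beta>(1) by simp
  then obtain \<rho> where \<rho>: "\<rho> > 0" "\<And>x. x \<in> ball (\<phi> p) \<rho> \<Longrightarrow> F x = r"
    using gronwall_ball[OF _ Fp F_deriv bound] by metis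
  show thesis
  proof (rule that)
    show "open (U \<inter> \<phi> -` ball (\<phi> p) \<rho>)" by (rule chart_preimage_open[OF U(1)]) simp
    show "ev0 x = r" if "x \<in> U \<inter> \<phi> -` ball (\<phi> p) \<rho>" for x
      using that \<rho>(2)[of "\<phi> x"] chart_inv[OF U(1), of x] by (simp add: F_def)
  qed (use U \<rho>(1) chart_subset[OF U(1)] in auto)
qed

text \<open>The number in question is the derivative of \<open>q\<close>. If it vanished,
  \<open>q\<close> would be \<open>B\<close> times the square of \<open>t - r\<close>, so the level
  set of \<open>ev0\<close> at the root would be open and closed, and \<open>ev0\<close>
  constant.\<close>

lemma simple_root:
  assumes p: "p \<in> M" and root: "q (ev0 p) = 0"
  shows "2 * B * ev0 p - b \<noteq> 0"
proof
  assume d: "2 * B * ev0 p - b = 0"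
  define r where "r = ev0 p"
  have b: "b = 2 * B * r" using d by (simp add: r_def)
  have "a = B * r\<^sup>2 - b * r" using root by (simp add: q_def r_def)
  then have q: "q t = B * (t - r)\<^sup>2" for t
    unfolding q_def by (simp only: b) (simp add: power2_eq_square algebra_simps)
  define Z where "Z = {x \<in> M. ev0 x \<in> {r}}"
  have "open Z"
  proof (subst open_subopen, intro ballI)
    fix x assume "x \<in> Z"
    then have x: "x \<in> M" "ev0 x = r" by (simp_all add: Z_def)
    obtain V where V: "open V" "x \<in> V" "V \<subseteq> M" "\<And>y. y \<in> V \<Longrightarrow> ev0 y = r"
      by (rule double_root_locally_constant[OF q x]) (rule that)
    have "V \<subseteq> Z" using V(3,4) by (auto simp: Z_def)
    then show "\<exists>V. open V \<and> x \<in> V \<and> V \<subseteq> Z" using V(1,2) by blast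
  qed
  moreover have "open {x \<in> M. ev0 x \<notin> {r}}"
    by (rule open_avoid[OF smooth_functions_continuous[OF ev0]]) simp
  ultimately have "Z \<inter> M = {} \<or> {x \<in> M. ev0 x \<notin> {r}} \<inter> M = {}"
    by (intro connectedD[OF conn]) (auto simp: Z_def)
  moreover have "p \<in> Z" using p by (simp add: Z_def r_def)
  ultimately have "\<forall>x\<in>M. ev0 x = r" using p by auto
  then show False using ev0_not_constant by blast
qed

subsection \<open>Eigenvalue functions near the zeros of the gradient\<close>

text \<open>The plane corresponds to \<open>v\<close> and \<open>J v\<close>, orthogonal vectors of
  equal length in the same eigenspace. On it the Hessian operator is twice
  \<open>(B r - b) + B r = q'(r)\<close>, whence \<open>c = 2 q'(r) |v|^2\<close>, nonzero by
  \<open>simple_root\<close>.\<close>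

lemma hessian_plane:
  assumes U: "(U, \<phi>) \<in> \<A>" "z \<in> U" and v: "v \<in> T z" "v \<noteq> 0" "A z v = ev0 z *\<^sub>R v"
    and root: "q (ev0 z) = 0"
  obtains u w c where "c \<noteq> 0" "\<And>s t. s *\<^sub>R u + t *\<^sub>R w = 0 \<Longrightarrow> s = 0 \<and> t = 0"
    "\<And>s t. frechet_derivative (\<lambda>x. frechet_derivative (ev0_chart U \<phi>) (at x) (s *\<^sub>R u + t *\<^sub>R w)) (at (\<phi> z))
      (s *\<^sub>R u + t *\<^sub>R w) = c * (s\<^sup>2 + t\<^sup>2)"
proof -
  have z: "z \<in> M" using chart_subset[OF U(1)] U(2) by auto
  define r where "r = ev0 z"
  have Lz: "\<Lambda> z = 0" using L_zero_iff[OF z] root by simp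
  have Jv: "J z v \<in> T z" by (rule endo_tangent[OF J_endo z v(1)])
  have AJv: "A z (J z v) = r *\<^sub>R J z v"
    using hermitian_J[OF A z v(1)] v(3) endo_scale[OF J_endo z v(1)] by (simp add: r_def)
  obtain u where u: "v = chart_vec U \<phi> z u" using tangent_eq_chart_vec[OF U v(1)] .
  obtain w where w: "J z v = chart_vec U \<phi> z w" using tangent_eq_chart_vec[OF U Jv] .
  have W: "chart_vec U \<phi> z (s *\<^sub>R u + t *\<^sub>R w) = s *\<^sub>R v + t *\<^sub>R J z v" for s t
    by (simp add: chart_vec_linear[OF U] u[symmetric] w[symmetric])
  have gW: "g z (s *\<^sub>R v + t *\<^sub>R J z v) (s *\<^sub>R v + t *\<^sub>R J z v) = (s\<^sup>2 + t\<^sup>2) * g z v v" for s t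
    using z v(1) Jv metric_J_self[OF z v(1)] metric_J_J[OF z v(1) v(1)]
    by (simp add: metric_add_left metric_add_right metric_scale_left metric_scale_right tangent_add tangent_smul
        power2_eq_square algebra_simps)
  have gv: "g z v v > 0" by (rule metric_pos[OF z v(1,2)])
  define c where "c = 2 * (2 * B * r - b) * g z v v"
  show thesis
  proof (rule that[of c u w])
    show "c \<noteq> 0" using simple_root[OF z root] gv by (simp add: c_def r_def)
    show "s = 0 \<and> t = 0" if "s *\<^sub>R u + t *\<^sub>R w = 0" for s t
    proof -
      have "s *\<^sub>R v + t *\<^sub>R J z v = 0" using W[of s t] chart_vec_eq_0_iff[OF U, of 0] that by simp
      then have "(s\<^sup>2 + t\<^sup>2) * g z v v = 0" using gW[of s t] metric_zero(1)[OF z tangent_zero] by simp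
      then show ?thesis using gv by (simp add: sum_power2_eq_zero_iff)
    qed
    fix s t
    define Y where "Y = s *\<^sub>R v + t *\<^sub>R J z v"
    have Y: "Y \<in> T z" unfolding Y_def by (intro tangent_add tangent_smul v Jv)
    have AY: "A z Y = r *\<^sub>R Y"
      using z v Jv AJv by (simp add: Y_def endo_add[OF A_endo] endo_scale[OF A_endo] tangent_smul r_def
          scaleR_add_right mult.commute)
    have "(B * r - b) *\<^sub>R Y + B *\<^sub>R A z Y = (2 * B * r - b) *\<^sub>R Y"
      unfolding AY scaleR_scaleR scaleR_add_left[symmetric] by (rule arg_cong[of _ _ "\<lambda>c. c *\<^sub>R Y"]) simp
    then have "g z ((B * r - b) *\<^sub>R Y + B *\<^sub>R A z Y) Y = (2 * B * r - b) * ((s\<^sup>2 + t\<^sup>2) * g z v v)"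
      using gW[of s t] by (simp add: metric_scale_left[OF z Y Y] Y_def[symmetric])
    then show "frechet_derivative (\<lambda>x. frechet_derivative (ev0_chart U \<phi>) (at x) (s *\<^sub>R u + t *\<^sub>R w)) (at (\<phi> z))
        (s *\<^sub>R u + t *\<^sub>R w) = c * (s\<^sup>2 + t\<^sup>2)"
      unfolding ev0_chart_hessian[OF U Lz] W Y_def[symmetric] r_def[symmetric] by (simp add: c_def)
  qed
qed

text \<open>Here \<open>ev\<close> could switch between \<open>r\<close> and \<open>ev0\<close>. The
  eigenvector supplied by \<open>ev\<close> itself gives a plane on which the Hessian of
  \<open>ev0\<close> is definite: this forces one choice near \<open>z\<close>, and it also prevents
  \<open>ev0\<close> from being locally constant, so that the two choices are
  distinguishable.\<close>

lemma eigenvalue_near_root: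
  assumes ev: "ev \<in> eigenvalue_functions \<A> A" and z: "z \<in> M" and r: "ev z = r" "ev0 z = r" "q r = 0"
  shows "\<exists>V. open V \<and> z \<in> V \<and> V \<subseteq> M \<and> ((\<forall>x\<in>V. ev x = r) \<or> (\<forall>x\<in>V. ev x = ev0 x))"
    and "\<not> (\<exists>V. open V \<and> z \<in> V \<and> V \<subseteq> M \<and> (\<forall>x\<in>V. ev0 x = r))"
proof -
  have ev_cont: "continuous_on M ev" using ev by (simp add: eigenvalue_functions_def)
  obtain U \<phi> where U: "(U, \<phi>) \<in> \<A>" "z \<in> U" using z by (auto simp: manifold_carrier_def)
  obtain v where v: "v \<in> T z" "v \<noteq> 0" "A z v = ev0 z *\<^sub>R v"
    using ev z r unfolding eigenvalue_functions_def by auto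
  obtain u w c where c: "c \<noteq> 0" and indep: "\<And>s t. s *\<^sub>R u + t *\<^sub>R w = 0 \<Longrightarrow> s = 0 \<and> t = 0"
    and hess: "\<And>s t. frechet_derivative (\<lambda>x. frechet_derivative (ev0_chart U \<phi>) (at x) (s *\<^sub>R u + t *\<^sub>R w))
      (at (\<phi> z)) (s *\<^sub>R u + t *\<^sub>R w) = c * (s\<^sup>2 + t\<^sup>2)"
    using hessian_plane[OF U v] r by metis
  show "\<not> (\<exists>V. open V \<and> z \<in> V \<and> V \<subseteq> M \<and> (\<forall>x\<in>V. ev0 x = r))"
  proof
    assume "\<exists>V. open V \<and> z \<in> V \<and> V \<subseteq> M \<and> (\<forall>x\<in>V. ev0 x = r)"
    then obtain V where V: "open V" "z \<in> V" "\<And>x. x \<in> V \<Longrightarrow> ev0 x = r" by blast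
    have o: "open (\<phi> ` (U \<inter> V))"
      using chart_open[OF U(1)] V(1) by (intro chart_image_open_subset[OF U(1)]) auto
    have D0: "frechet_derivative (ev0_chart U \<phi>) (at x) y = 0" if "x \<in> \<phi> ` (U \<inter> V)" for x y
    proof -
      have "(ev0_chart U \<phi> has_derivative (\<lambda>_. 0)) (at x)"
        by (rule has_derivative_transform_within_open[OF has_derivative_const[of r] o that])
           (auto simp: chart_inv[OF U(1)] V(3))
      then show ?thesis by (simp add: frechet_derivative_eqI)
    qed
    have "((\<lambda>x. frechet_derivative (ev0_chart U \<phi>) (at x) (1 *\<^sub>R u + 0 *\<^sub>R w)) has_derivative (\<lambda>_. 0)) (at (\<phi> z))"
      by (rule has_derivative_transform_within_open[OF has_derivative_const[of 0] o]) (use U V D0 in auto)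
    then show False using hess[of 1 0] c by (simp add: frechet_derivative_eqI)
  qed
  \<comment> \<open>The other roots form a finite, hence closed, set that both functions avoid near
    \<open>z\<close>; this reduces the possible values of \<open>ev\<close> to \<open>r\<close> and
    \<open>ev0\<close>.\<close>
  define C where "C = {t. q t = 0} - {r}"
  have C: "closed C" unfolding C_def using finite_roots by (simp add: finite_imp_closed)
  define V0 where "V0 = U \<inter> ({x \<in> M. ev x \<notin> C} \<inter> {x \<in> M. ev0 x \<notin> C})"
  have V0: "open V0" unfolding V0_def
    using open_avoid[OF ev_cont C] open_avoid[OF smooth_functions_continuous[OF ev0] C] chart_open[OF U(1)] by auto
  have zV0: "z \<in> V0" using U z r by (simp add: V0_def C_def)
  define S where "S = \<phi> ` V0"
  have S: "open S" "\<phi> z \<in> S" unfolding S_def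
    using chart_image_open_subset[OF U(1) V0] zV0 by (auto simp: V0_def)
  have V0U: "V0 \<subseteq> U" by (auto simp: V0_def)
  define F where "F = ev0_chart U \<phi>"
  define e where "e = ev \<circ> inv_into U \<phi>"
  have S_inv: "inv_into U \<phi> x \<in> V0" "\<phi> (inv_into U \<phi> x) = x" if "x \<in> S" for x
    using that V0U chart_inv[OF U(1)] by (auto simp: S_def)
  have F: "smooth_on S F" unfolding F_def
    by (rule smooth_on_subset[OF smooth_functions_chart[OF ev0 U(1)]]) (use V0U in \<open>auto simp: S_def\<close>)
  have e_cont: "continuous_on S e" unfolding e_def o_def
    by (rule continuous_on_compose2[OF ev_cont continuous_on_subset[OF homeomorphism_cont2[OF chart_homeomorphism[OF U(1)]]]])
       (use V0U S_inv(1) in \<open>auto simp: S_def V0_def\<close>)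
  have crit: "frechet_derivative F (at x) y = 0" if x: "x \<in> S" "F x = r" for x y
  proof -
    define p where "p = inv_into U \<phi> x"
    have p: "p \<in> U" "p \<in> M" "\<phi> p = x" using S_inv[OF x(1)] by (auto simp: p_def V0_def)
    have "\<Lambda> p = 0" using L_zero_iff[OF p(2)] x(2) r(3) by (simp add: F_def p_def)
    then show ?thesis
      using ev0_chart_derivative[OF U(1) p(1), of y] metric_zero(1)[OF p(2) chart_vec_tangent[OF U(1) p(1)]]
      by (simp add: F_def p(3))
  qed
  obtain \<rho> where \<rho>: "\<rho> > 0" "ball (\<phi> z) \<rho> \<subseteq> S"
    and uniq: "\<And>x s t. x \<in> ball (\<phi> z) \<rho> \<Longrightarrow> x + (s *\<^sub>R u + t *\<^sub>R w) \<in> ball (\<phi> z) \<rho> \<Longrightarrow> F x = r \<Longrightarrow>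
      F (x + (s *\<^sub>R u + t *\<^sub>R w)) = r \<Longrightarrow> s = 0 \<and> t = 0"
    using slice_unique_zero[OF S F crit c hess[folded F_def]] by metis
  have dich: "e x = r \<or> e x = F x" if "x \<in> ball (\<phi> z) \<rho>" for x
  proof -
    have x: "inv_into U \<phi> x \<in> V0" using S_inv(1) \<rho>(2) that by blast
    then show ?thesis
      using eigenvalue_function_cases[OF ev, of "inv_into U \<phi> x"] by (auto simp: V0_def C_def e_def F_def)
  qed
  have "(\<forall>x\<in>ball (\<phi> z) \<rho>. e x = r) \<or> (\<forall>x\<in>ball (\<phi> z) \<rho>. e x = F x)"
    by (rule slice_dichotomy[OF \<rho>(1) indep continuous_on_subset[OF smooth_on_continuous_on[OF F] \<rho>(2)]
          continuous_on_subset[OF e_cont \<rho>(2)] dich uniq])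
  moreover have "e (\<phi> x) = ev x" "F (\<phi> x) = ev0 x" if "x \<in> U" for x
    using chart_inv[OF U(1) that] by (simp_all add: e_def F_def)
  ultimately have "(\<forall>x\<in>U \<inter> \<phi> -` ball (\<phi> z) \<rho>. ev x = r) \<or> (\<forall>x\<in>U \<inter> \<phi> -` ball (\<phi> z) \<rho>. ev x = ev0 x)"
    by fastforce
  moreover have "open (U \<inter> \<phi> -` ball (\<phi> z) \<rho>)" by (rule chart_preimage_open[OF U(1)]) simp
  moreover have "z \<in> U \<inter> \<phi> -` ball (\<phi> z) \<rho>" using U(2) \<rho>(1) by simp
  ultimately show "\<exists>V. open V \<and> z \<in> V \<and> V \<subseteq> M \<and> ((\<forall>x\<in>V. ev x = r) \<or> (\<forall>x\<in>V. ev x = ev0 x))"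
    using chart_subset[OF U(1)] by blast
qed

section \<open>Gluing the local alternatives over the connected manifold\<close>

lemma eigenvalue_locally:
  assumes ev: "ev \<in> eigenvalue_functions \<A> A" and p: "p \<in> M"
  shows "\<exists>V. open V \<and> p \<in> V \<and> V \<subseteq> M \<and> ((\<exists>r. q r = 0 \<and> (\<forall>x\<in>V. ev x = r)) \<or> (\<forall>x\<in>V. ev x = ev0 x))"
proof -
  have ev_cont: "continuous_on M ev" using ev by (simp add: eigenvalue_functions_def)
  have closed: "closed ({t. q t = 0} - D)" for D
    by (rule finite_imp_closed) (use finite_roots in simp)
  consider "q (ev p) \<noteq> 0" | "q (ev p) = 0" "ev p \<noteq> ev0 p" | "q (ev p) = 0" "ev p = ev0 p" by blast
  then show ?thesis
  proof cases
    case 1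
    \<comment> \<open>Not a root at \<open>p\<close>, hence not a root nearby, which leaves only
      \<open>ev0\<close>.\<close>
    let ?V = "{x \<in> M. ev x \<notin> {t. q t = 0} - {}}"
    have "\<forall>x\<in>?V. ev x = ev0 x" using eigenvalue_function_cases[OF ev] by auto
    then show ?thesis using open_avoid[OF ev_cont closed, of "{}"] 1 p by (intro exI[of _ ?V]) auto
  next
    case 2
    \<comment> \<open>A root different from \<open>ev0\<close> at \<open>p\<close>: nearby
      \<open>ev\<close> still avoids \<open>ev0\<close> and all other roots, so it stays at this
      root.\<close>
    let ?V1 = "{x \<in> M. ev x \<notin> {t. q t = 0} - {ev p}}" and ?V2 = "{x \<in> M. ev x - ev0 x \<notin> {0}}"
    have "open ?V2"
      by (rule open_avoid[OF continuous_on_diff[OF ev_cont smooth_functions_continuous[OF ev0]]]) simp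
    then have "open (?V1 \<inter> ?V2)" using open_avoid[OF ev_cont closed] by (rule open_Int[rotated])
    moreover have "\<forall>x\<in>?V1 \<inter> ?V2. ev x = ev p" using eigenvalue_function_cases[OF ev] by auto
    moreover have "p \<in> ?V1 \<inter> ?V2" "?V1 \<inter> ?V2 \<subseteq> M" using 2 p by auto
    ultimately show ?thesis using 2(1) by blast
  next
    case 3
    then show ?thesis using eigenvalue_near_root(1)[OF ev p refl] by metis
  qed
qed

text \<open>The open sets on which \<open>ev\<close> is a root and those on which it is
  \<open>ev0\<close> cover \<open>M\<close>. By connectedness one kind suffices; if it is the first,
  \<open>ev\<close> has finite range and is therefore constant.\<close>

lemma nonconstant_eigenvalue_eq:
  assumes ev: "ev \<in> nonconstant_eigenvalues \<A> A"
  shows "ev = (\<lambda>p. if p \<in> M then ev0 p else 0)"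
proof -
  have ev': "ev \<in> eigenvalue_functions \<A> A" and nc: "\<not> ev constant_on M"
    using ev by (auto simp: nonconstant_eigenvalues_def)
  have ev_cont: "continuous_on M ev" using ev' by (simp add: eigenvalue_functions_def)
  define P1 where "P1 V \<longleftrightarrow> open V \<and> V \<subseteq> M \<and> (\<exists>r. q r = 0 \<and> (\<forall>x\<in>V. ev x = r))" for V
  define P2 where "P2 V \<longleftrightarrow> open V \<and> V \<subseteq> M \<and> (\<forall>x\<in>V. ev x = ev0 x)" for V
  have "open (\<Union>{V. P1 V})" "open (\<Union>{V. P2 V})" by (auto simp: P1_def P2_def)
  moreover have cover: "M \<subseteq> \<Union>{V. P1 V} \<union> \<Union>{V. P2 V}"
  proof
    fix p assume "p \<in> M"
    from eigenvalue_locally[OF ev' this] obtain V where "p \<in> V" "P1 V \<or> P2 V"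
      unfolding P1_def P2_def by blast
    then show "p \<in> \<Union>{V. P1 V} \<union> \<Union>{V. P2 V}" by blast
  qed
  moreover have "\<Union>{V. P1 V} \<inter> \<Union>{V. P2 V} \<inter> M = {}"
  proof (rule ccontr)
    assume "\<not> ?thesis"
    then obtain p V V' where p: "p \<in> V" "p \<in> V'" "p \<in> M" "P1 V" "P2 V'" by blast
    then obtain r where r: "q r = 0" "\<And>x. x \<in> V \<Longrightarrow> ev x = r" by (auto simp: P1_def)
    have eq: "ev0 x = r" if "x \<in> V \<inter> V'" for x using that r(2) p(5) by (auto simp: P2_def)
    have "open (V \<inter> V')" "V \<inter> V' \<subseteq> M" using p by (auto simp: P1_def P2_def)
    \<comment> \<open>An overlap would make \<open>ev0\<close> constant near a point where it equals
      \<open>ev\<close> and a root.\<close>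
    then show False
      using eigenvalue_near_root(2)[OF ev' p(3) r(2)[OF p(1)] eq r(1)] p(1,2) eq by blast
  qed
  ultimately have "\<Union>{V. P1 V} \<inter> M = {} \<or> \<Union>{V. P2 V} \<inter> M = {}"
    by (intro connectedD[OF conn])
  then have all: "\<forall>x\<in>M. ev x = ev0 x"
  proof
    assume "\<Union>{V. P1 V} \<inter> M = {}"
    then have "M \<subseteq> \<Union>{V. P2 V}" using cover by blast
    then show ?thesis unfolding P2_def by blast
  next
    assume "\<Union>{V. P2 V} \<inter> M = {}"
    then have "M \<subseteq> \<Union>{V. P1 V}" using cover by blast
    then have "q (ev p) = 0" if "p \<in> M" for p using that unfolding P1_def by force
    then have "ev ` M \<subseteq> {t. q t = 0}" by blast
    then have "ev constant_on M"
      using continuous_finite_range_constant[OF conn ev_cont] finite_roots finite_subset by blast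
    then show ?thesis using nc by blast
  qed
  moreover have "ev p = 0" if "p \<notin> M" for p using ev' that by (simp add: eigenvalue_functions_def)
  ultimately show ?thesis by auto
qed

lemma few_nonconstant_eigenvalues:
  assumes "S \<subseteq> nonconstant_eigenvalues \<A> A" "card S = 2"
  shows False
proof -
  obtain f1 f2 where "S = {f1, f2}" "f1 \<noteq> f2" using assms(2) unfolding card_2_iff by blast
  then show False using nonconstant_eigenvalue_eq[of f1] nonconstant_eigenvalue_eq[of f2] assms(1) by auto
qed

end

section \<open>Low mobility forces a quadratic relation\<close>

text \<open>Since \<open>dim\<close> is meaningful only in the finite-dimensional case, the
  independent triple is extended to a basis there; otherwise the mobility is infinite.\<close>

lemma three_le_mobility:
  assumes "X \<in> Sol \<A> g J nabla" "Y \<in> Sol \<A> g J nabla" "Z \<in> Sol \<A> g J nabla"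
    and X: "X \<noteq> 0" and Y: "Y \<notin> span {X}" and Z: "Z \<notin> span {X, Y}"
  shows "mobility \<A> g J nabla \<ge> 3"
proof (cases "\<exists>S. finite S \<and> Sol \<A> g J nabla \<subseteq> span S")
  case True
  then obtain S where S: "finite S" "Sol \<A> g J nabla \<subseteq> span S" by blast
  have ne: "Y \<noteq> X" "Z \<noteq> X" "Z \<noteq> Y" using Y Z by (auto intro: span_base)
  have "independent {X}" using X by simp
  then have "independent {Y, X}" using Y by (rule independent_insertI[rotated])
  then have ind: "independent {Z, X, Y}"
    using Z independent_insertI[of Z "{X, Y}"] by (simp add: insert_commute)
  obtain C where C: "{Z, X, Y} \<subseteq> C" "C \<subseteq> Sol \<A> g J nabla" "independent C" "Sol \<A> g J nabla \<subseteq> span C"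
    using maximal_independent_subset_extend[OF _ ind, of "Sol \<A> g J nabla"] assms(1-3) by auto
  have "finite C" using independent_span_bound[OF S(1) C(3)] C(2) S(2) by auto
  then have "card {Z, X, Y} \<le> card C" using C(1) by (rule card_mono)
  moreover have "card {Z, X, Y} = 3" using ne by simp
  moreover have "card C = dim (Sol \<A> g J nabla)" by (rule basis_card_eq_dim[OF C(2,4,3)])
  ultimately have "3 \<le> dim (Sol \<A> g J nabla)" by simp
  then have "enat 3 \<le> enat (dim (Sol \<A> g J nabla))" by simp
  then show ?thesis using True by (simp add: mobility_def numeral_eq_enat)
next
  case False
  then show ?thesis unfolding mobility_def by (simp only: if_False) simp
qed

context kaehler
begin

lemma mobility_equation_combination:
  assumes A: "A1 \<in> endo_fields \<A>" "A2 \<in> endo_fields \<A>" "s *\<^sub>R A1 + t *\<^sub>R A2 \<in> endo_fields \<A>"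
    and L: "L1 \<in> vector_fields \<A>" "L2 \<in> vector_fields \<A>"
    and eq: "mobility_equation \<A> g J nabla A1 L1" "mobility_equation \<A> g J nabla A2 L2"
  shows "mobility_equation \<A> g J nabla (s *\<^sub>R A1 + t *\<^sub>R A2) (s *\<^sub>R L1 + t *\<^sub>R L2)"
proof -
  have L': "s *\<^sub>R L1 + t *\<^sub>R L2 \<in> vector_fields \<A>" by (intro vector_fields_add vector_fields_scaleR L)
  show ?thesis
    unfolding mobility_equation_iff[OF A(3) L']
  proof (intro ballI)
    fix X Y p assume X: "X \<in> vector_fields \<A>" and Y: "Y \<in> vector_fields \<A>" and p: "p \<in> M"
    note AY = vector_fields_app[OF A(1) Y] vector_fields_app[OF A(2) Y]
    have "app (s *\<^sub>R A1 + t *\<^sub>R A2) Y = s *\<^sub>R app A1 Y + t *\<^sub>R app A2 Y"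
      by (simp add: fun_eq_iff app_def scaleR_fun_apply)
    then have "nabla X (app (s *\<^sub>R A1 + t *\<^sub>R A2) Y) = s *\<^sub>R nabla X (app A1 Y) + t *\<^sub>R nabla X (app A2 Y)"
      using nabla_add[OF X vector_fields_scaleR[OF AY(1)] vector_fields_scaleR[OF AY(2)]]
        nabla_scaleR[OF X AY(1)] nabla_scaleR[OF X AY(2)] by simp
    moreover have "nabla X (app A1 Y) p = A1 p (nabla X Y p) + mobility_term p (X p) (L1 p) (Y p)"
      "nabla X (app A2 Y) p = A2 p (nabla X Y p) + mobility_term p (X p) (L2 p) (Y p)"
      using eq X Y p unfolding mobility_equation_iff[OF A(1) L(1)] mobility_equation_iff[OF A(2) L(2)] by blast+
    moreover have "mobility_term p (X p) ((s *\<^sub>R L1 + t *\<^sub>R L2) p) (Y p) =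
        s *\<^sub>R mobility_term p (X p) (L1 p) (Y p) + t *\<^sub>R mobility_term p (X p) (L2 p) (Y p)"
      using p vector_field_tangent[OF X, of p] vector_field_tangent[OF Y, of p]
        vector_field_tangent[OF L(1), of p] vector_field_tangent[OF L(2), of p]
      by (simp add: mobility_term_def scaleR_fun_apply metric_add_left metric_scale_left
          endo_add[OF J_endo] endo_scale[OF J_endo] endo_tangent[OF J_endo] tangent_smul algebra_simps)
    ultimately show "nabla X (app (s *\<^sub>R A1 + t *\<^sub>R A2) Y) p = (s *\<^sub>R A1 + t *\<^sub>R A2) p (nabla X Y p)
        + mobility_term p (X p) ((s *\<^sub>R L1 + t *\<^sub>R L2) p) (Y p)"
      by (simp add: scaleR_fun_apply algebra_simps)
  qed
qed

lemma nonzero_tangent: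
  assumes "p \<in> M"
  obtains v where "v \<in> T p" "v \<noteq> 0"
proof -
  obtain U \<phi> where U: "(U, \<phi>) \<in> \<A>" "p \<in> U" using assms by (auto simp: manifold_carrier_def)
  obtain i :: 'e where "i \<in> Basis" using nonempty_Basis by blast
  then show thesis
    using that[OF chart_vec_tangent[OF U, of i]] chart_vec_eq_0_iff[OF U, of i] nonzero_Basis by blast
qed

text \<open>Pairing with the two vectors is a linear map into a plane, which cannot be injective in
  dimension at least 3.\<close>

lemma tangent_orthogonal_pair:
  assumes p: "p \<in> M" and dim: "DIM('e) \<ge> 3" and x: "x \<in> T p" "y \<in> T p"
  obtains v where "v \<in> T p" "v \<noteq> 0" "g p x v = 0" "g p y v = 0"
proof -
  obtain U \<phi> where U: "(U, \<phi>) \<in> \<A>" "p \<in> U" using p by (auto simp: manifold_carrier_def)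
  note t = chart_vec_tangent[OF U]
  let ?f = "\<lambda>u. (g p x (chart_vec U \<phi> p u), g p y (chart_vec U \<phi> p u))"
  have lin: "linear ?f"
    by (rule linearI) (simp_all add: chart_vec_linear[OF U] metric_add_right metric_scale_right p t x)
  have "\<not> inj ?f"
  proof
    assume "inj ?f"
    then have "dim (range ?f) = DIM('e)" using dim_image_eq[OF lin, of UNIV] by simp
    moreover have "dim (range ?f) \<le> DIM(real \<times> real)" by (rule dim_subset_UNIV)
    ultimately show False using dim by simp
  qed
  then obtain u where "u \<noteq> 0" "?f u = 0" using linear_injective_0[OF lin] by blast
  then show thesis
    using that[OF t[of u]] chart_vec_eq_0_iff[OF U, of u] by (simp add: zero_prod_def)
qed

end

section \<open>From linear dependence of the square to a quadratic system\<close>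

context extended_system
begin

text \<open>A multiple of the identity satisfies the mobility equation with the zero field, and the
  field is unique, contrary to \<Lambda> not vanishing identically.\<close>

lemma A_not_scalar: "A \<noteq> c *\<^sub>R id_endo"
proof
  assume "A = c *\<^sub>R id_endo"
  then have eq: "A = c *\<^sub>R id_endo + 0 *\<^sub>R A" by simp
  have "mobility_equation \<A> g J nabla (c *\<^sub>R id_endo + 0 *\<^sub>R A) (c *\<^sub>R 0 + 0 *\<^sub>R \<Lambda>)"
    by (rule mobility_equation_combination[OF id_endo_fields A_endo _ vector_fields_zero L
          id_endo_mobility_equation mobility_eq]) (simp only: eq[symmetric] A_endo)
  then have "mobility_equation \<A> g J nabla A 0" unfolding eq[symmetric] by simp
  then have "\<Lambda> = 0" by (rule mobility_equation_unique[OF A_endo L vector_fields_zero mobility_eq])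
  then show False using L_nonzero by simp
qed

text \<open>\<open>Id\<close> and \<open>A\<close> are independent solutions, so a solution outside
  their span would raise the mobility to 3.\<close>

lemma Sol_combination:
  assumes small: "\<not> mobility \<A> g J nabla \<ge> 3" and C: "C \<in> Sol \<A> g J nabla"
  obtains s t where "C = s *\<^sub>R id_endo + t *\<^sub>R A"
proof -
  have "id_endo \<noteq> (0 :: 'a endo)"
  proof
    obtain p where p: "p \<in> M" "\<Lambda> p \<noteq> 0" using L_nonzero by blast
    assume "id_endo = (0 :: 'a endo)"
    then have "id_endo p (\<Lambda> p) = 0" by simp
    then show False using p vector_field_tangent[OF L, of p] by (simp add: id_endo_def)
  qed
  moreover have "A \<notin> span {id_endo}" using A_not_scalar by (auto simp: span_singleton)
  ultimately have "C \<in> span {id_endo, A}"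
    using three_le_mobility[OF id_endo_Sol A_Sol C] small by blast
  then obtain s t where "C - s *\<^sub>R id_endo = t *\<^sub>R A"
    unfolding span_insert[of id_endo] span_singleton by auto
  then have "C = s *\<^sub>R id_endo + t *\<^sub>R A" by (simp add: algebra_simps)
  then show thesis by (rule that)
qed

text \<open>The shift in \<mu> comes from rewriting \<open>t B A\<close> as
  \<open>B C - B s Id\<close> in the derivative of \<open>t \<Lambda>\<close>.\<close>

lemma combination_extended_system:
  assumes C: "hermitian \<A> g J C" "C = s *\<^sub>R id_endo + t *\<^sub>R A" and t: "t \<noteq> 0"
  shows "extended_system \<A> g J nabla B C (t *\<^sub>R \<Lambda>) (\<lambda>p. t * \<mu> p + - B * s)"
proof unfold_locales
  show "hermitian \<A> g J C" by (rule C(1))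
  show tL: "t *\<^sub>R \<Lambda> \<in> vector_fields \<A>" by (rule vector_fields_scaleR[OF L])
  show "(\<lambda>p. t * \<mu> p + - B * s) \<in> smooth_functions \<A>"
    by (intro smooth_functions_add smooth_functions_mult smooth_functions_const mu)
  have "mobility_equation \<A> g J nabla (s *\<^sub>R id_endo + t *\<^sub>R A) (s *\<^sub>R 0 + t *\<^sub>R \<Lambda>)"
    by (rule mobility_equation_combination[OF id_endo_fields A_endo _ vector_fields_zero L
          id_endo_mobility_equation mobility_eq]) (use hermitian_endo[OF C(1)] C(2) in simp)
  then show "mobility_equation \<A> g J nabla C (t *\<^sub>R \<Lambda>)" by (simp add: C(2))
  show "nabla X (t *\<^sub>R \<Lambda>) p = (t * \<mu> p + - B * s) *\<^sub>R X p + B *\<^sub>R C p (X p)"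
    if X: "X \<in> vector_fields \<A>" for X p
  proof -
    have "id_endo p (X p) = X p"
      using vector_field_tangent[OF X, of p] vector_field_off[OF X, of p] by (auto simp: id_endo_def)
    then show ?thesis
      by (simp add: nabla_scaleR[OF X L] scaleR_fun_apply nabla_L[OF X] C(2) algebra_simps)
  qed
  show "X p (\<lambda>p. t * \<mu> p + - B * s) = 2 * B * g p ((t *\<^sub>R \<Lambda>) p) (X p)"
    if X: "X \<in> vector_fields \<A>" and p: "p \<in> M" for X p
    using tangent_fadd[OF vector_field_tangent[OF X, of p]
        smooth_functions_mult[OF smooth_functions_const[of t] mu] smooth_functions_const[of "- B * s"]]
      tangent_fscale[OF vector_field_tangent[OF X] mu, of p t]
      tangent_const[OF vector_field_tangent[OF X, of p], of "- B * s"] grad_mu[OF X p]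
      metric_scale_left[OF p vector_field_tangent[OF L] vector_field_tangent[OF X], of t]
    by (simp add: scaleR_fun_apply)
  show "\<exists>p\<in>M. (t *\<^sub>R \<Lambda>) p \<noteq> 0" using L_nonzero t by (simp add: scaleR_fun_apply)
qed

text \<open>The second relation compares the vector fields of the two solutions, which agree by
  uniqueness, so \<open>square_field\<close> is \<open>b \<Lambda>\<close>. The third compares the
  covariant derivatives of both sides of that identity.\<close>

lemma quadratic_relations:
  assumes sq: "square_endo B A \<Lambda> = a *\<^sub>R id_endo + b *\<^sub>R A"
  shows "\<And>p v. p \<in> M \<Longrightarrow> v \<in> T p \<Longrightarrow>
      B *\<^sub>R A p (A p v) - b *\<^sub>R A p v - a *\<^sub>R v = rank_endo \<Lambda> p v"
    and "\<And>p. p \<in> M \<Longrightarrow> B *\<^sub>R A p (\<Lambda> p) = (\<mu> p + b) *\<^sub>R \<Lambda> p"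
    and "\<And>p. p \<in> M \<Longrightarrow> B * g p (\<Lambda> p) (\<Lambda> p) = (\<mu> p)\<^sup>2 + b * \<mu> p - a * B"
proof -
  have sq_p: "square_endo B A \<Lambda> p v = a *\<^sub>R v + b *\<^sub>R A p v" if "p \<in> M" "v \<in> T p" for p v
    using that by (simp add: sq scaleR_fun_apply id_endo_def)
  show "B *\<^sub>R A p (A p v) - b *\<^sub>R A p v - a *\<^sub>R v = rank_endo \<Lambda> p v" if "p \<in> M" "v \<in> T p" for p v
    using sq_p[OF that] that by (simp add: square_endo_def algebra_simps)
  have "mobility_equation \<A> g J nabla (a *\<^sub>R id_endo + b *\<^sub>R A) (a *\<^sub>R 0 + b *\<^sub>R \<Lambda>)"
    by (rule mobility_equation_combination[OF id_endo_fields A_endo _ vector_fields_zero L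
          id_endo_mobility_equation mobility_eq])
       (simp add: sq[symmetric] hermitian_endo[OF square_endo_hermitian[OF A L]])
  then have "mobility_equation \<A> g J nabla (square_endo B A \<Lambda>) (b *\<^sub>R \<Lambda>)" by (simp add: sq)
  then have field: "square_field = b *\<^sub>R \<Lambda>"
    by (rule mobility_equation_unique[OF hermitian_endo[OF square_endo_hermitian[OF A L]] square_field
          vector_fields_scaleR[OF L] square_mobility_equation])
  show "B *\<^sub>R A p (\<Lambda> p) = (\<mu> p + b) *\<^sub>R \<Lambda> p" for p
    using fun_cong[OF field, of p] by (simp add: square_field_def scaleR_fun_apply algebra_simps)
  show "B * g p (\<Lambda> p) (\<Lambda> p) = (\<mu> p)\<^sup>2 + b * \<mu> p - a * B" if p: "p \<in> M" for p
  proof -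
    \<comment> \<open>After the terms with \<open>A v\<close> cancel, a scalar multiple of
      \<open>v\<close> remains; any nonzero vector lets the scalar be read off.\<close>
    obtain v where v: "v \<in> T p" "v \<noteq> 0" using nonzero_tangent[OF p] .
    obtain X where X: "X \<in> vector_fields \<A>" "X p = v" using vector_field_extension[OF p v(1)] .
    have "nabla X square_field p = b *\<^sub>R (\<mu> p *\<^sub>R v + B *\<^sub>R A p v)"
      unfolding field nabla_scaleR[OF X(1) L] by (simp add: scaleR_fun_apply nabla_L[OF X(1)] X(2))
    then have "(B * g p (\<Lambda> p) (\<Lambda> p) - (\<mu> p)\<^sup>2) *\<^sub>R v + B *\<^sub>R (a *\<^sub>R v + b *\<^sub>R A p v)
        = b *\<^sub>R (\<mu> p *\<^sub>R v + B *\<^sub>R A p v)"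
      unfolding nabla_square_field[OF X(1) p] X(2) sq_p[OF p v(1)] .
    then have "(B * g p (\<Lambda> p) (\<Lambda> p) - (\<mu> p)\<^sup>2 + B * a - b * \<mu> p) *\<^sub>R v = 0"
      by (simp add: algebra_simps)
    then have "B * g p (\<Lambda> p) (\<Lambda> p) - (\<mu> p)\<^sup>2 + B * a - b * \<mu> p = 0" using v(2) scaleR_eq_0_iff by blast
    then show ?thesis by (simp add: algebra_simps)
  qed
qed

text \<open>For \<open>B = 0\<close> the relations say \<open>\<mu>\<^sup>2 + b\<mu> = 0\<close> and \<open>(\<mu> + b)\<Lambda> = 0\<close>, so \<open>\<mu>\<close> is the constant \<open>-b\<close>, and
  \<open>b = 0\<close> would make the rank two endomorphism \<open>rank_endo \<Lambda>\<close> a multiple of the identity.\<close>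

lemma flat_case:
  assumes conn: "connected M" and dim: "DIM('e) \<ge> 3"
    and sq: "square_endo B A \<Lambda> = a *\<^sub>R id_endo + b *\<^sub>R A" and B: "B = 0"
  shows "b \<noteq> 0" and "\<And>p. p \<in> M \<Longrightarrow> \<mu> p = - b"
proof -
  note rel = quadratic_relations[OF sq]
  obtain p0 where p0: "p0 \<in> M" "\<Lambda> p0 \<noteq> 0" using L_nonzero by blast
  show "b \<noteq> 0"
  proof
    assume b: "b = 0"
    have Lp: "\<Lambda> p0 \<in> T p0" by (rule vector_field_tangent[OF L])
    obtain v where v: "v \<in> T p0" "v \<noteq> 0" "g p0 (\<Lambda> p0) v = 0" "g p0 (J p0 (\<Lambda> p0)) v = 0"
      using tangent_orthogonal_pair[OF p0(1) dim Lp endo_tangent[OF J_endo p0(1) Lp]] .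
    \<comment> \<open>A vector orthogonal to \<Lambda> and \<open>J \<Lambda>\<close> is killed by
      the rank two endomorphism, which forces \<open>a = 0\<close>; then that endomorphism vanishes
      on \<Lambda> too.\<close>
    have "a *\<^sub>R v = 0" using rel(1)[OF p0(1) v(1)] by (simp add: b B rank_endo_def v)
    then have "rank_endo \<Lambda> p0 (\<Lambda> p0) = 0" using rel(1)[OF p0(1) Lp] v(2) by (simp add: b B)
    then have "g p0 (\<Lambda> p0) (\<Lambda> p0) *\<^sub>R \<Lambda> p0 = 0"
      by (simp add: rank_endo_def metric_J_self[OF p0(1) Lp])
    then show False using metric_pos[OF p0(1) Lp p0(2)] p0(2) by simp
  qed
  have mu_values: "\<mu> p \<in> {0, - b}" if "p \<in> M" for p
  proof -
    have "\<mu> p * (\<mu> p + b) = 0" using rel(3)[OF that] by (simp add: B power2_eq_square algebra_simps)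
    then show ?thesis by auto
  qed
  then have "\<mu> ` M \<subseteq> {0, - b}" by blast
  then have "\<mu> constant_on M"
    using continuous_finite_range_constant[OF conn smooth_functions_continuous[OF mu]] finite_subset by blast
  then obtain c where c: "\<And>p. p \<in> M \<Longrightarrow> \<mu> p = c" by (auto simp: constant_on_def)
  have "\<mu> p0 = - b" using rel(2)[OF p0(1)] p0(2) by (simp add: B eq_neg_iff_add_eq_0)
  then show "\<mu> p = - b" if "p \<in> M" for p using c[OF that] c[OF p0(1)] by simp
qed

text \<open>\<open>ev0\<close> must be a globally smooth function, also where \<Lambda> vanishes and
  the eigenvalue equation says nothing. It is therefore solved from a scalar relation, whose form
  depends on whether \<open>B\<close> is 0.\<close>

lemma quadratic_system:
  assumes conn: "connected M" and dim: "DIM('e) \<ge> 3"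
    and sq: "square_endo B A \<Lambda> = a *\<^sub>R id_endo + b *\<^sub>R A"
  obtains ev0 where "quadratic_system \<A> g J nabla B b a A \<Lambda> ev0"
proof (cases "B = 0")
  case B: False
  note rel = quadratic_relations[OF sq]
  \<comment> \<open>Read off from B A \<Lambda> = (\<mu> + b) \<Lambda>.\<close>
  define ev0 where "ev0 p = (1 / B) * \<mu> p + b / B" for p
  have Bev: "B * ev0 p = \<mu> p + b" for p using B by (simp add: ev0_def algebra_simps)
  have "quadratic_system \<A> g J nabla B b a A \<Lambda> ev0"
  proof unfold_locales
    show smooth: "ev0 \<in> smooth_functions \<A>"
      unfolding ev0_def by (intro smooth_functions_add smooth_functions_mult smooth_functions_const mu)
    show "X p ev0 = 2 * g p (\<Lambda> p) (X p)" if X: "X \<in> vector_fields \<A>" and p: "p \<in> M" for X p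
    proof -
      note t = vector_field_tangent[OF X, of p]
      have "X p ev0 = (1 / B) * X p \<mu>"
        unfolding ev0_def
        by (simp only: tangent_fadd[OF t smooth_functions_mult[OF smooth_functions_const mu] smooth_functions_const]
            tangent_fscale[OF t mu] tangent_const[OF t] add_0_right)
      then show ?thesis using grad_mu[OF X p] B by simp
    qed
    show "B * (ev0 p)\<^sup>2 - b * ev0 p - a = g p (\<Lambda> p) (\<Lambda> p)" if p: "p \<in> M" for p
    proof -
      have "B * (B * (ev0 p)\<^sup>2 - b * ev0 p - a) = (B * ev0 p)\<^sup>2 - b * (B * ev0 p) - a * B"
        by (simp add: power2_eq_square algebra_simps)
      also have "\<dots> = B * g p (\<Lambda> p) (\<Lambda> p)"
        unfolding Bev rel(3)[OF p] by (simp add: power2_eq_square algebra_simps)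
      finally show ?thesis using B by simp
    qed
    show "A p (\<Lambda> p) = ev0 p *\<^sub>R \<Lambda> p" if p: "p \<in> M" for p
    proof -
      have "B *\<^sub>R A p (\<Lambda> p) = B *\<^sub>R (ev0 p *\<^sub>R \<Lambda> p)" using rel(2)[OF p] by (simp add: Bev)
      then show ?thesis using B by (simp only: scaleR_cancel_left simp_thms)
    qed
    show "nabla X \<Lambda> p = (B * ev0 p - b) *\<^sub>R X p + B *\<^sub>R A p (X p)" if "X \<in> vector_fields \<A>" for X p
      using nabla_L[OF that] by (simp add: Bev)
  qed (use conn A L rel(1) B L_nonzero in auto)
  then show thesis by (rule that)
next
  case B: True
  note rel = quadratic_relations[OF sq]
  note flat = flat_case[OF conn dim sq B]
  \<comment> \<open>With \<open>B = 0\<close> the function \<mu> is constant and carries no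
    information; instead the linear equation \<open>q(ev0) = |\<Lambda>|^2\<close> is solved for
    \<open>ev0\<close>, using \<open>b \<noteq> 0\<close>.\<close>
  define ev0 where "ev0 p = (- 1 / b) * g p (\<Lambda> p) (\<Lambda> p) + - (a / b)" for p
  have bev: "b * ev0 p = - g p (\<Lambda> p) (\<Lambda> p) - a" for p using flat(1) by (simp add: ev0_def algebra_simps)
  have "quadratic_system \<A> g J nabla B b a A \<Lambda> ev0"
  proof unfold_locales
    show "ev0 \<in> smooth_functions \<A>"
      unfolding ev0_def
      by (intro smooth_functions_add smooth_functions_mult smooth_functions_const metric_smooth L)
    show "X p ev0 = 2 * g p (\<Lambda> p) (X p)" if X: "X \<in> vector_fields \<A>" and p: "p \<in> M" for X p
    proof -
      note t = vector_field_tangent[OF X, of p] and l = vector_field_tangent[OF L, of p]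
      have "X p ev0 = (- 1 / b) * X p (\<lambda>p. g p (\<Lambda> p) (\<Lambda> p))"
        unfolding ev0_def
        by (simp only: tangent_fadd[OF t smooth_functions_mult[OF smooth_functions_const metric_smooth[OF L L]]
            smooth_functions_const] tangent_fscale[OF t metric_smooth[OF L L]] tangent_const[OF t] add_0_right)
      also have "X p (\<lambda>p. g p (\<Lambda> p) (\<Lambda> p)) = - 2 * b * g p (\<Lambda> p) (X p)"
        unfolding nabla_metric[OF X L L p]
        using nabla_L[OF X, of p] flat(2)[OF p] metric_sym[OF p t l] metric_scale_left[OF p t l, of b]
          metric_scale_right[OF p t l, of b] metric_uminus[OF p tangent_smul[OF t, of b] l]
        by (simp add: B)
      finally show ?thesis using flat(1) by simp
    qed
    show "B * (ev0 p)\<^sup>2 - b * ev0 p - a = g p (\<Lambda> p) (\<Lambda> p)" if p: "p \<in> M" for p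
      by (simp add: B bev)
    show "A p (\<Lambda> p) = ev0 p *\<^sub>R \<Lambda> p" if p: "p \<in> M" for p
    proof -
      have l: "\<Lambda> p \<in> T p" by (rule vector_field_tangent[OF L])
      have eq: "- (b *\<^sub>R A p (\<Lambda> p)) - a *\<^sub>R \<Lambda> p = g p (\<Lambda> p) (\<Lambda> p) *\<^sub>R \<Lambda> p"
        using rel(1)[OF p l] metric_J_self[OF p l] by (simp add: B rank_endo_def)
      have "b *\<^sub>R A p (\<Lambda> p) = - (- (b *\<^sub>R A p (\<Lambda> p)) - a *\<^sub>R \<Lambda> p) - a *\<^sub>R \<Lambda> p" by simp
      also have "\<dots> = b *\<^sub>R (ev0 p *\<^sub>R \<Lambda> p)"
        unfolding eq scaleR_scaleR bev by (simp add: scaleR_diff_left)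
      finally show ?thesis using flat(1) by (simp only: scaleR_cancel_left simp_thms)
    qed
    show "nabla X \<Lambda> p = (B * ev0 p - b) *\<^sub>R X p + B *\<^sub>R A p (X p)"
      if "X \<in> vector_fields \<A>" "p \<in> M" for X p
      using nabla_L[OF that(1)] flat(2)[OF that(2)] by (simp add: B)
  qed (use conn A L rel(1) flat(1) L_nonzero in auto)
  then show thesis by (rule that)
qed

lemma few_eigenvalues:
  assumes conn: "connected M" and dim: "DIM('e) \<ge> 3" and small: "\<not> mobility \<A> g J nabla \<ge> 3"
  shows "\<not> ((\<exists>S\<subseteq>nonconstant_eigenvalues \<A> A. card S = 2) \<or> (\<exists>S\<subseteq>constant_eigenvalues \<A> A. card S = 3))"
proof -
  obtain a b where sq: "square_endo B A \<Lambda> = a *\<^sub>R id_endo + b *\<^sub>R A"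
    using Sol_combination[OF small square_Sol] .
  obtain ev0 where "quadratic_system \<A> g J nabla B b a A \<Lambda> ev0"
    using quadratic_system[OF conn dim sq] .
  then interpret quadratic_system \<A> g J nabla B b a A \<Lambda> ev0 .
  show ?thesis using few_nonconstant_eigenvalues few_constant_eigenvalues by blast
qed

end

context manifold
begin

lemma scalar_eigenvalues:
  assumes A: "A = s *\<^sub>R id_endo"
  shows "nonconstant_eigenvalues \<A> A = {}"
    and "constant_eigenvalues \<A> A \<subseteq> {\<lambda>p. if p \<in> M then s else 0}"
proof -
  have val: "ev p = s" if ev: "ev \<in> eigenvalue_functions \<A> A" and p: "p \<in> M" for ev p
  proof -
    obtain v where v: "v \<in> T p" "v \<noteq> 0" "A p v = ev p *\<^sub>R v"
      using ev p by (auto simp: eigenvalue_functions_def)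
    then have "s *\<^sub>R v = ev p *\<^sub>R v" using p by (simp add: A scaleR_fun_apply id_endo_def)
    then show ?thesis using v(2) by (metis scaleR_right_imp_eq)
  qed
  show "nonconstant_eigenvalues \<A> A = {}"
    using val unfolding nonconstant_eigenvalues_def constant_on_def by blast
  show "constant_eigenvalues \<A> A \<subseteq> {\<lambda>p. if p \<in> M then s else 0}"
    using val by (auto simp: constant_eigenvalues_def eigenvalue_functions_def)
qed

end

theorem theorem6:
  fixes \<A> :: "('a::{t2_space,second_countable_topology}, 'e::euclidean_space) atlas"
    and g :: "'a metric" and J :: "'a endo" and nabla :: "'a connection"
    and B :: real and m :: nat
  assumes "kaehler_manifold \<A> g J nabla"
    and "connected (manifold_carrier \<A>)"
    and "DIM('e) = 2 * m" and "2 * m \<ge> 4"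
    and "C_C \<A> g J nabla B"
    and "\<exists>A\<in>Sol \<A> g J nabla.
           (\<exists>S\<subseteq>nonconstant_eigenvalues \<A> A. card S = 2) \<or>
           (\<exists>S\<subseteq>constant_eigenvalues \<A> A. card S = 3)"
  shows "mobility \<A> g J nabla \<ge> 3"
proof (rule ccontr)
  assume small: "\<not> mobility \<A> g J nabla \<ge> 3"
  interpret kaehler \<A> g J nabla
    using assms(1) by unfold_locales (auto simp: kaehler_manifold_def)
  obtain A0 \<Lambda> \<mu> where C: "hermitian \<A> g J A0" "\<Lambda> \<in> vector_fields \<A>" "\<exists>p\<in>M. \<Lambda> p \<noteq> 0"
    "\<mu> \<in> smooth_functions \<A>" "mobility_equation \<A> g J nabla A0 \<Lambda>"
    "\<And>X. X \<in> vector_fields \<A> \<Longrightarrow> nabla X \<Lambda> = fscale \<mu> X + B *\<^sub>R app A0 X"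
    "\<And>X p. X \<in> vector_fields \<A> \<Longrightarrow> p \<in> M \<Longrightarrow> X p \<mu> = 2 * B * flat g \<Lambda> p (X p)"
    using assms(5) unfolding C_C_def by blast
  interpret S0: extended_system \<A> g J nabla B A0 \<Lambda> \<mu>
    by unfold_locales (use C in \<open>simp_all add: flat_def fscale_def app_def scaleR_fun_apply\<close>)
  obtain A where A: "A \<in> Sol \<A> g J nabla" and many: "(\<exists>S\<subseteq>nonconstant_eigenvalues \<A> A. card S = 2) \<or>
      (\<exists>S\<subseteq>constant_eigenvalues \<A> A. card S = 3)"
    using assms(6) by blast
  obtain s t where st: "A = s *\<^sub>R id_endo + t *\<^sub>R A0" using S0.Sol_combination[OF small A] .
  have herm: "hermitian \<A> g J A" using A by (simp add: Sol_def)
  show False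
  proof (cases "t = 0")
    case True
    then have "A = s *\<^sub>R id_endo" using st by simp
    note ev = scalar_eigenvalues[OF this]
    have "card S \<noteq> 2" if "S \<subseteq> nonconstant_eigenvalues \<A> A" for S
      using that by (simp add: ev(1))
    moreover have "card S \<noteq> 3" if "S \<subseteq> constant_eigenvalues \<A> A" for S
      using card_mono[OF _ subset_trans[OF that ev(2)]] by simp
    ultimately show False using many by blast
  next
    case False
    \<comment> \<open>The eigenvalues to be counted are those of \<open>A\<close>, so the system is
      set up anew with \<open>A\<close> in place of \<open>A0\<close>.\<close>
    interpret S: extended_system \<A> g J nabla B A "t *\<^sub>R \<Lambda>" "\<lambda>p. t * \<mu> p + - B * s"
      by (rule S0.combination_extended_system[OF herm st False])
    show False using S.few_eigenvalues[OF assms(2) _ small] assms(3,4) many by simp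
  qed
qed

end
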